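(* Let $d\ge 3$, $r\ge 1$, and let $\mathcal{X}=\mathbb{P}_{fr}^{d-1}(\mathcal{O}_r)$ be the free projective $d$-space over $\mathcal{O}_r=\mathcal{O}/\mathfrak{p}^r$. For every $\varphi\in\mathrm{Aut}^0(\mathcal{X})$ there exist $A\in GL_d(\mathcal{O}_r)$ and $\tau\in\mathrm{Aut}_{Ring}(\mathcal{O}_r)$ such that $\varphi=\varphi_{A,\tau}$, so that $$\mathrm{Aut}^0(\mathcal{X})\cong PGL_d(\mathcal{O}_r)\rtimes \mathrm{Aut}_{Ring}(\mathcal{O}_r),$$ and the full automorphism group of $\mathcal{X}$ is $$\mathrm{Aut}(\mathcal{X})=\mathrm{Aut}^0(\mathcal{X})\rtimes\langle\varphi_\bot\rangle\cong\bigl(PGL_d(\mathcal{O}_r)\rtimes \mathrm{Aut}_{Ring}(\mathcal{O}_r)\bigr)\rtimes(\mathbb{Z}/2\mathbb{Z}).$$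
   Context: Let $\mathcal{O}$ be a Dedekind domain, $\mathfrak{p}\trianglelefteq\mathcal{O}$ a nonzero prime ideal with finite residue field of order $q=|\mathcal{O}/\mathfrak{p}|$, $r\ge1$, and $\mathcal{O}_r=\mathcal{O}/\mathfrak{p}^r$, a finite local ring of size $q^r$. The free projective $d$-space $\mathcal{X}=\mathbb{P}_{fr}^{d-1}(\mathcal{O}_r)$ is the simplicial complex whose vertices are the free submodules $0\lneq V\lneq\mathcal{O}_r^d$, and whose cells are the flags (chains under inclusion) of such free submodules. The color of a vertex is the rank of the corresponding submodule. $\mathrm{Aut}(\mathcal{X})$ is the group of all simplicial automorphisms and $\mathrm{Aut}^0(\mathcal{X})$ the subgroup of color-preserving ones. $\mathrm{Aut}_{Ring}(\mathcal{O}_r)$ is the group of ring automorphisms of $\mathcal{O}_r$, acting entrywise on matrices; $PGL_d(\mathcal{O}_r)=GL_d(\mathcal{O}_r)/\mathcal{O}_r^\times$. For $A\in GL_d(\mathcal{O}_r)$ and $\tau\in\mathrm{Aut}_{Ring}(\mathcal{O}_r)$, let $\overline{\tau}(v)=(\tau(v_1),\ldots,\tau(v_d))^T$, and let $\varphi_{A,\tau}$ be the automorphism $\varphi_{A,\tau}(V)=\{A\overline{\tau}(v)\mid v\in V\}$ of $\mathcal{X}$. Let $\varphi_\bot$ be the automorphism $\varphi_\bot(V)=V^\bot:=\{w\in\mathcal{O}_r^d\mid \forall v\in V:\ \langle v,w\rangle=0\}$, where $\langle\ ,\ \rangle$ is the standard bilinear form on $\mathcal{O}_r^d$. *)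

theory Defs
  imports "HOL-Algebra.Algebra"
begin

text \<open>
  The last assumption says that \<open>R\<close> is integrally closed in its fraction field: it is the monic
  equation \<open>(a/b)^n + (\<Sum>i<n. c\<^sub>i (a/b)^i) = 0\<close> for a fraction \<open>a/b\<close>, multiplied by \<open>b^n\<close>,
  and the conclusion says \<open>a/b \<in> R\<close>.
\<close>

locale dedekind_domain = noetherian_domain R for R (structure) +
  assumes nonzero_prime_maximal:
    "\<lbrakk>primeideal P R; P \<noteq> {\<zero>}\<rbrakk> \<Longrightarrow> maximalideal P R"
  and integrally_closed:
    "\<lbrakk>a \<in> carrier R; b \<in> carrier R; b \<noteq> \<zero>; (0::nat) < n; c \<in> {..<n} \<rightarrow> carrier R;
      (a [^] n) \<oplus> (\<Oplus>i\<in>{..<n}. c i \<otimes> (a [^] i) \<otimes> (b [^] (n - i))) = \<zero>\<rbrakk>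
     \<Longrightarrow> \<exists>q\<in>carrier R. a = b \<otimes> q"

definition quot_power :: "('a, 'm) ring_scheme \<Rightarrow> 'a set \<Rightarrow> nat \<Rightarrow> 'a set ring" where
  "quot_power R P r = R Quot (P [^]\<^bsub>ideals_set R\<^esub> r)"

text \<open>
  The module \<open>R^d\<close> of column vectors, indexed by \<open>{..<d}\<close>.  The record type of modules extends
  that of rings; its fields \<open>mult\<close> and \<open>one\<close> have no meaning for a module.
\<close>

definition vec_module :: "('a, 'm) ring_scheme \<Rightarrow> nat \<Rightarrow> ('a, nat \<Rightarrow> 'a) module" where
  "vec_module R d =
    \<lparr>carrier = {..<d} \<rightarrow>\<^sub>E carrier R,
     monoid.mult = undefined,
     one = undefined,
     ring.zero = (\<lambda>i\<in>{..<d}. \<zero>\<^bsub>R\<^esub>),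
     ring.add = (\<lambda>v w. \<lambda>i\<in>{..<d}. v i \<oplus>\<^bsub>R\<^esub> w i),
     smult = (\<lambda>c v. \<lambda>i\<in>{..<d}. c \<otimes>\<^bsub>R\<^esub> v i)\<rparr>"

definition is_basis ::
  "('a, 'm) ring_scheme \<Rightarrow> ('a, 'v, 'n) module_scheme \<Rightarrow> 'v set \<Rightarrow> nat \<Rightarrow> (nat \<Rightarrow> 'v) \<Rightarrow> bool" where
  "is_basis R M V k b \<longleftrightarrow>
    b \<in> {..<k} \<rightarrow> V \<and>
    (\<forall>v\<in>V. \<exists>!c. c \<in> {..<k} \<rightarrow>\<^sub>E carrier R \<and> v = (\<Oplus>\<^bsub>M\<^esub>i\<in>{..<k}. c i \<odot>\<^bsub>M\<^esub> b i))"

text \<open>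
  Only finite bases are considered; over a finite ring, submodules of \<open>R^d\<close> admit no others.
\<close>

definition free_submodule ::
  "('a, 'm) ring_scheme \<Rightarrow> ('a, 'v, 'n) module_scheme \<Rightarrow> 'v set \<Rightarrow> bool" where
  "free_submodule R M V \<longleftrightarrow> submodule V R M \<and> (\<exists>k b. is_basis R M V k b)"

text \<open>Over a nontrivial commutative ring all bases of a free module have the same size.\<close>

definition free_rank ::
  "('a, 'm) ring_scheme \<Rightarrow> ('a, 'v, 'n) module_scheme \<Rightarrow> 'v set \<Rightarrow> nat" where
  "free_rank R M V = (THE k. \<exists>b. is_basis R M V k b)"

text \<open>
  A complex is given by its set of vertices and its set of cells.  A bijection of the vertices
  that maps the set of cells onto itself is one which is simplicial together with its inverse.
\<close>

definition simplicial_auts :: "'v set \<Rightarrow> 'v set set \<Rightarrow> ('v \<Rightarrow> 'v) set" where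
  "simplicial_auts vs cells = {\<phi> \<in> Bij vs. (\<lambda>C. \<phi> ` C) ` cells = cells}"

definition simplicial_Aut :: "'v set \<Rightarrow> 'v set set \<Rightarrow> ('v \<Rightarrow> 'v) monoid" where
  "simplicial_Aut vs cells = (BijGroup vs)\<lparr>carrier := simplicial_auts vs cells\<rparr>"

definition fr_vertices :: "('a, 'm) ring_scheme \<Rightarrow> nat \<Rightarrow> (nat \<Rightarrow> 'a) set set" where
  "fr_vertices R d =
    {V. free_submodule R (vec_module R d) V \<and>
        V \<noteq> {\<zero>\<^bsub>vec_module R d\<^esub>} \<and> V \<noteq> carrier (vec_module R d)}"

definition fr_flags :: "('a, 'm) ring_scheme \<Rightarrow> nat \<Rightarrow> (nat \<Rightarrow> 'a) set set set" where
  "fr_flags R d = {C. C \<subseteq> fr_vertices R d \<and> (\<forall>V\<in>C. \<forall>W\<in>C. V \<subseteq> W \<or> W \<subseteq> V)}"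

definition fr_color :: "('a, 'm) ring_scheme \<Rightarrow> nat \<Rightarrow> (nat \<Rightarrow> 'a) set \<Rightarrow> nat" where
  "fr_color R d V = free_rank R (vec_module R d) V"

definition fr_Aut ::
  "('a, 'm) ring_scheme \<Rightarrow> nat \<Rightarrow> ((nat \<Rightarrow> 'a) set \<Rightarrow> (nat \<Rightarrow> 'a) set) monoid" where
  "fr_Aut R d = simplicial_Aut (fr_vertices R d) (fr_flags R d)"

definition fr_auts0 ::
  "('a, 'm) ring_scheme \<Rightarrow> nat \<Rightarrow> ((nat \<Rightarrow> 'a) set \<Rightarrow> (nat \<Rightarrow> 'a) set) set" where
  "fr_auts0 R d =
    {\<phi> \<in> carrier (fr_Aut R d). \<forall>V\<in>fr_vertices R d. fr_color R d (\<phi> V) = fr_color R d V}"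

definition fr_Aut0 ::
  "('a, 'm) ring_scheme \<Rightarrow> nat \<Rightarrow> ((nat \<Rightarrow> 'a) set \<Rightarrow> (nat \<Rightarrow> 'a) set) monoid" where
  "fr_Aut0 R d = (fr_Aut R d)\<lparr>carrier := fr_auts0 R d\<rparr>"

definition mat_monoid :: "('a, 'm) ring_scheme \<Rightarrow> nat \<Rightarrow> (nat \<times> nat \<Rightarrow> 'a) monoid" where
  "mat_monoid R d =
    \<lparr>carrier = {..<d} \<times> {..<d} \<rightarrow>\<^sub>E carrier R,
     monoid.mult = (\<lambda>A B. \<lambda>(i, j)\<in>{..<d} \<times> {..<d}. \<Oplus>\<^bsub>R\<^esub>k\<in>{..<d}. A (i, k) \<otimes>\<^bsub>R\<^esub> B (k, j)),
     one = (\<lambda>(i, j)\<in>{..<d} \<times> {..<d}. if i = j then \<one>\<^bsub>R\<^esub> else \<zero>\<^bsub>R\<^esub>)\<rparr>"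

definition GL :: "('a, 'm) ring_scheme \<Rightarrow> nat \<Rightarrow> (nat \<times> nat \<Rightarrow> 'a) monoid" where
  "GL R d = units_of (mat_monoid R d)"

definition scalar_mats :: "('a, 'm) ring_scheme \<Rightarrow> nat \<Rightarrow> (nat \<times> nat \<Rightarrow> 'a) set" where
  "scalar_mats R d =
    (\<lambda>u. \<lambda>(i, j)\<in>{..<d} \<times> {..<d}. if i = j then u else \<zero>\<^bsub>R\<^esub>) ` Units R"

definition PGL :: "('a, 'm) ring_scheme \<Rightarrow> nat \<Rightarrow> (nat \<times> nat \<Rightarrow> 'a) set monoid" where
  "PGL R d = GL R d Mod scalar_mats R d"

definition ring_Aut :: "('a, 'm) ring_scheme \<Rightarrow> ('a \<Rightarrow> 'a) monoid" where
  "ring_Aut R = (BijGroup (carrier R))\<lparr>carrier := ring_hom R R \<inter> Bij (carrier R)\<rparr>"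

definition mat_map :: "nat \<Rightarrow> ('a \<Rightarrow> 'a) \<Rightarrow> (nat \<times> nat \<Rightarrow> 'a) \<Rightarrow> (nat \<times> nat \<Rightarrow> 'a)" where
  "mat_map d \<tau> A = (\<lambda>(i, j)\<in>{..<d} \<times> {..<d}. \<tau> (A (i, j)))"

definition mat_transpose :: "nat \<Rightarrow> (nat \<times> nat \<Rightarrow> 'a) \<Rightarrow> (nat \<times> nat \<Rightarrow> 'a)" where
  "mat_transpose d A = (\<lambda>(i, j)\<in>{..<d} \<times> {..<d}. A (j, i))"

definition vec_map :: "nat \<Rightarrow> ('a \<Rightarrow> 'a) \<Rightarrow> (nat \<Rightarrow> 'a) \<Rightarrow> (nat \<Rightarrow> 'a)" where
  "vec_map d \<tau> v = (\<lambda>i\<in>{..<d}. \<tau> (v i))"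

definition mat_vec ::
  "('a, 'm) ring_scheme \<Rightarrow> nat \<Rightarrow> (nat \<times> nat \<Rightarrow> 'a) \<Rightarrow> (nat \<Rightarrow> 'a) \<Rightarrow> (nat \<Rightarrow> 'a)" where
  "mat_vec R d A v = (\<lambda>i\<in>{..<d}. \<Oplus>\<^bsub>R\<^esub>j\<in>{..<d}. A (i, j) \<otimes>\<^bsub>R\<^esub> v j)"

definition std_form ::
  "('a, 'm) ring_scheme \<Rightarrow> nat \<Rightarrow> (nat \<Rightarrow> 'a) \<Rightarrow> (nat \<Rightarrow> 'a) \<Rightarrow> 'a" where
  "std_form R d v w = (\<Oplus>\<^bsub>R\<^esub>i\<in>{..<d}. v i \<otimes>\<^bsub>R\<^esub> w i)"

definition phi_semilinear ::
  "('a, 'm) ring_scheme \<Rightarrow> nat \<Rightarrow> (nat \<times> nat \<Rightarrow> 'a) \<Rightarrow> ('a \<Rightarrow> 'a) \<Rightarrow>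
     (nat \<Rightarrow> 'a) set \<Rightarrow> (nat \<Rightarrow> 'a) set" where
  "phi_semilinear R d A \<tau> = (\<lambda>V\<in>fr_vertices R d. (\<lambda>v. mat_vec R d A (vec_map d \<tau> v)) ` V)"

definition phi_perp ::
  "('a, 'm) ring_scheme \<Rightarrow> nat \<Rightarrow> (nat \<Rightarrow> 'a) set \<Rightarrow> (nat \<Rightarrow> 'a) set" where
  "phi_perp R d =
    (\<lambda>V\<in>fr_vertices R d.
       {w \<in> carrier (vec_module R d). \<forall>v\<in>V. std_form R d v w = \<zero>\<^bsub>R\<^esub>})"

text \<open>
  The external product \<open>G \<rtimes>\<^sub>\<alpha> H\<close>, where \<open>\<alpha> h\<close> is the automorphism of \<open>G\<close> by which \<open>h\<close> acts.
\<close>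

definition semidirect ::
  "('g, 'm) monoid_scheme \<Rightarrow> ('h, 'n) monoid_scheme \<Rightarrow> ('h \<Rightarrow> 'g \<Rightarrow> 'g) \<Rightarrow> ('g \<times> 'h) monoid" where
  "semidirect G H \<alpha> =
    \<lparr>carrier = carrier G \<times> carrier H,
     monoid.mult = (\<lambda>(g, h) (g', h'). (g \<otimes>\<^bsub>G\<^esub> \<alpha> h g', h \<otimes>\<^bsub>H\<^esub> h')),
     one = (\<one>\<^bsub>G\<^esub>, \<one>\<^bsub>H\<^esub>)\<rparr>"

definition is_internal_semidirect ::
  "('g, 'm) monoid_scheme \<Rightarrow> 'g set \<Rightarrow> 'g set \<Rightarrow> bool" where
  "is_internal_semidirect G N H \<longleftrightarrow>
    N \<lhd> G \<and> subgroup H G \<and> N \<inter> H = {\<one>\<^bsub>G\<^esub>} \<and> N <#>\<^bsub>G\<^esub> H = carrier G"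

text \<open>
  \<open>PGammaL R d\<close> is \<open>PGL\<^sub>d(R) \<rtimes> Aut\<^sub>R\<^sub>i\<^sub>n\<^sub>g(R)\<close>.
  Elements of \<open>PGL\<close> are cosets, that is, sets of matrices.  The actions below are the entrywise
  action of ring automorphisms and the inverse transpose, applied to all members of a coset.
\<close>

definition PGammaL ::
  "('a, 'm) ring_scheme \<Rightarrow> nat \<Rightarrow> ((nat \<times> nat \<Rightarrow> 'a) set \<times> ('a \<Rightarrow> 'a)) monoid" where
  "PGammaL R d = semidirect (PGL R d) (ring_Aut R) (\<lambda>\<tau> C. mat_map d \<tau> ` C)"

definition inv_transpose_action ::
  "('a, 'm) ring_scheme \<Rightarrow> nat \<Rightarrow> int \<Rightarrow>
     (nat \<times> nat \<Rightarrow> 'a) set \<times> ('a \<Rightarrow> 'a) \<Rightarrow> (nat \<times> nat \<Rightarrow> 'a) set \<times> ('a \<Rightarrow> 'a)" where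
  "inv_transpose_action R d \<epsilon> = (\<lambda>(C, \<tau>).
     (if \<epsilon> = 0 then C else (\<lambda>B. mat_transpose d (inv\<^bsub>GL R d\<^esub> B)) ` C, \<tau>))"

end

theory Submission
  imports Defs
begin

text \<open>
  The ring \<open>S = R/P\<^sup>r\<close> is used only through an element \<open>s \<noteq> 0\<close> that is annihilated by every
  non-unit.  Such an \<open>s\<close> makes every free submodule of \<open>S\<^sup>d\<close> the image of a coordinate subspace
  under a linear automorphism, and the condition \<open>s v \<in> V\<close> expresses that \<open>v\<close> lies in \<open>V\<close> modulo
  the maximal ideal.  Two distinct points agree modulo the maximal ideal iff no unique free
  submodule of rank 2 contains both, so an inclusion-preserving automorphism respects this relation
  and therefore the join of an independent point and submodule.  After composition with a linear map
  it fixes the points of a projective frame; the classical coordinatization then gives one function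
  \<open>\<tau>\<close> on all coordinates, and incidence in planes shows that \<open>\<tau>\<close> is a ring automorphism.

  For the full group, points and hyperplanes are recognized in the comparability graph.  An
  automorphism that maps one point to a point does so for all points and preserves inclusion;
  otherwise its composition with \<open>\<bottom>\<close> does.
\<close>


section \<open>Free modules and linear automorphisms\<close>

text \<open>Bases replace them: nested free submodules have a common adapted basis, so an equality
  can be obtained from one inclusion, checked on generators, and a comparison of ranks.
  Multiplication by \<open>s\<close> vanishes exactly on the non-units, so conditions on
  \<open>s\<close> v speak about the reduction of \<open>v\<close> to the residue field without
  leaving the module. In particular injectivity of a linear map forces the existence of an
  invertible pivot, which makes elimination work as over a field. Coordinates with respect to a
  frame are directly available only for vectors with first coordinate 1. The remaining points,
  including those whose first coordinate is a nonzero non-unit, are located as intersections of two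
  joins. These joins, and the readings of sum and product, take place in the span of e_0, e_i, e_j
  with two different nonzero indices; this is where \<open>d \<ge> 3\<close> enters.\<close>

locale socle_module = cring S for S (structure) +
  fixes d :: nat and s :: 'a
  assumes d_ge_3: "d \<ge> 3"
    and socle_closed [simp, intro]: "s \<in> carrier S"
    and socle_nonzero: "s \<noteq> \<zero>"
    and Unit_or_annihilates_socle: "x \<in> carrier S \<Longrightarrow> x \<in> Units S \<or> s \<otimes> x = \<zero>"
begin

abbreviation "M \<equiv> vec_module S d"

lemma vec_add_nth [simp]: "i < d \<Longrightarrow> (v \<oplus>\<^bsub>M\<^esub> w) i = v i \<oplus> w i"
  by (simp add: vec_module_def)

lemma vec_smult_nth [simp]: "i < d \<Longrightarrow> (c \<odot>\<^bsub>M\<^esub> v) i = c \<otimes> v i"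
  by (simp add: vec_module_def)

lemma vec_zero_nth [simp]: "i < d \<Longrightarrow> \<zero>\<^bsub>M\<^esub> i = \<zero>"
  by (simp add: vec_module_def)

lemma vec_nth_closed [simp, intro]: "v \<in> carrier M \<Longrightarrow> i < d \<Longrightarrow> v i \<in> carrier S"
  by (auto simp: vec_module_def)

lemma vec_closedI: "(\<And>i. i < d \<Longrightarrow> f i \<in> carrier S) \<Longrightarrow> (\<lambda>i\<in>{..<d}. f i) \<in> carrier M"
  by (auto simp: vec_module_def)

lemma vec_eqI: "v \<in> carrier M \<Longrightarrow> w \<in> carrier M \<Longrightarrow> (\<And>i. i < d \<Longrightarrow> v i = w i) \<Longrightarrow> v = w"
  by (auto simp: vec_module_def intro: PiE_ext)

lemma vec_add_closed: "v \<in> carrier M \<Longrightarrow> w \<in> carrier M \<Longrightarrow> v \<oplus>\<^bsub>M\<^esub> w \<in> carrier M"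
  by (auto simp: vec_module_def PiE_iff)

lemma vec_smult_closed: "c \<in> carrier S \<Longrightarrow> w \<in> carrier M \<Longrightarrow> c \<odot>\<^bsub>M\<^esub> w \<in> carrier M"
  by (auto simp: vec_module_def PiE_iff)

lemma vec_zero_closed: "\<zero>\<^bsub>M\<^esub> \<in> carrier M"
  by (auto simp: vec_module_def PiE_iff)

lemma vec_minus_closed: "v \<in> carrier M \<Longrightarrow> (\<lambda>i\<in>{..<d}. \<ominus> v i) \<in> carrier M"
  by (intro vec_closedI) simp

lemma abelian_group_vec: "abelian_group M"
proof (rule abelian_groupI)
  fix x assume x: "x \<in> carrier M"
  show "\<exists>y\<in>carrier M. y \<oplus>\<^bsub>M\<^esub> x = \<zero>\<^bsub>M\<^esub>"
    by (rule bexI[OF _ vec_minus_closed[OF x]])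
       (auto intro!: vec_eqI vec_add_closed vec_zero_closed vec_minus_closed x simp: l_neg x)
qed (auto intro!: vec_eqI vec_add_closed vec_zero_closed simp: a_ac)

sublocale vec: module S M
  by (rule moduleI[OF is_cring abelian_group_vec])
     (auto intro!: vec_eqI vec_add_closed vec_smult_closed simp: l_distr r_distr m_assoc)

definition unit_vec :: "nat \<Rightarrow> nat \<Rightarrow> 'a" where
  "unit_vec i = (\<lambda>j\<in>{..<d}. if j = i then \<one> else \<zero>)"

lemma unit_vec_closed [simp, intro]: "unit_vec i \<in> carrier M"
  unfolding unit_vec_def by (intro vec_closedI) simp

lemma unit_vec_nth [simp]: "j < d \<Longrightarrow> unit_vec i j = (if j = i then \<one> else \<zero>)"
  by (simp add: unit_vec_def)

definition coord_space :: "nat set \<Rightarrow> (nat \<Rightarrow> 'a) set" where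
  "coord_space I = {v \<in> carrier M. \<forall>i<d. i \<notin> I \<longrightarrow> v i = \<zero>}"

abbreviation std_space :: "nat \<Rightarrow> (nat \<Rightarrow> 'a) set" where
  "std_space k \<equiv> coord_space {..<k}"

lemma coord_space_closed: "v \<in> coord_space I \<Longrightarrow> v \<in> carrier M"
  by (simp add: coord_space_def)

lemma coord_space_nth: "v \<in> coord_space I \<Longrightarrow> i < d \<Longrightarrow> i \<notin> I \<Longrightarrow> v i = \<zero>"
  by (simp add: coord_space_def)

lemma coord_space_add: "v \<in> coord_space I \<Longrightarrow> w \<in> coord_space I \<Longrightarrow> v \<oplus>\<^bsub>M\<^esub> w \<in> coord_space I"
  by (auto simp: coord_space_def)

lemma coord_space_smult: "c \<in> carrier S \<Longrightarrow> w \<in> coord_space I \<Longrightarrow> c \<odot>\<^bsub>M\<^esub> w \<in> coord_space I"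
  by (auto simp: coord_space_def)

lemma coord_space_mono: "I \<subseteq> J \<Longrightarrow> coord_space I \<subseteq> coord_space J"
  by (auto simp: coord_space_def)

lemma unit_vec_in_coord_space: "i \<in> I \<Longrightarrow> unit_vec i \<in> coord_space I"
  by (auto simp: coord_space_def)

lemma std_space_full: "std_space d = carrier M"
  by (auto simp: coord_space_def)

lemma coord_space_empty [simp]: "coord_space {} = {\<zero>\<^bsub>M\<^esub>}"
  by (auto simp: coord_space_def intro: vec_eqI)

lemma one_neq_zero: "\<one> \<noteq> \<zero>"
  using socle_nonzero socle_closed r_one r_null by metis

text \<open>A unit cannot kill the nonzero \<open>s\<close>, and every other element does so by the
  locale assumption. Invertibility thus becomes a nonvanishing condition for the linear map
  \<open>s \<otimes> _\<close>, which is how pivots are found later.\<close>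

lemma Unit_iff: "x \<in> carrier S \<Longrightarrow> x \<in> Units S \<longleftrightarrow> s \<otimes> x \<noteq> \<zero>"
proof -
  assume x: "x \<in> carrier S"
  have "s \<otimes> x \<noteq> \<zero>" if u: "x \<in> Units S"
  proof
    assume "s \<otimes> x = \<zero>"
    then have "(s \<otimes> x) \<otimes> inv x = \<zero>" using u by simp
    then have "s = \<zero>" using u x by (simp add: m_assoc)
    then show False using socle_nonzero by simp
  qed
  then show ?thesis using Unit_or_annihilates_socle[OF x] by blast
qed

text \<open>The domain is a parameter because the map that a basis defines on coefficients is only
  given on a subspace \<open>std_space k\<close>; turning it into an automorphism is the task of
  \<open>extend_linear_injection\<close>.\<close>

definition linear_on :: "(nat \<Rightarrow> 'a) set \<Rightarrow> ((nat \<Rightarrow> 'a) \<Rightarrow> nat \<Rightarrow> 'a) \<Rightarrow> bool" where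
  "linear_on D f \<longleftrightarrow> f \<in> D \<rightarrow> carrier M \<and>
     (\<forall>v\<in>D. \<forall>w\<in>D. f (v \<oplus>\<^bsub>M\<^esub> w) = f v \<oplus>\<^bsub>M\<^esub> f w) \<and>
     (\<forall>c\<in>carrier S. \<forall>v\<in>D. f (c \<odot>\<^bsub>M\<^esub> v) = c \<odot>\<^bsub>M\<^esub> f v)"

text \<open>\<open>\<tau>\<close> is an arbitrary function on scalars. Being a ring automorphism is
  a separate hypothesis, so that linear maps, inverses and composites share one notion and
  properties of the scalar map can also be deduced, as in
  \<open>semilinear_fixing_lines\<close>.\<close>

definition semilinear :: "('a \<Rightarrow> 'a) \<Rightarrow> ((nat \<Rightarrow> 'a) \<Rightarrow> nat \<Rightarrow> 'a) \<Rightarrow> bool" where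
  "semilinear \<tau> f \<longleftrightarrow> bij_betw f (carrier M) (carrier M) \<and>
     (\<forall>v\<in>carrier M. \<forall>w\<in>carrier M. f (v \<oplus>\<^bsub>M\<^esub> w) = f v \<oplus>\<^bsub>M\<^esub> f w) \<and>
     (\<forall>c\<in>carrier S. \<forall>v\<in>carrier M. f (c \<odot>\<^bsub>M\<^esub> v) = \<tau> c \<odot>\<^bsub>M\<^esub> f v)"

abbreviation "lin_aut \<equiv> semilinear (\<lambda>c. c)"

lemma semilinear_bij: "semilinear \<tau> f \<Longrightarrow> bij_betw f (carrier M) (carrier M)"
  by (simp add: semilinear_def)

lemma semilinear_closed [intro]: "semilinear \<tau> f \<Longrightarrow> v \<in> carrier M \<Longrightarrow> f v \<in> carrier M"
  by (auto simp: semilinear_def bij_betw_def)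

lemma semilinear_inj: "semilinear \<tau> f \<Longrightarrow> inj_on f (carrier M)"
  by (auto simp: semilinear_def bij_betw_def)

lemma semilinear_eq_iff:
  "semilinear \<tau> f \<Longrightarrow> v \<in> carrier M \<Longrightarrow> w \<in> carrier M \<Longrightarrow> f v = f w \<longleftrightarrow> v = w"
  using semilinear_inj by (auto simp: inj_on_def)

lemma semilinear_add:
  "semilinear \<tau> f \<Longrightarrow> v \<in> carrier M \<Longrightarrow> w \<in> carrier M \<Longrightarrow> f (v \<oplus>\<^bsub>M\<^esub> w) = f v \<oplus>\<^bsub>M\<^esub> f w"
  by (auto simp: semilinear_def)

lemma semilinear_smult:
  "semilinear \<tau> f \<Longrightarrow> c \<in> carrier S \<Longrightarrow> v \<in> carrier M \<Longrightarrow> f (c \<odot>\<^bsub>M\<^esub> v) = \<tau> c \<odot>\<^bsub>M\<^esub> f v"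
  by (auto simp: semilinear_def)

lemma semilinear_cong:
  "semilinear \<tau> f \<Longrightarrow> (\<And>c. c \<in> carrier S \<Longrightarrow> \<tau> c = \<rho> c) \<Longrightarrow> semilinear \<rho> f"
  by (auto simp: semilinear_def)

lemma semilinear_comp:
  assumes f: "semilinear \<tau> f" and g: "semilinear \<rho> g" and \<rho>: "\<rho> \<in> carrier S \<rightarrow> carrier S"
  shows "semilinear (\<lambda>c. \<tau> (\<rho> c)) (f \<circ> g)"
  unfolding semilinear_def
proof (intro conjI ballI)
  show "bij_betw (f \<circ> g) (carrier M) (carrier M)"
    using f g bij_betw_trans semilinear_bij by blast
  show "(f \<circ> g) (v \<oplus>\<^bsub>M\<^esub> w) = (f \<circ> g) v \<oplus>\<^bsub>M\<^esub> (f \<circ> g) w"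
    if "v \<in> carrier M" "w \<in> carrier M" for v w
    using that semilinear_closed[OF g] by (simp add: semilinear_add[OF f] semilinear_add[OF g])
  show "(f \<circ> g) (c \<odot>\<^bsub>M\<^esub> v) = \<tau> (\<rho> c) \<odot>\<^bsub>M\<^esub> (f \<circ> g) v"
    if "c \<in> carrier S" "v \<in> carrier M" for c v
    using that funcset_mem[OF \<rho>] semilinear_closed[OF g]
    by (simp add: semilinear_smult[OF f] semilinear_smult[OF g])
qed

lemma lin_aut_comp: "lin_aut f \<Longrightarrow> lin_aut g \<Longrightarrow> lin_aut (f \<circ> g)"
  using semilinear_comp[of "\<lambda>c. c" f "\<lambda>c. c" g] by auto

lemma semilinear_inv:
  assumes f: "semilinear \<tau> f" and \<rho>: "\<And>c. c \<in> carrier S \<Longrightarrow> \<rho> c \<in> carrier S \<and> \<tau> (\<rho> c) = c"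
  shows "semilinear \<rho> (inv_into (carrier M) f)"
  unfolding semilinear_def
proof (intro conjI ballI)
  let ?g = "inv_into (carrier M) f"
  show bij: "bij_betw ?g (carrier M) (carrier M)"
    using f bij_betw_inv_into semilinear_bij by blast
  have fg: "f (?g v) = v" if "v \<in> carrier M" for v
    using semilinear_bij[OF f] that bij_betw_inv_into_right by metis
  have gc: "?g v \<in> carrier M" if "v \<in> carrier M" for v
    using bij that by (auto simp: bij_betw_def)
  show "?g (v \<oplus>\<^bsub>M\<^esub> w) = ?g v \<oplus>\<^bsub>M\<^esub> ?g w" if "v \<in> carrier M" "w \<in> carrier M" for v w
    by (subst semilinear_eq_iff[OF f, symmetric])
       (use that in \<open>auto simp: semilinear_add[OF f] fg gc\<close>)
  show "?g (c \<odot>\<^bsub>M\<^esub> v) = \<rho> c \<odot>\<^bsub>M\<^esub> ?g v" if "c \<in> carrier S" "v \<in> carrier M" for c v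
    by (subst semilinear_eq_iff[OF f, symmetric])
       (use that \<rho>[OF that(1)] in \<open>auto simp: semilinear_smult[OF f] fg gc\<close>)
qed

abbreviation "inv_on_vecs f \<equiv> inv_into (carrier M) f"

lemma lin_aut_inv: "lin_aut f \<Longrightarrow> lin_aut (inv_on_vecs f)"
  by (rule semilinear_inv) auto

lemma inv_on_vecs_right: "semilinear \<tau> f \<Longrightarrow> v \<in> carrier M \<Longrightarrow> f (inv_on_vecs f v) = v"
  using semilinear_bij bij_betw_inv_into_right by metis

lemma inv_on_vecs_left: "semilinear \<tau> f \<Longrightarrow> v \<in> carrier M \<Longrightarrow> inv_on_vecs f (f v) = v"
  using semilinear_bij bij_betw_inv_into_left by metis

lemma inv_on_vecs_closed: "semilinear \<tau> f \<Longrightarrow> v \<in> carrier M \<Longrightarrow> inv_on_vecs f v \<in> carrier M"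
  using semilinear_bij bij_betw_inv_into bij_betwE by metis

lemma lin_aut_id: "lin_aut (\<lambda>v. v)"
  by (auto simp: semilinear_def bij_betw_def)

lemma lin_autI:
  assumes "\<And>v. v \<in> carrier M \<Longrightarrow> f v \<in> carrier M" "\<And>v. v \<in> carrier M \<Longrightarrow> g v \<in> carrier M"
    "\<And>v. v \<in> carrier M \<Longrightarrow> g (f v) = v" "\<And>v. v \<in> carrier M \<Longrightarrow> f (g v) = v"
    "\<And>v w. v \<in> carrier M \<Longrightarrow> w \<in> carrier M \<Longrightarrow> f (v \<oplus>\<^bsub>M\<^esub> w) = f v \<oplus>\<^bsub>M\<^esub> f w"
    "\<And>c v. c \<in> carrier S \<Longrightarrow> v \<in> carrier M \<Longrightarrow> f (c \<odot>\<^bsub>M\<^esub> v) = c \<odot>\<^bsub>M\<^esub> f v"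
  shows "lin_aut f"
  unfolding semilinear_def using assms by (auto intro!: bij_betw_byWitness[where f' = g])

lemma lin_aut_perm:
  assumes "bij_betw \<pi> {..<d} {..<d}"
  shows "lin_aut (\<lambda>v. \<lambda>j\<in>{..<d}. v (\<pi> j))"
proof -
  let ?\<kappa> = "inv_into {..<d} \<pi>"
  have \<pi>: "\<pi> j < d" if "j < d" for j using assms that by (auto simp: bij_betw_def)
  have \<kappa>: "?\<kappa> j < d" if "j < d" for j using bij_betw_inv_into[OF assms] that by (auto simp: bij_betw_def)
  have 1: "?\<kappa> (\<pi> j) = j" if "j < d" for j using bij_betw_inv_into_left[OF assms] that by auto
  have 2: "\<pi> (?\<kappa> j) = j" if "j < d" for j using bij_betw_inv_into_right[OF assms] that by auto
  show ?thesis
    by (rule lin_autI[where g = "\<lambda>v. \<lambda>j\<in>{..<d}. v (?\<kappa> j)"])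
       (auto intro!: vec_closedI vec_eqI simp: \<pi> \<kappa> 1 2)
qed

text \<open>The linear map that sends \<open>e\<^sub>i\<close> to \<open>u\<close> and fixes the other unit vectors.\<close>

definition column_op :: "nat \<Rightarrow> (nat \<Rightarrow> 'a) \<Rightarrow> (nat \<Rightarrow> 'a) \<Rightarrow> nat \<Rightarrow> 'a" where
  "column_op i u v = (\<lambda>j\<in>{..<d}. if j = i then v i \<otimes> u i else v j \<oplus> v i \<otimes> u j)"

lemma lin_aut_column_op:
  assumes i: "i < d" and u: "u \<in> carrier M" and un: "u i \<in> Units S"
  shows "lin_aut (column_op i u)"
proof -
  \<comment> \<open>Dividing by the pivot \<open>u i\<close> recovers the coefficient of
    \<open>u\<close>; the inverse subtracts that multiple of \<open>u\<close> from the other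
    coordinates.\<close>
  let ?g = "\<lambda>v. \<lambda>j\<in>{..<d}. if j = i then v i \<otimes> inv (u i)
                else v j \<ominus> (v i \<otimes> inv (u i)) \<otimes> u j"
  have a: "x \<otimes> u i \<otimes> inv (u i) = x" if "x \<in> carrier S" for x
    using that un u i by (simp add: m_assoc)
  have b: "x \<otimes> inv (u i) \<otimes> u i = x" if "x \<in> carrier S" for x
    using that un u i by (simp add: m_assoc)
  have c: "x \<oplus> y \<ominus> y = x" "x \<ominus> y \<oplus> y = x" if "x \<in> carrier S" "y \<in> carrier S" for x y
    using that by algebra+
  have e: "x \<oplus> y \<oplus> (x' \<otimes> z \<oplus> y' \<otimes> z) = x \<oplus> x' \<otimes> z \<oplus> (y \<oplus> y' \<otimes> z)"
    if "x \<in> carrier S" "y \<in> carrier S" "x' \<in> carrier S" "y' \<in> carrier S" "z \<in> carrier S"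
    for x y x' y' z
    using that by algebra
  have e': "c \<otimes> x \<oplus> c \<otimes> (y \<otimes> z) = c \<otimes> (x \<oplus> y \<otimes> z)"
    if "x \<in> carrier S" "y \<in> carrier S" "z \<in> carrier S" "c \<in> carrier S" for x y z c
    using that by algebra+
  show ?thesis unfolding column_op_def
    by (rule lin_autI[where g = ?g])
       (use i u un in \<open>auto intro!: vec_closedI vec_eqI simp: a b c e e' l_distr m_assoc\<close>)
qed

text \<open>Basis exchange with pivot \<open>i\<close>: swapping coordinates \<open>k\<close> and
  \<open>i\<close> sends e_k to e_i, and \<open>column_op i u\<close> sends e_i to \<open>u\<close>.
  Vectors of \<open>std_space k\<close> vanish at both indices, so neither map moves them. The
  clause on \<open>m\<close> lets the exchange take place inside a larger subspace that contains
  \<open>u\<close>.\<close>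

lemma exists_lin_aut_extending:
  assumes k: "k < d" and u: "u \<in> carrier M" and i: "k \<le> i" "i < d" and un: "u i \<in> Units S"
  shows "\<exists>t. lin_aut t \<and> (\<forall>v\<in>std_space k. t v = v) \<and> t (unit_vec k) = u \<and>
          (\<forall>m. i < m \<longrightarrow> u \<in> std_space m \<longrightarrow> t ` std_space m = std_space m)"
proof -
  define \<pi> where "\<pi> = Fun.swap k i (\<lambda>j. j)"
  have \<pi>d: "\<pi> j < d" if "j < d" for j using that k i by (auto simp: \<pi>_def Fun.swap_def)
  have "bij_betw \<pi> {..<d} {..<d}"
    by (rule bij_betw_byWitness[where f' = \<pi>]) (use k i in \<open>auto simp: \<pi>_def Fun.swap_def\<close>)
  note perm = lin_aut_perm[OF this]
  define t where "t = column_op i u \<circ> (\<lambda>v. \<lambda>j\<in>{..<d}. v (\<pi> j))"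
  have t: "lin_aut t"
    unfolding t_def by (rule lin_aut_comp[OF lin_aut_column_op[OF i(2) u un] perm])
  have tnth: "t v j = (if j = i then v k \<otimes> u i else v (\<pi> j) \<oplus> v k \<otimes> u j)" if "j < d" for v j
    using that i k by (auto simp: t_def column_op_def \<pi>_def Fun.swap_def)
  show ?thesis
  proof (intro exI[of _ t] conjI ballI allI impI)
    fix v assume v: "v \<in> std_space k"
    note vc = coord_space_closed[OF v]
    have "v k = \<zero>" "v i = \<zero>" using v k i by (auto simp: coord_space_def)
    then show "t v = v"
      by (intro vec_eqI semilinear_closed[OF t] vc)
         (use u vc i k in \<open>auto simp: tnth \<pi>_def Fun.swap_def\<close>)
  next
    show "t (unit_vec k) = u"
      by (intro vec_eqI semilinear_closed[OF t] u)
         (use u k i in \<open>auto simp: tnth \<pi>_def Fun.swap_def\<close>)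
  next
    fix m assume m: "i < m" "u \<in> std_space m"
    \<comment> \<open>Both swapped indices lie below \<open>m\<close> and \<open>u\<close> vanishes
      from \<open>m\<close> on, so \<open>t\<close> leaves alone the coordinates that define
      \<open>std_space m\<close>.\<close>
    have iff: "t v \<in> std_space m \<longleftrightarrow> v \<in> std_space m" if v: "v \<in> carrier M" for v
    proof -
      have "t v j = v j" if "j < d" "\<not> j < m" for j
        using that m i k u v coord_space_nth[OF m(2)] by (auto simp: tnth \<pi>_def Fun.swap_def)
      then show ?thesis using v t by (auto simp: coord_space_def)
    qed
    show "t ` std_space m = std_space m"
    proof (intro equalityI subsetI)
      fix w assume w: "w \<in> std_space m"
      then have "w = t (inv_on_vecs t w)" "inv_on_vecs t w \<in> carrier M"
        using inv_on_vecs_right[OF t] inv_on_vecs_closed[OF t] coord_space_closed by auto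
      then show "w \<in> t ` std_space m" using iff w by (metis image_eqI)
    qed (use iff coord_space_closed in auto)
  qed (rule t)
qed


section \<open>Extending linear injections\<close>

lemma std_space_Suc:
  assumes k: "k < d" and v: "v \<in> std_space (Suc k)"
  obtains v' where "v' \<in> std_space k" "v = v' \<oplus>\<^bsub>M\<^esub> v k \<odot>\<^bsub>M\<^esub> unit_vec k"
    "\<And>i. i < k \<Longrightarrow> v' i = v i"
proof
  let ?v = "\<lambda>j\<in>{..<d}. if j < k then v j else \<zero>"
  have vc: "v \<in> carrier M" using v coord_space_closed by auto
  show "?v \<in> std_space k" using vc by (auto simp: coord_space_def intro!: vec_closedI)
  have "v j = \<zero>" if "j < d" "\<not> j < k" "j \<noteq> k" for j
    using v that by (auto simp: coord_space_def)
  then show "v = ?v \<oplus>\<^bsub>M\<^esub> v k \<odot>\<^bsub>M\<^esub> unit_vec k"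
    using vc k by (intro vec_eqI) (auto intro!: vec_add_closed vec_smult_closed vec_closedI)
qed (use k in auto)

lemma linear_on_add: "linear_on D f \<Longrightarrow> v \<in> D \<Longrightarrow> w \<in> D \<Longrightarrow> f (v \<oplus>\<^bsub>M\<^esub> w) = f v \<oplus>\<^bsub>M\<^esub> f w"
  by (auto simp: linear_on_def)

lemma linear_on_smult: "linear_on D f \<Longrightarrow> c \<in> carrier S \<Longrightarrow> v \<in> D \<Longrightarrow> f (c \<odot>\<^bsub>M\<^esub> v) = c \<odot>\<^bsub>M\<^esub> f v"
  by (auto simp: linear_on_def)

lemma linear_on_closed: "linear_on D f \<Longrightarrow> v \<in> D \<Longrightarrow> f v \<in> carrier M"
  by (auto simp: linear_on_def)

lemma linear_on_subset: "linear_on D f \<Longrightarrow> C \<subseteq> D \<Longrightarrow> linear_on C f"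
  unfolding linear_on_def by (meson Pi_anti_mono subset_iff)

lemma lin_aut_linear_on: "lin_aut g \<Longrightarrow> D \<subseteq> carrier M \<Longrightarrow> linear_on D g"
  unfolding linear_on_def by (auto simp: semilinear_add semilinear_smult subset_iff)

lemma linear_on_expand:
  assumes "linear_on (std_space k) f" "k \<le> d" "v \<in> std_space k"
  shows "f v = (\<Oplus>\<^bsub>M\<^esub>i\<in>{..<k}. v i \<odot>\<^bsub>M\<^esub> f (unit_vec i))"
  using assms
proof (induction k arbitrary: v)
  case 0
  have z: "\<zero>\<^bsub>M\<^esub> \<in> std_space 0" by simp
  have "f (\<zero> \<odot>\<^bsub>M\<^esub> \<zero>\<^bsub>M\<^esub>) = \<zero> \<odot>\<^bsub>M\<^esub> f \<zero>\<^bsub>M\<^esub>"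
    using linear_on_smult[OF 0(1) zero_closed z] .
  then show ?case using 0(3) linear_on_closed[OF 0(1) z] by (simp)
next
  case (Suc k)
  obtain v' where v': "v' \<in> std_space k" "v = v' \<oplus>\<^bsub>M\<^esub> v k \<odot>\<^bsub>M\<^esub> unit_vec k"
    "\<And>i. i < k \<Longrightarrow> v' i = v i"
    using std_space_Suc[of k v] Suc.prems by auto
  have sub: "std_space k \<subseteq> std_space (Suc k)" by (intro coord_space_mono) auto
  have u: "unit_vec i \<in> std_space (Suc k)" if "i \<le> k" for i
    using that by (intro unit_vec_in_coord_space) auto
  have vk: "v i \<in> carrier S" if "i \<le> k" for i
    using coord_space_closed[OF Suc.prems(3)] Suc.prems(2) that by auto
  have fc: "f (unit_vec i) \<in> carrier M" if "i \<le> k" for i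
    using linear_on_closed[OF Suc.prems(1) u[OF that]] .
  have "f v = f (v' \<oplus>\<^bsub>M\<^esub> v k \<odot>\<^bsub>M\<^esub> unit_vec k)" using v'(2) by simp
  also have "\<dots> = f v' \<oplus>\<^bsub>M\<^esub> v k \<odot>\<^bsub>M\<^esub> f (unit_vec k)"
    using linear_on_add[OF Suc.prems(1)] linear_on_smult[OF Suc.prems(1)] v'(1) sub u vk
    by (simp add: coord_space_smult subset_iff)
  also have "f v' = (\<Oplus>\<^bsub>M\<^esub>i\<in>{..<k}. v' i \<odot>\<^bsub>M\<^esub> f (unit_vec i))"
    using Suc.IH[OF linear_on_subset[OF Suc.prems(1) sub] _ v'(1)] Suc.prems(2) by simp
  also have "\<dots> = (\<Oplus>\<^bsub>M\<^esub>i\<in>{..<k}. v i \<odot>\<^bsub>M\<^esub> f (unit_vec i))"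
    using v'(3) vk fc by (intro vec.M.finsum_cong') auto
  finally show ?case
    using vk fc by (simp add: lessThan_Suc vec.M.a_comm Pi_iff)
qed

text \<open>Steinitz exchange with the socle in place of a field: an injection cannot send
  \<open>s\<close> e_k into the image of \<open>std_space k\<close>, so the image of e_k has a pivot
  beyond it. Adding one basis vector at a time extends the map to an automorphism, and the position
  of the pivots gives the inequality of ranks.\<close>

lemma extend_linear_injection:
  assumes "linear_on (std_space k) f" "inj_on f (std_space k)" "f ` std_space k \<subseteq> std_space m"
    and "k \<le> d" "m \<le> d"
  shows "k \<le> m \<and> (\<exists>g. lin_aut g \<and> g ` std_space m = std_space m \<and> (\<forall>v\<in>std_space k. g v = f v))"
  using assms
proof (induction k)
  case 0
  have z: "\<zero>\<^bsub>M\<^esub> \<in> std_space 0" by simp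
  have "f (\<zero> \<odot>\<^bsub>M\<^esub> \<zero>\<^bsub>M\<^esub>) = \<zero> \<odot>\<^bsub>M\<^esub> f \<zero>\<^bsub>M\<^esub>"
    using linear_on_smult[OF 0(1) zero_closed z] .
  then have "f \<zero>\<^bsub>M\<^esub> = \<zero>\<^bsub>M\<^esub>" using linear_on_closed[OF 0(1) z] by simp
  then show ?case using lin_aut_id by (intro conjI exI[of _ "\<lambda>v. v"]) (auto)
next
  case (Suc k)
  have sub: "std_space k \<subseteq> std_space (Suc k)" by (intro coord_space_mono) auto
  obtain g where km: "k \<le> m" and g: "lin_aut g" "g ` std_space m = std_space m"
    "\<And>v. v \<in> std_space k \<Longrightarrow> g v = f v"
    using Suc.IH linear_on_subset[OF Suc.prems(1) sub] inj_on_subset[OF Suc.prems(2) sub] Suc.prems(3-5) sub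
    by (metis Suc_leD image_mono subset_trans)
  have uk: "unit_vec k \<in> std_space (Suc k)" by (intro unit_vec_in_coord_space) auto
  \<comment> \<open>In the coordinates given by \<open>g\<close>, the part of \<open>f\<close>
    treated so far is the identity; only the position \<open>u\<close> of the next basis vector
    matters.\<close>
  define u where "u = inv_on_vecs g (f (unit_vec k))"
  have fm: "f (unit_vec k) \<in> std_space m" using uk Suc.prems(3) by auto
  then obtain u' where u': "u' \<in> std_space m" "f (unit_vec k) = g u'" using g(2) by (metis imageE)
  then have um: "u \<in> std_space m"
    using inv_on_vecs_left[OF g(1)] coord_space_closed by (simp add: u_def)
  then have uc: "u \<in> carrier M" using coord_space_closed by auto
  have gu: "g u = f (unit_vec k)"
    unfolding u_def using inv_on_vecs_right[OF g(1)] fm coord_space_closed by auto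
  \<comment> \<open>Without a pivot from index \<open>k\<close> on, \<open>s\<close> u would lie in
    \<open>std_space k\<close>, where \<open>g\<close> agrees with \<open>f\<close>. Then
    \<open>f\<close> would take the same value at \<open>s\<close> u and at \<open>s\<close> e_k,
    although only the first of them lies in \<open>std_space k\<close>.\<close>
  have "\<exists>i. k \<le> i \<and> i < d \<and> u i \<in> Units S"
  proof (rule ccontr)
    assume a: "\<not> ?thesis"
    then have "s \<otimes> u i = \<zero>" if "k \<le> i" "i < d" for i
      using that uc Unit_or_annihilates_socle by blast
    then have su: "s \<odot>\<^bsub>M\<^esub> u \<in> std_space k"
      using uc by (auto simp: coord_space_def)
    have "f (s \<odot>\<^bsub>M\<^esub> u) = g (s \<odot>\<^bsub>M\<^esub> u)" using g(3)[OF su] by simp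
    also have "\<dots> = s \<odot>\<^bsub>M\<^esub> f (unit_vec k)" using semilinear_smult[OF g(1)] uc gu by simp
    also have "\<dots> = f (s \<odot>\<^bsub>M\<^esub> unit_vec k)" using linear_on_smult[OF Suc.prems(1) _ uk] by simp
    finally have "s \<odot>\<^bsub>M\<^esub> u = s \<odot>\<^bsub>M\<^esub> unit_vec k"
      using inj_onD[OF Suc.prems(2)] su sub coord_space_smult[OF socle_closed uk] by blast
    then have "s \<odot>\<^bsub>M\<^esub> unit_vec k \<in> std_space k" using su by simp
    then have "(s \<odot>\<^bsub>M\<^esub> unit_vec k) k = \<zero>" using Suc.prems(4) by (simp add: coord_space_nth)
    then show False using socle_nonzero Suc.prems(4) by simp
  qed
  then obtain i where i: "k \<le> i" "i < d" "u i \<in> Units S" by blast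
  have im: "i < m"
  proof (rule ccontr)
    assume "\<not> i < m"
    then have "u i = \<zero>" using um i by (simp add: coord_space_def)
    then show False using i(3) one_neq_zero by (metis Unit_iff r_null socle_closed zero_closed)
  qed
  obtain t where t: "lin_aut t" "\<forall>v\<in>std_space k. t v = v" "t (unit_vec k) = u"
    "t ` std_space m = std_space m"
    using exists_lin_aut_extending[OF _ uc i] Suc.prems(4) im um by auto
  have gt: "(g \<circ> t) v = f v" if v: "v \<in> std_space (Suc k)" for v
  proof -
    obtain v' where v': "v' \<in> std_space k" "v = v' \<oplus>\<^bsub>M\<^esub> v k \<odot>\<^bsub>M\<^esub> unit_vec k"
      using std_space_Suc[of k v] Suc.prems(4) v by auto
    have vk: "v k \<in> carrier S" using coord_space_closed[OF v] Suc.prems(4) by auto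
    have vc: "v' \<in> carrier M" using coord_space_closed[OF v'(1)] .
    have "g (t v) = g (t (v' \<oplus>\<^bsub>M\<^esub> v k \<odot>\<^bsub>M\<^esub> unit_vec k))" using v'(2) by simp
    also have "\<dots> = g v' \<oplus>\<^bsub>M\<^esub> v k \<odot>\<^bsub>M\<^esub> g u"
      using t(2,3) v'(1) vk vc uc semilinear_closed[OF t(1)] by (simp add: semilinear_add[OF t(1)] semilinear_smult[OF t(1)]
        semilinear_add[OF g(1)] semilinear_smult[OF g(1)])
    also have "\<dots> = f v' \<oplus>\<^bsub>M\<^esub> f (v k \<odot>\<^bsub>M\<^esub> unit_vec k)"
      using linear_on_smult[OF Suc.prems(1) vk uk] g(3)[OF v'(1)] gu by simp
    also have "\<dots> = f (v' \<oplus>\<^bsub>M\<^esub> v k \<odot>\<^bsub>M\<^esub> unit_vec k)"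
      using linear_on_add[OF Suc.prems(1)] v'(1) sub coord_space_smult[OF vk uk] by (simp add: subset_iff)
    finally show ?thesis using v'(2) by simp
  qed
  have "(g \<circ> t) ` std_space m = std_space m" using t(4) g(2) by (metis image_comp)
  then show ?case using gt lin_aut_comp[OF g(1) t(1)] im i(1) by (metis Suc_leI le_less_trans)
qed

text \<open>Seen through \<open>h\<close>, the smaller space is an injected coordinate subspace of
  \<open>std_space m\<close>, and the extension can be chosen to preserve
  \<open>std_space m\<close>. This is the common adapted basis of two nested free
  submodules.\<close>

lemma image_std_space_nested:
  assumes g: "lin_aut g" and h: "lin_aut h" and k: "k \<le> d" and m: "m \<le> d"
    and sub: "g ` std_space k \<subseteq> h ` std_space m"
  shows "k \<le> m \<and> (\<exists>f. lin_aut f \<and> f ` std_space m = h ` std_space m \<and> (\<forall>v\<in>std_space k. f v = g v))"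
proof -
  let ?f = "inv_on_vecs h \<circ> g"
  note h' = lin_aut_inv[OF h]
  have f: "lin_aut ?f" by (rule lin_aut_comp[OF h' g])
  have subM: "std_space l \<subseteq> carrier M" for l using coord_space_closed by blast
  have "?f ` std_space k \<subseteq> std_space m"
  proof
    fix w assume "w \<in> ?f ` std_space k"
    then obtain v where v: "v \<in> std_space k" "w = inv_on_vecs h (g v)" by auto
    then obtain u where "u \<in> std_space m" "g v = h u" using sub by auto
    then show "w \<in> std_space m" using v inv_on_vecs_left[OF h] coord_space_closed by auto
  qed
  from extend_linear_injection[OF lin_aut_linear_on[OF f subM] inj_on_subset[OF semilinear_inj[OF f] subM] this k m]
  obtain t where km: "k \<le> m" and t: "lin_aut t" "t ` std_space m = std_space m"
    "\<And>v. v \<in> std_space k \<Longrightarrow> t v = inv_on_vecs h (g v)" by auto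
  have "(h \<circ> t) v = g v" if "v \<in> std_space k" for v
    using that t(3) inv_on_vecs_right[OF h] semilinear_closed[OF g] coord_space_closed by auto
  moreover have "(h \<circ> t) ` std_space m = h ` std_space m" using t(2) by (metis image_comp)
  ultimately show ?thesis using km lin_aut_comp[OF h t(1)] by blast
qed

section \<open>Bases and images of coordinate subspaces\<close>

lemma submodule_image_std_space:
  assumes g: "lin_aut g"
  shows "submodule (g ` std_space k) S M"
proof (rule vec.submoduleI)
  have closed: "v \<in> carrier M" if "v \<in> std_space k" for v using that coord_space_closed by auto
  have sm: "c \<odot>\<^bsub>M\<^esub> v \<in> g ` std_space k" if cv: "c \<in> carrier S" "v \<in> g ` std_space k" for c v
  proof -
    obtain w where w: "w \<in> std_space k" "v = g w" using cv(2) by blast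
    then have "c \<odot>\<^bsub>M\<^esub> v = g (c \<odot>\<^bsub>M\<^esub> w)" using semilinear_smult[OF g cv(1)] closed by simp
    then show ?thesis using coord_space_smult[OF cv(1) w(1)] by auto
  qed
  then show "c \<odot>\<^bsub>M\<^esub> v \<in> g ` std_space k" if "c \<in> carrier S" "v \<in> g ` std_space k" for c v
    using that .
  show sub: "g ` std_space k \<subseteq> carrier M" using closed g by auto
  have z: "\<zero>\<^bsub>M\<^esub> \<in> std_space k" by (auto simp: coord_space_def)
  show zero: "\<zero>\<^bsub>M\<^esub> \<in> g ` std_space k" using sm[OF zero_closed] z sub by force
  show "\<ominus>\<^bsub>M\<^esub> a \<in> g ` std_space k" if "a \<in> g ` std_space k" for a
    using sm[of "\<ominus> \<one>" a] that vec.smult_l_minus[of \<one> a] subsetD[OF sub that] by simp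
  show "a \<oplus>\<^bsub>M\<^esub> b \<in> g ` std_space k" if ab: "a \<in> g ` std_space k" "b \<in> g ` std_space k" for a b
  proof -
    obtain v w where vw: "v \<in> std_space k" "a = g v" "w \<in> std_space k" "b = g w" using ab by auto
    then have "a \<oplus>\<^bsub>M\<^esub> b = g (v \<oplus>\<^bsub>M\<^esub> w)" using semilinear_add[OF g] closed by simp
    then show ?thesis using coord_space_add vw by auto
  qed
qed

lemma submodule_finsum:
  assumes V: "submodule V S M" and "finite I" "f \<in> I \<rightarrow> V"
  shows "(\<Oplus>\<^bsub>M\<^esub>i\<in>I. f i) \<in> V"
  using assms(2,3)
proof (induction I)
  case empty
  obtain v where v: "v \<in> V" using vec.submoduleE(2)[OF V] by auto
  then have "\<zero> \<odot>\<^bsub>M\<^esub> v \<in> V" using vec.submoduleE(4)[OF V] by blast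
  then show ?case using v vec.submoduleE(1)[OF V] by auto
next
  case (insert a F)
  then have "f \<in> F \<rightarrow> carrier M" "f a \<in> carrier M" using vec.submoduleE(1)[OF V] by auto
  then show ?case using insert vec.submoduleE(5)[OF V] by (simp add: Pi_iff)
qed

text \<open>\<open>is_basis\<close> works with coefficient families on \<open>{..<k}\<close>,
  whereas \<open>std_space k\<close> consists of vectors of length \<open>d\<close>; this is the
  passage from the former to the latter.\<close>

definition pad :: "nat \<Rightarrow> (nat \<Rightarrow> 'a) \<Rightarrow> nat \<Rightarrow> 'a" where
  "pad k c = (\<lambda>j\<in>{..<d}. if j < k then c j else \<zero>)"

lemma pad_in: "k \<le> d \<Longrightarrow> c \<in> {..<k} \<rightarrow> carrier S \<Longrightarrow> pad k c \<in> std_space k"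
  by (auto simp: pad_def coord_space_def Pi_iff intro!: vec_closedI)

lemma pad_nth: "k \<le> d \<Longrightarrow> i < k \<Longrightarrow> pad k c i = c i"
  by (simp add: pad_def)

lemma is_basis_image_std_space:
  assumes g: "lin_aut g" and k: "k \<le> d"
  shows "is_basis S M (g ` std_space k) k (\<lambda>i. g (unit_vec i))"
  unfolding is_basis_def
proof (intro conjI ballI ex_ex1I)
  have sub: "std_space k \<subseteq> carrier M" using coord_space_closed by auto
  note exp = linear_on_expand[OF lin_aut_linear_on[OF g sub] k]
  show "(\<lambda>i. g (unit_vec i)) \<in> {..<k} \<rightarrow> g ` std_space k"
    using unit_vec_in_coord_space by auto
  fix v assume "v \<in> g ` std_space k"
  then obtain w where w: "w \<in> std_space k" "v = g w" by auto
  have "v = (\<Oplus>\<^bsub>M\<^esub>i\<in>{..<k}. restrict w {..<k} i \<odot>\<^bsub>M\<^esub> g (unit_vec i))"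
    unfolding w(2) exp[OF w(1)]
    using subsetD[OF sub w(1)] k by (intro vec.M.finsum_cong') (auto simp: semilinear_closed[OF g])
  moreover have "restrict w {..<k} \<in> {..<k} \<rightarrow>\<^sub>E carrier S"
    using subsetD[OF sub w(1)] k by auto
  ultimately show "\<exists>c. c \<in> {..<k} \<rightarrow>\<^sub>E carrier S \<and> v = (\<Oplus>\<^bsub>M\<^esub>i\<in>{..<k}. c i \<odot>\<^bsub>M\<^esub> g (unit_vec i))"
    by blast
  have pad: "(\<Oplus>\<^bsub>M\<^esub>i\<in>{..<k}. c i \<odot>\<^bsub>M\<^esub> g (unit_vec i)) = g (pad k c)" if "c \<in> {..<k} \<rightarrow>\<^sub>E carrier S" for c
  proof -
    have c: "c \<in> {..<k} \<rightarrow> carrier S" using that by auto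
    show ?thesis unfolding exp[OF pad_in[OF k c]]
      using k funcset_mem[OF c] by (intro vec.M.finsum_cong') (auto simp: pad_nth semilinear_closed[OF g])
  qed
  fix c c' assume c: "c \<in> {..<k} \<rightarrow>\<^sub>E carrier S \<and> v = (\<Oplus>\<^bsub>M\<^esub>i\<in>{..<k}. c i \<odot>\<^bsub>M\<^esub> g (unit_vec i))"
    "c' \<in> {..<k} \<rightarrow>\<^sub>E carrier S \<and> v = (\<Oplus>\<^bsub>M\<^esub>i\<in>{..<k}. c' i \<odot>\<^bsub>M\<^esub> g (unit_vec i))"
  then have "g (pad k c) = g (pad k c')" using pad by auto
  moreover have "pad k c \<in> carrier M" "pad k c' \<in> carrier M"
    using c pad_in[OF k] sub by (blast dest: PiE_restrict)+
  ultimately have "pad k c = pad k c'" using semilinear_eq_iff[OF g] by simp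
  then have "c i = c' i" if "i < k" for i using pad_nth[OF k that] by metis
  then show "c = c'" using c by (auto intro: PiE_ext)
qed

text \<open>Forming linear combinations of the basis is a linear injection of
  \<open>std_space k\<close>, so it extends to an automorphism. The bound \<open>k \<le> d\<close>
  needs its own argument: \<open>d\<close> basis vectors already span everything, so a further one
  would have two expansions.\<close>

lemma basis_imp_image_std_space:
  assumes V: "submodule V S M" and b: "is_basis S M V k b"
  shows "k \<le> d \<and> (\<exists>g. lin_aut g \<and> V = g ` std_space k)"
proof -
  have bV: "b i \<in> V" if "i < k" for i using b that by (auto simp: is_basis_def)
  then have bc: "b i \<in> carrier M" if "i < k" for i using vec.submoduleE(1)[OF V] that by blast
  define f where "f n v = (\<Oplus>\<^bsub>M\<^esub>i\<in>{..<n}. v i \<odot>\<^bsub>M\<^esub> b i)" for n and v :: "nat \<Rightarrow> 'a"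
  have fV: "f n v \<in> V" if "n \<le> k" "v \<in> {..<n} \<rightarrow> carrier S" for n v
    unfolding f_def
  proof (intro submodule_finsum[OF V] finite_lessThan funcsetI)
    fix i assume i: "i \<in> {..<n}"
    show "v i \<odot>\<^bsub>M\<^esub> b i \<in> V"
      using that(1) i bV by (intro vec.submoduleE(4)[OF V] funcset_mem[OF that(2)]) auto
  qed
  \<comment> \<open>Uniqueness in \<open>is_basis\<close> concerns extensional families only, hence
    the detour through \<open>restrict\<close>.\<close>
  have uniq: "c i = c' i" if "c \<in> {..<k} \<rightarrow> carrier S" "c' \<in> {..<k} \<rightarrow> carrier S" "f k c = f k c'" "i < k" for c c' i
  proof -
    have r: "f k (restrict c {..<k}) = f k c" if "c \<in> {..<k} \<rightarrow> carrier S" for c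
      unfolding f_def using that bc by (intro vec.M.finsum_cong') auto
    have "\<exists>!e. e \<in> {..<k} \<rightarrow>\<^sub>E carrier S \<and> f k c = f k e"
      using b fV[OF order_refl that(1)] unfolding is_basis_def f_def by blast
    then obtain e where e: "\<And>e'. e' \<in> {..<k} \<rightarrow>\<^sub>E carrier S \<Longrightarrow> f k c = f k e' \<Longrightarrow> e' = e" by auto
    have "restrict c {..<k} = e"
      using that(1) r[OF that(1)] by (intro e) auto
    moreover have "restrict c' {..<k} = e"
      using that(2,3) r[OF that(2)] by (intro e) auto
    ultimately have "restrict c {..<k} = restrict c' {..<k}" by simp
    then show ?thesis using that(4) by (metis lessThan_iff restrict_apply')
  qed
  have std: "v \<in> {..<n} \<rightarrow> carrier S" if "v \<in> std_space n" "n \<le> d" for v n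
    using that coord_space_closed by fastforce
  have lin: "linear_on (std_space n) (f n)" if n: "n \<le> k" "n \<le> d" for n
    unfolding linear_on_def
  proof (intro conjI ballI)
    show "f n \<in> std_space n \<rightarrow> carrier M" using fV[OF n(1)] std[OF _ n(2)] vec.submoduleE(1)[OF V] by blast
    fix v assume v: "v \<in> std_space n"
    have vc: "v i \<in> carrier S" if "i < n" for i using std[OF v n(2)] that by auto
    show "f n (v \<oplus>\<^bsub>M\<^esub> w) = f n v \<oplus>\<^bsub>M\<^esub> f n w" if w: "w \<in> std_space n" for w
    proof -
      have wc: "w i \<in> carrier S" if "i < n" for i using std[OF w n(2)] that by auto
      have "f n (v \<oplus>\<^bsub>M\<^esub> w) = (\<Oplus>\<^bsub>M\<^esub>i\<in>{..<n}. v i \<odot>\<^bsub>M\<^esub> b i \<oplus>\<^bsub>M\<^esub> w i \<odot>\<^bsub>M\<^esub> b i)"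
        unfolding f_def using vc wc bc n
        by (intro vec.M.finsum_cong') (auto simp: vec.smult_l_distr)
      also have "\<dots> = f n v \<oplus>\<^bsub>M\<^esub> f n w"
        unfolding f_def using vc wc bc n by (intro vec.M.finsum_addf) auto
      finally show ?thesis .
    qed
    show "f n (c \<odot>\<^bsub>M\<^esub> v) = c \<odot>\<^bsub>M\<^esub> f n v" if c: "c \<in> carrier S" for c
    proof -
      have "c \<odot>\<^bsub>M\<^esub> f n v = (\<Oplus>\<^bsub>M\<^esub>i\<in>{..<n}. c \<odot>\<^bsub>M\<^esub> (v i \<odot>\<^bsub>M\<^esub> b i))"
        unfolding f_def using vc bc n c by (intro vec.finsum_smult_ldistr) auto
      also have "\<dots> = f n (c \<odot>\<^bsub>M\<^esub> v)"
        unfolding f_def using vc bc n c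
        by (intro vec.M.finsum_cong') (auto simp: vec.smult_assoc1)
      finally show ?thesis by simp
    qed
  qed
  show ?thesis
  proof (cases "k \<le> d")
    case True
    have inj: "inj_on (f k) (std_space k)"
    proof (rule inj_onI)
      fix v w assume vw: "v \<in> std_space k" "w \<in> std_space k" "f k v = f k w"
      have "v i = w i" if "i < d" for i
        using uniq[OF std[OF vw(1) True] std[OF vw(2) True] vw(3), of i] that vw(1,2)
        by (cases "i < k") (auto simp: coord_space_def)
      then show "v = w" using vw(1,2) coord_space_closed by (auto intro: vec_eqI)
    qed
    have "f k ` std_space k = V"
    proof (intro equalityI subsetI)
      fix w assume "w \<in> V"
      then obtain c where c: "c \<in> {..<k} \<rightarrow>\<^sub>E carrier S" "w = f k c"
        using b unfolding is_basis_def f_def by blast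
      then have c': "c \<in> {..<k} \<rightarrow> carrier S" by auto
      have "f k (pad k c) = f k c"
        unfolding f_def using c' bc True by (intro vec.M.finsum_cong') (auto simp: pad_nth)
      then show "w \<in> f k ` std_space k" using c(2) pad_in[OF True c'] by (metis imageI)
    qed (use fV[OF order_refl std[OF _ True]] in auto)
    moreover have "f k ` std_space k \<subseteq> std_space d"
      using calculation vec.submoduleE(1)[OF V] std_space_full by simp
    ultimately show ?thesis
      using extend_linear_injection[OF lin[OF order_refl True] inj _ True order_refl] True
      by (metis (no_types, lifting) image_cong)
  next
    case False
    then have dk: "d < k" "d \<le> k" by auto
    \<comment> \<open>Padding by zeros turns a combination of the first \<open>d\<close> basis
      vectors into one of all \<open>k\<close>. These \<open>d\<close> vectors give an injective
      endomorphism of the whole module, which is onto by \<open>extend_linear_injection\<close>; so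
      \<open>b d\<close> is a combination of them, while the family \<open>e\<close> below
      represents it as well.\<close>
    define z where "z c j = (if j < d then c j else \<zero>)" for c :: "nat \<Rightarrow> 'a" and j
    have zc: "z v \<in> {..<k} \<rightarrow> carrier S" if "v \<in> std_space d" for v
      using that by (auto simp: z_def coord_space_def)
    have fz: "f k (z v) = f d v" if v: "v \<in> std_space d" for v
    proof -
      have "f d v = f k (z v)" unfolding f_def
      proof (rule vec.M.add.finprod_mono_neutral_cong_left)
        show "(\<lambda>i. z v i \<odot>\<^bsub>M\<^esub> b i) \<in> {..<k} \<rightarrow> carrier M" using zc[OF v] bc by auto
      qed (use dk bc in \<open>auto simp: z_def\<close>)
      then show ?thesis by simp
    qed
    have inj: "inj_on (f d) (std_space d)"
    proof (rule inj_onI)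
      fix v w assume vw: "v \<in> std_space d" "w \<in> std_space d" "f d v = f d w"
      have "v i = w i" if "i < d" for i
        using uniq[OF zc[OF vw(1)] zc[OF vw(2)], of i] that vw(3) dk fz[OF vw(1)] fz[OF vw(2)]
        by (simp add: z_def)
      then show "v = w" using vw(1,2) coord_space_closed by (auto intro: vec_eqI)
    qed
    have "f d ` std_space d \<subseteq> std_space d"
      using linear_on_closed[OF lin[OF dk(2) order_refl]] std_space_full by auto
    from extend_linear_injection[OF lin[OF dk(2) order_refl] inj this order_refl order_refl]
    have "f d ` std_space d = std_space d" by (metis (no_types, lifting) image_cong)
    then obtain v where v: "v \<in> std_space d" "b d = f d v"
      using bc[OF dk(1)] std_space_full by (metis imageE)
    define e where "e j = (if j = d then \<one> else \<zero>)" for j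
    have "f k e = (\<Oplus>\<^bsub>M\<^esub>i\<in>{..<k}. if d = i then b i else \<zero>\<^bsub>M\<^esub>)"
      unfolding f_def e_def using bc by (intro vec.M.finsum_cong') auto
    also have "\<dots> = b d" using bc dk by (intro vec.M.finsum_singleton) auto
    finally have "f k e = f k (z v)" using v fz[OF v(1)] by simp
    moreover have "e \<in> {..<k} \<rightarrow> carrier S" by (auto simp: e_def)
    ultimately have "e d = z v d" using uniq zc[OF v(1)] dk(1) by blast
    then show ?thesis using one_neq_zero by (simp add: e_def z_def)
  qed
qed


section \<open>Free submodules, lines and ranks\<close>

text \<open>Working form of being free of rank \<open>k\<close>. It is equivalent to having a basis
  of size \<open>k\<close> (\<open>basis_imp_subspace\<close>, \<open>subspace_imp_basis\<close>)
  and supplies a change of coordinates of the whole module at once.\<close>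

definition subspace :: "nat \<Rightarrow> (nat \<Rightarrow> 'a) set \<Rightarrow> bool" where
  "subspace k V \<longleftrightarrow> k \<le> d \<and> (\<exists>g. lin_aut g \<and> V = g ` std_space k)"

abbreviation "verts \<equiv> fr_vertices S d"

abbreviation "rk \<equiv> fr_color S d"

lemma subspace_image: "lin_aut g \<Longrightarrow> k \<le> d \<Longrightarrow> subspace k (g ` std_space k)"
  by (auto simp: subspace_def)

lemma subspace_std: "k \<le> d \<Longrightarrow> subspace k (std_space k)"
  using subspace_image[OF lin_aut_id] by simp

lemma subspace_submodule: "subspace k V \<Longrightarrow> submodule V S M"
  using submodule_image_std_space by (auto simp: subspace_def)

lemma subspace_closed: "subspace k V \<Longrightarrow> v \<in> V \<Longrightarrow> v \<in> carrier M"
  using vec.submoduleE(1)[OF subspace_submodule] by blast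

lemma subspace_add: "subspace k V \<Longrightarrow> v \<in> V \<Longrightarrow> w \<in> V \<Longrightarrow> v \<oplus>\<^bsub>M\<^esub> w \<in> V"
  using vec.submoduleE(5)[OF subspace_submodule] by blast

lemma subspace_smult: "subspace k V \<Longrightarrow> c \<in> carrier S \<Longrightarrow> v \<in> V \<Longrightarrow> c \<odot>\<^bsub>M\<^esub> v \<in> V"
  using vec.submoduleE(4)[OF subspace_submodule] by blast

lemma subspace_dim_le: "subspace k V \<Longrightarrow> k \<le> d"
  by (simp add: subspace_def)

lemma subspace_nested:
  assumes "subspace k V" "subspace m W" "V \<subseteq> W"
  obtains g where "lin_aut g" "V = g ` std_space k" "W = g ` std_space m" "k \<le> m"
proof -
  obtain g h where gh: "lin_aut g" "V = g ` std_space k" "lin_aut h" "W = h ` std_space m"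
    using assms by (auto simp: subspace_def)
  have "k \<le> d" "m \<le> d" "g ` std_space k \<subseteq> h ` std_space m"
    using assms gh(2,4) by (auto simp: subspace_def)
  from image_std_space_nested[OF gh(1,3) this] obtain f where
    f: "k \<le> m" "lin_aut f" "f ` std_space m = h ` std_space m" "\<And>v. v \<in> std_space k \<Longrightarrow> f v = g v"
    by blast
  have "V = f ` std_space k" using gh(2) f(4) by simp
  then show thesis using that f(1-3) gh(4) by blast
qed

text \<open>An adapted basis makes both sides images of coordinate subspaces under one map, so the
  ranks decide. Most equalities of vertices below are obtained this way.\<close>

lemma subspace_nested_eq:
  "subspace k V \<Longrightarrow> subspace m W \<Longrightarrow> V \<subseteq> W \<Longrightarrow> m \<le> k \<Longrightarrow> V = W"
  by (erule subspace_nested) auto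

lemma subspace_dim_unique: "subspace k V \<Longrightarrow> subspace m V \<Longrightarrow> k = m"
  using subspace_nested[of k V m V "k \<le> m"] subspace_nested[of m V k V "m \<le> k"] by auto

lemma lin_aut_zero:
  assumes g: "lin_aut g" shows "g \<zero>\<^bsub>M\<^esub> = \<zero>\<^bsub>M\<^esub>"
proof -
  have "g (\<zero> \<odot>\<^bsub>M\<^esub> \<zero>\<^bsub>M\<^esub>) = \<zero> \<odot>\<^bsub>M\<^esub> g \<zero>\<^bsub>M\<^esub>"
    by (rule semilinear_smult[OF g zero_closed vec.M.zero_closed])
  then show ?thesis using semilinear_closed[OF g vec.M.zero_closed] by simp
qed

lemma basis_imp_subspace: "submodule V S M \<Longrightarrow> is_basis S M V k b \<Longrightarrow> subspace k V"
  using basis_imp_image_std_space[of V k b] by (simp add: subspace_def)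

lemma subspace_imp_basis: "subspace k V \<Longrightarrow> \<exists>b. is_basis S M V k b"
  unfolding subspace_def using is_basis_image_std_space by (elim conjE exE) blast

lemma free_submodule_iff: "free_submodule S M V \<longleftrightarrow> (\<exists>k. subspace k V)"
proof
  assume "free_submodule S M V"
  then show "\<exists>k. subspace k V"
    unfolding free_submodule_def by (elim conjE exE) (rule exI, rule basis_imp_subspace)
next
  assume "\<exists>k. subspace k V"
  then obtain k where k: "subspace k V" ..
  then show "free_submodule S M V"
    unfolding free_submodule_def using subspace_submodule[OF k] subspace_imp_basis[OF k] by blast
qed

text \<open>The description in \<open>free_rank\<close> has a unique solution: two standard forms of
  one submodule are nested in each other, which forces equal ranks.\<close>

lemma rk_eq: "subspace k V \<Longrightarrow> rk V = k"
proof -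
  assume V: "subspace k V"
  have "m = k" if "\<exists>b. is_basis S M V m b" for m
    using that basis_imp_subspace[OF subspace_submodule[OF V]] subspace_dim_unique[OF _ V] by (elim exE) blast
  then show ?thesis unfolding fr_color_def free_rank_def
    using subspace_imp_basis[OF V] by (intro the_equality)
qed

lemma subspace_0: "subspace 0 {\<zero>\<^bsub>M\<^esub>}"
  using subspace_std[of 0] by simp

lemma subspace_d: "subspace d (carrier M)"
  using subspace_std[of d] by (simp add: std_space_full)

lemma vertex_iff: "V \<in> verts \<longleftrightarrow> (\<exists>k. subspace k V \<and> 0 < k \<and> k < d)"
proof -
  have "V \<noteq> {\<zero>\<^bsub>M\<^esub>} \<and> V \<noteq> carrier M \<longleftrightarrow> 0 < k \<and> k < d" if V: "subspace k V" for k
  proof -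
    have "V = {\<zero>\<^bsub>M\<^esub>} \<longleftrightarrow> k = 0"
    proof
      show "V = {\<zero>\<^bsub>M\<^esub>} \<Longrightarrow> k = 0" using V subspace_0 subspace_dim_unique by blast
      show "k = 0 \<Longrightarrow> V = {\<zero>\<^bsub>M\<^esub>}" using V lin_aut_zero by (auto simp: subspace_def)
    qed
    moreover have "V = carrier M \<longleftrightarrow> k = d"
    proof
      show "V = carrier M \<Longrightarrow> k = d" using V subspace_d subspace_dim_unique by blast
      show "k = d \<Longrightarrow> V = carrier M"
        using V subspace_nested_eq[OF _ subspace_d] subspace_closed by (metis order_refl subsetI)
    qed
    ultimately show ?thesis using subspace_dim_le[OF V] by auto
  qed
  then show ?thesis unfolding fr_vertices_def free_submodule_iff by blast
qed

lemma vertexI: "subspace k V \<Longrightarrow> 0 < k \<Longrightarrow> k < d \<Longrightarrow> V \<in> verts"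
  using vertex_iff by blast

lemma vertex_subspace: "V \<in> verts \<Longrightarrow> subspace (rk V) V"
  by (auto simp: vertex_iff dest: rk_eq)

lemma rk_pos: "V \<in> verts \<Longrightarrow> 0 < rk V" and rk_less: "V \<in> verts \<Longrightarrow> rk V < d"
  by (auto simp: vertex_iff dest: rk_eq)

lemma rk_mono: "V \<in> verts \<Longrightarrow> W \<in> verts \<Longrightarrow> V \<subseteq> W \<Longrightarrow> rk V \<le> rk W"
  by (erule subspace_nested[OF vertex_subspace vertex_subspace])

lemma vertex_eqI: "V \<in> verts \<Longrightarrow> W \<in> verts \<Longrightarrow> V \<subseteq> W \<Longrightarrow> rk W \<le> rk V \<Longrightarrow> V = W"
  by (rule subspace_nested_eq[OF vertex_subspace vertex_subspace])

lemma vertex_standard: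
  assumes "V \<in> verts" obtains g where "lin_aut g" "V = g ` std_space (rk V)"
  using vertex_subspace[OF assms] unfolding subspace_def by blast

lemma vertex_image: "lin_aut g \<Longrightarrow> 0 < k \<Longrightarrow> k < d \<Longrightarrow> g ` std_space k \<in> verts"
  using vertexI[OF subspace_image] by simp

lemma rk_image: "lin_aut g \<Longrightarrow> k \<le> d \<Longrightarrow> rk (g ` std_space k) = k"
  using rk_eq[OF subspace_image] by simp


section \<open>Unimodular vectors and the points they span\<close>

definition unimodular :: "(nat \<Rightarrow> 'a) \<Rightarrow> bool" where
  "unimodular v \<longleftrightarrow> v \<in> carrier M \<and> s \<odot>\<^bsub>M\<^esub> v \<noteq> \<zero>\<^bsub>M\<^esub>"

definition line :: "(nat \<Rightarrow> 'a) \<Rightarrow> (nat \<Rightarrow> 'a) set" where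
  "line v = (\<lambda>c. c \<odot>\<^bsub>M\<^esub> v) ` carrier S"

lemma unimodular_closed: "unimodular v \<Longrightarrow> v \<in> carrier M"
  by (simp add: unimodular_def)

lemma line_self: "v \<in> carrier M \<Longrightarrow> v \<in> line v"
  unfolding line_def by (metis image_eqI one_closed vec.smult_one)

lemma line_closed: "v \<in> carrier M \<Longrightarrow> w \<in> line v \<Longrightarrow> w \<in> carrier M"
  by (auto simp: line_def)

lemma line_subset_iff: "subspace k V \<Longrightarrow> v \<in> carrier M \<Longrightarrow> line v \<subseteq> V \<longleftrightarrow> v \<in> V"
  using line_self by (auto simp: line_def subspace_smult)

lemma not_in_std_space:
  assumes "v \<in> carrier M" "s \<odot>\<^bsub>M\<^esub> v \<notin> std_space k"
  shows "\<exists>i\<ge>k. i < d \<and> v i \<in> Units S"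
proof -
  obtain i where i: "i < d" "\<not> i < k" "s \<otimes> v i \<noteq> \<zero>"
    using assms by (auto simp: coord_space_def)
  then have "v i \<in> Units S" using assms(1) Unit_iff[of "v i"] by auto
  then show ?thesis using i by (intro exI[of _ i]) simp
qed

text \<open>That \<open>s\<close> v lies outside the subspace means that \<open>v\<close> is
  independent of it modulo the maximal ideal. Then \<open>v\<close> has a pivot beyond the first
  \<open>k\<close> coordinates and can serve as the next basis vector. Joins with a point are built
  from this.\<close>

lemma extend_image_std_space:
  assumes g: "lin_aut g" and k: "k < d" and v: "v \<in> carrier M" and n: "s \<odot>\<^bsub>M\<^esub> v \<notin> g ` std_space k"
  obtains h where "lin_aut h" "\<And>x. x \<in> std_space k \<Longrightarrow> h x = g x" "h (unit_vec k) = v"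
proof -
  let ?u = "inv_on_vecs g v"
  have u: "?u \<in> carrier M" "g ?u = v"
    using inv_on_vecs_closed[OF g v] inv_on_vecs_right[OF g v] by auto
  have "s \<odot>\<^bsub>M\<^esub> ?u \<notin> std_space k"
  proof
    assume "s \<odot>\<^bsub>M\<^esub> ?u \<in> std_space k"
    then have "g (s \<odot>\<^bsub>M\<^esub> ?u) \<in> g ` std_space k" by (rule imageI)
    then show False using n semilinear_smult[OF g socle_closed u(1)] u(2) by simp
  qed
  then obtain i where i: "k \<le> i" "i < d" "?u i \<in> Units S"
    using not_in_std_space[OF u(1)] by blast
  obtain t where "lin_aut t" "\<forall>v\<in>std_space k. t v = v" "t (unit_vec k) = ?u"
    using exists_lin_aut_extending[OF k u(1) i] by blast
  then show thesis using that[of "g \<circ> t"] lin_aut_comp[OF g] u(2) by auto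
qed

lemma unimodular_standard:
  assumes v: "unimodular v"
  obtains g where "lin_aut g" "g (unit_vec 0) = v"
proof -
  have n: "s \<odot>\<^bsub>M\<^esub> v \<notin> (\<lambda>v. v) ` std_space 0" and d: "0 < d"
    using v d_ge_3 by (simp_all add: unimodular_def)
  show thesis
    by (rule extend_image_std_space[OF lin_aut_id d unimodular_closed[OF v] n], rule that)
qed

lemma line_image: "lin_aut g \<Longrightarrow> v \<in> carrier M \<Longrightarrow> g ` line v = line (g v)"
  unfolding line_def by (auto simp: image_image semilinear_smult)

lemma std_space_1: "std_space 1 = line (unit_vec 0)"
proof (intro equalityI subsetI)
  fix v assume v: "v \<in> std_space 1"
  then have "v = v 0 \<odot>\<^bsub>M\<^esub> unit_vec 0"
    using d_ge_3 coord_space_closed[OF v] coord_space_nth[OF v] by (intro vec_eqI) auto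
  moreover have "v 0 \<in> carrier S" using d_ge_3 coord_space_closed[OF v] by auto
  ultimately show "v \<in> line (unit_vec 0)" unfolding line_def by blast
qed (auto simp: line_def coord_space_def)

lemma unimodular_image_iff: "lin_aut g \<Longrightarrow> v \<in> carrier M \<Longrightarrow> unimodular (g v) \<longleftrightarrow> unimodular v"
proof -
  assume g: "lin_aut g" and v: "v \<in> carrier M"
  have "s \<odot>\<^bsub>M\<^esub> g v = \<zero>\<^bsub>M\<^esub> \<longleftrightarrow> g (s \<odot>\<^bsub>M\<^esub> v) = g \<zero>\<^bsub>M\<^esub>"
    using g v by (simp add: semilinear_smult lin_aut_zero)
  also have "\<dots> \<longleftrightarrow> s \<odot>\<^bsub>M\<^esub> v = \<zero>\<^bsub>M\<^esub>" using semilinear_eq_iff[OF g] v by simp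
  finally show ?thesis using g v by (auto simp: unimodular_def)
qed

text \<open>By \<open>Unit_iff\<close>, each coordinate of \<open>s\<close> v tests one coordinate
  of \<open>v\<close>. So \<open>s\<close> v being nonzero says that \<open>v\<close> does not
  vanish in the residue field, the right condition for spanning a free submodule of rank 1.\<close>

lemma unimodular_iff: "unimodular v \<longleftrightarrow> v \<in> carrier M \<and> (\<exists>i<d. v i \<in> Units S)"
proof -
  have "s \<odot>\<^bsub>M\<^esub> v = \<zero>\<^bsub>M\<^esub> \<longleftrightarrow> (\<forall>i<d. s \<otimes> v i = \<zero>)" if "v \<in> carrier M"
    using that by (metis vec_eqI vec_smult_nth vec_zero_nth vec_smult_closed socle_closed vec_zero_closed)
  then show ?thesis using Unit_iff by (auto simp: unimodular_def)
qed

lemma unimodular_unit_vec: "i < d \<Longrightarrow> unimodular (unit_vec i)"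
  unfolding unimodular_iff by (auto intro!: exI[of _ i])

lemma line_subspace: "unimodular v \<Longrightarrow> subspace 1 (line v)"
proof -
  assume "unimodular v"
  then obtain g where g: "lin_aut g" "g (unit_vec 0) = v" by (rule unimodular_standard)
  have "line v = g ` std_space 1" using line_image[OF g(1)] g(2) std_space_1 by simp
  then show ?thesis using subspace_image[OF g(1), of 1] d_ge_3 by simp
qed

lemma line_vertex: "unimodular v \<Longrightarrow> line v \<in> verts" and rk_line: "unimodular v \<Longrightarrow> rk (line v) = 1"
  using vertexI[OF line_subspace] rk_eq[OF line_subspace] d_ge_3 by auto

lemma subspace_1_line:
  assumes "subspace 1 V" obtains v where "unimodular v" "V = line v"
proof -
  obtain g where g: "lin_aut g" "V = g ` std_space 1" using assms by (auto simp: subspace_def)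
  then have "V = line (g (unit_vec 0))" using line_image[OF g(1)] std_space_1 by simp
  moreover have "unimodular (g (unit_vec 0))"
    using unimodular_image_iff[OF g(1)] unimodular_unit_vec[of 0] d_ge_3 by simp
  ultimately show thesis using that by blast
qed

lemma rk_1_line: assumes "V \<in> verts" "rk V = 1" obtains v where "unimodular v" "V = line v"
  using subspace_1_line vertex_subspace[OF assms(1)] assms(2) by auto

lemma line_unimodular_eq: "unimodular v \<Longrightarrow> w \<in> line v \<Longrightarrow> unimodular w \<Longrightarrow> line w = line v"
  using subspace_nested_eq[OF line_subspace line_subspace, of w v]
    line_subset_iff[OF line_subspace] unimodular_closed by simp

lemma unimodular_smult: "unimodular v \<Longrightarrow> c \<in> Units S \<Longrightarrow> unimodular (c \<odot>\<^bsub>M\<^esub> v)"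
  by (auto simp: unimodular_iff)

lemma line_smult_mem: "c \<in> carrier S \<Longrightarrow> c \<odot>\<^bsub>M\<^esub> v \<in> line v"
  by (auto simp: line_def)

lemma line_smult: "unimodular v \<Longrightarrow> c \<in> Units S \<Longrightarrow> line (c \<odot>\<^bsub>M\<^esub> v) = line v"
  by (rule line_unimodular_eq[OF _ line_smult_mem unimodular_smult]) auto

text \<open>An automorphism sends unit vectors to unimodular ones, so a free submodule is generated
  by the unimodular vectors in it. Inclusions can therefore be checked on points.\<close>

lemma subspace_subset_unimodularI:
  assumes V: "subspace k V" and W: "subspace m W" and "\<And>v. unimodular v \<Longrightarrow> v \<in> V \<Longrightarrow> v \<in> W"
  shows "V \<subseteq> W"
proof -
  obtain g where g: "lin_aut g" "V = g ` std_space k" "k \<le> d" using V by (auto simp: subspace_def)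
  have gu: "g (unit_vec i) \<in> W" if "i < k" for i
  proof (rule assms(3))
    show "unimodular (g (unit_vec i))"
      using that g unimodular_image_iff unimodular_unit_vec by simp
    show "g (unit_vec i) \<in> V" using that g unit_vec_in_coord_space[of i "{..<k}"] by auto
  qed
  show ?thesis
  proof
    fix v assume "v \<in> V"
    then obtain u where u: "u \<in> std_space k" "v = g u" using g by auto
    have "linear_on (std_space k) g" using lin_aut_linear_on[OF g(1)] coord_space_closed by blast
    then have "v = (\<Oplus>\<^bsub>M\<^esub>i\<in>{..<k}. u i \<odot>\<^bsub>M\<^esub> g (unit_vec i))"
      using linear_on_expand[OF _ g(3) u(1)] u(2) by simp
    also have "\<dots> \<in> W"
      using u g(3) gu coord_space_closed[OF u(1)]
      by (intro submodule_finsum[OF subspace_submodule[OF W]]) (auto intro!: subspace_smult[OF W])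
    finally show "v \<in> W" .
  qed
qed


section \<open>Order automorphisms and congruent points\<close>

text \<open>Index sets are arbitrary here because hyperplanes will appear as coordinate spaces with
  one index left out.\<close>

lemma image_coord_space_subset:
  assumes g: "lin_aut g" and W: "subspace m W" and I: "\<And>i. i \<in> I \<Longrightarrow> i < d \<Longrightarrow> g (unit_vec i) \<in> W"
  shows "g ` coord_space I \<subseteq> W"
proof
  fix w assume "w \<in> g ` coord_space I"
  then obtain u where u: "u \<in> coord_space I" "w = g u" by blast
  have uc: "u \<in> carrier M" using coord_space_closed[OF u(1)] .
  have "linear_on (std_space d) g" using lin_aut_linear_on[OF g] by (simp add: std_space_full)
  then have "w = (\<Oplus>\<^bsub>M\<^esub>i\<in>{..<d}. u i \<odot>\<^bsub>M\<^esub> g (unit_vec i))"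
    using linear_on_expand[of d g u] u(2) uc by (simp add: std_space_full)
  also have "\<dots> \<in> W"
  proof (intro submodule_finsum[OF subspace_submodule[OF W]] finite_lessThan funcsetI)
    fix i assume i: "i \<in> {..<d}"
    show "u i \<odot>\<^bsub>M\<^esub> g (unit_vec i) \<in> W"
    proof (cases "i \<in> I")
      case True
      then show ?thesis using i I uc by (intro subspace_smult[OF W]) auto
    next
      case False
      then have "u i = \<zero>" using coord_space_nth[OF u(1)] i by simp
      moreover have "g (unit_vec i) \<in> carrier M" using semilinear_closed[OF g] by simp
      moreover obtain x where x: "x \<in> W" using vec.submoduleE(2)[OF subspace_submodule[OF W]] by blast
      moreover have "\<zero> \<odot>\<^bsub>M\<^esub> x \<in> W" using subspace_smult[OF W zero_closed x] .
      ultimately show ?thesis using subspace_closed[OF W x] by simp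
    qed
  qed
  finally show "w \<in> W" .
qed

text \<open>A permutation that matches \<open>I\<close> with an initial segment of the indices, and
  the complements with each other, reduces this to \<open>std_space (card I)\<close>.\<close>

lemma subspace_coord_space:
  assumes I: "I \<subseteq> {..<d}"
  shows "subspace (card I) (coord_space I)"
proof -
  have fin: "finite I" using I finite_subset by blast
  have c: "card I \<le> d" using card_mono[OF _ I] by simp
  obtain f where f: "bij_betw f I {..<card I}" using ex_bij_betw_finite_nat[OF fin] atLeast0LessThan by auto
  have "card ({..<d} - I) = card {card I..<d}" using I fin by (simp add: card_Diff_subset)
  then obtain h where h: "bij_betw h ({..<d} - I) {card I..<d}"
    using finite_same_card_bij[OF _ _ \<open>card ({..<d} - I) = card {card I..<d}\<close>] by (meson finite_Diff finite_atLeastLessThan finite_lessThan)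
  define \<pi> where "\<pi> j = (if j \<in> I then f j else h j)" for j
  have "bij_betw \<pi> (I \<union> ({..<d} - I)) ({..<card I} \<union> {card I..<d})"
    unfolding \<pi>_def by (rule bij_betw_disjoint_Un[OF f h]) auto
  moreover have "I \<union> ({..<d} - I) = {..<d}" "{..<card I} \<union> {card I..<d} = {..<d}" using I c by auto
  ultimately have \<pi>: "bij_betw \<pi> {..<d} {..<d}" by simp
  have \<pi>I: "\<pi> j < card I \<longleftrightarrow> j \<in> I" if "j < d" for j
  proof (cases "j \<in> I")
    case True
    then show ?thesis using bij_betwE[OF f] by (simp add: \<pi>_def)
  next
    case False
    then have "h j \<in> {card I..<d}" using bij_betwE[OF h] that by simp
    then show ?thesis using False by (simp add: \<pi>_def)
  qed
  have \<pi>d: "\<pi> j < d" if "j < d" for j using that \<pi> by (auto simp: bij_betw_def)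
  let ?p = "\<lambda>v. \<lambda>j\<in>{..<d}. v (\<pi> j)"
  note p = lin_aut_perm[OF \<pi>]
  have iff: "?p v \<in> coord_space I \<longleftrightarrow> v \<in> std_space (card I)" if v: "v \<in> carrier M" for v
  proof -
    have pv: "?p v \<in> carrier M" using semilinear_closed[OF p v] .
    have "(\<forall>i<d. i \<notin> I \<longrightarrow> v (\<pi> i) = \<zero>) \<longleftrightarrow> (\<forall>i<d. \<not> i < card I \<longrightarrow> v i = \<zero>)"
    proof
      assume a: "\<forall>i<d. i \<notin> I \<longrightarrow> v (\<pi> i) = \<zero>"
      show "\<forall>i<d. \<not> i < card I \<longrightarrow> v i = \<zero>"
      proof (intro allI impI)
        fix i assume i: "i < d" "\<not> i < card I"
        then obtain j where "j < d" "\<pi> j = i" using \<pi> unfolding bij_betw_def by (metis imageE lessThan_iff)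
        then show "v i = \<zero>" using a i \<pi>I by blast
      qed
    qed (use \<pi>I \<pi>d in blast)
    then show ?thesis using pv v by (auto simp: coord_space_def)
  qed
  have "coord_space I = ?p ` std_space (card I)"
  proof (intro equalityI subsetI)
    fix w assume w: "w \<in> coord_space I"
    have wc: "w \<in> carrier M" using coord_space_closed[OF w] .
    have "inv_on_vecs ?p w \<in> std_space (card I)"
      using iff[OF inv_on_vecs_closed[OF p wc]] inv_on_vecs_right[OF p wc] w by simp
    then show "w \<in> ?p ` std_space (card I)"
      using inv_on_vecs_right[OF p wc] by (intro image_eqI[of _ _ "inv_on_vecs ?p w"]) simp_all
  next
    fix w assume "w \<in> ?p ` std_space (card I)"
    then obtain v where v: "v \<in> std_space (card I)" "w = ?p v" by blast
    show "w \<in> coord_space I" unfolding v(2) using iff[OF coord_space_closed[OF v(1)]] v(1) by blast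
  qed
  then show ?thesis using subspace_image[OF p c] by simp
qed


section \<open>Order automorphisms and ranks\<close>

definition order_aut :: "((nat \<Rightarrow> 'a) set \<Rightarrow> (nat \<Rightarrow> 'a) set) \<Rightarrow> bool" where
  "order_aut \<phi> \<longleftrightarrow> bij_betw \<phi> verts verts \<and> (\<forall>V\<in>verts. \<forall>W\<in>verts. \<phi> V \<subseteq> \<phi> W \<longleftrightarrow> V \<subseteq> W)"

lemma order_aut_bij: "order_aut \<phi> \<Longrightarrow> bij_betw \<phi> verts verts"
  by (simp add: order_aut_def)

lemma order_aut_closed: "order_aut \<phi> \<Longrightarrow> V \<in> verts \<Longrightarrow> \<phi> V \<in> verts"
  by (auto simp: order_aut_def bij_betw_def)

lemma order_aut_subset_iff: "order_aut \<phi> \<Longrightarrow> V \<in> verts \<Longrightarrow> W \<in> verts \<Longrightarrow> \<phi> V \<subseteq> \<phi> W \<longleftrightarrow> V \<subseteq> W"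
  by (simp add: order_aut_def)

lemma order_aut_eq_iff: "order_aut \<phi> \<Longrightarrow> V \<in> verts \<Longrightarrow> W \<in> verts \<Longrightarrow> \<phi> V = \<phi> W \<longleftrightarrow> V = W"
  using order_aut_subset_iff[of \<phi> V W] order_aut_subset_iff[of \<phi> W V] by blast

lemma order_aut_surj:
  assumes "order_aut \<phi>" "W \<in> verts" obtains V where "V \<in> verts" "\<phi> V = W"
  using assms unfolding order_aut_def bij_betw_def by (metis imageE)

lemma order_aut_inv:
  assumes \<phi>: "order_aut \<phi>"
  shows "order_aut (inv_into verts \<phi>)"
  unfolding order_aut_def
proof (intro conjI ballI)
  let ?i = "inv_into verts \<phi>"
  show b: "bij_betw ?i verts verts" using bij_betw_inv_into[OF order_aut_bij[OF \<phi>]] .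
  fix V W assume V: "V \<in> verts" and W: "W \<in> verts"
  have "?i V \<in> verts" "?i W \<in> verts" using b V W by (auto simp: bij_betw_def)
  then show "?i V \<subseteq> ?i W \<longleftrightarrow> V \<subseteq> W"
    using order_aut_subset_iff[OF \<phi>, of "?i V" "?i W"]
      bij_betw_inv_into_right[OF order_aut_bij[OF \<phi>]] V W by simp
qed

lemma order_aut_comp: "order_aut \<phi> \<Longrightarrow> order_aut \<psi> \<Longrightarrow> order_aut (\<phi> \<circ> \<psi>)"
  unfolding order_aut_def
proof (elim conjE, intro conjI ballI)
  assume \<phi>: "bij_betw \<phi> verts verts" "\<forall>V\<in>verts. \<forall>W\<in>verts. \<phi> V \<subseteq> \<phi> W \<longleftrightarrow> V \<subseteq> W"
    and \<psi>: "bij_betw \<psi> verts verts" "\<forall>V\<in>verts. \<forall>W\<in>verts. \<psi> V \<subseteq> \<psi> W \<longleftrightarrow> V \<subseteq> W"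
  show "bij_betw (\<phi> \<circ> \<psi>) verts verts" by (rule bij_betw_trans[OF \<psi>(1) \<phi>(1)])
  show "(\<phi> \<circ> \<psi>) V \<subseteq> (\<phi> \<circ> \<psi>) W \<longleftrightarrow> V \<subseteq> W" if "V \<in> verts" "W \<in> verts" for V W
    using \<phi>(2) \<psi>(2) that bij_betwE[OF \<psi>(1)] by simp
qed

lemma order_aut_cong:
  assumes "order_aut \<phi>" "\<And>V. V \<in> verts \<Longrightarrow> \<phi> V = \<psi> V" shows "order_aut \<psi>"
  using assms(1) bij_betw_cong[of verts \<phi> \<psi> verts] assms(2) unfolding order_aut_def by auto

text \<open>A vertex of rank \<open>Suc k\<close> with \<open>k\<close> positive properly contains
  one of rank \<open>k\<close>; proper inclusion survives the map, and between vertices it raises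
  the rank. Applied to the inverse as well, this yields equality in
  \<open>rk_order_aut\<close>.\<close>

lemma rk_order_aut_ge:
  assumes \<phi>: "order_aut \<phi>" and V: "V \<in> verts"
  shows "rk V \<le> rk (\<phi> V)"
proof -
  have "k \<le> rk (\<phi> V)" if "V \<in> verts" "rk V = k" for V k
    using that
  proof (induction k arbitrary: V)
    case (Suc k)
    show ?case
    proof (cases "k = 0")
      case True
      then show ?thesis using rk_pos[OF order_aut_closed[OF \<phi> Suc.prems(1)]] by simp
    next
      case False
      obtain g where g: "lin_aut g" "V = g ` std_space (Suc k)"
        using vertex_standard[OF Suc.prems(1)] Suc.prems(2) by metis
      have kd: "k < d" using rk_less[OF Suc.prems(1)] Suc.prems(2) by simp
      let ?U = "g ` std_space k"
      have U: "?U \<in> verts" "rk ?U = k"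
        using vertex_image[OF g(1)] rk_image[OF g(1)] kd False by auto
      have sub: "?U \<subseteq> V" unfolding g(2) by (intro image_mono coord_space_mono) auto
      have "\<phi> ?U \<subseteq> \<phi> V" "\<phi> ?U \<noteq> \<phi> V"
        using order_aut_subset_iff[OF \<phi> U(1) Suc.prems(1)] sub
          order_aut_eq_iff[OF \<phi> U(1) Suc.prems(1)] U(2) Suc.prems(2) by auto
      then have "rk (\<phi> ?U) < rk (\<phi> V)"
        using vertex_eqI[OF order_aut_closed[OF \<phi> U(1)] order_aut_closed[OF \<phi> Suc.prems(1)]] by force
      then show ?thesis using Suc.IH[OF U] by simp
    qed
  qed simp
  then show ?thesis using V by simp
qed

lemma rk_order_aut:
  assumes \<phi>: "order_aut \<phi>" and V: "V \<in> verts"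
  shows "rk (\<phi> V) = rk V"
proof -
  have "rk (\<phi> V) \<le> rk (inv_into verts \<phi> (\<phi> V))"
    by (rule rk_order_aut_ge[OF order_aut_inv[OF \<phi>] order_aut_closed[OF \<phi> V]])
  then show ?thesis
    using rk_order_aut_ge[OF \<phi> V] bij_betw_inv_into_left[OF order_aut_bij[OF \<phi>] V] by simp
qed

section \<open>Congruence of points modulo the maximal ideal\<close>

definition near :: "(nat \<Rightarrow> 'a) set \<Rightarrow> (nat \<Rightarrow> 'a) set \<Rightarrow> bool" where
  "near p V \<longleftrightarrow> (\<forall>v\<in>p. s \<odot>\<^bsub>M\<^esub> v \<in> V)"

text \<open>Scalars commute with \<open>s\<close> and \<open>V\<close> is closed under them, so the
  condition on a whole point reduces to any one generator of it.\<close>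

lemma near_line:
  assumes "v \<in> carrier M" "subspace k V"
  shows "near (line v) V \<longleftrightarrow> s \<odot>\<^bsub>M\<^esub> v \<in> V"
proof
  show "near (line v) V \<Longrightarrow> s \<odot>\<^bsub>M\<^esub> v \<in> V" using line_self[OF assms(1)] by (simp add: near_def)
  assume a: "s \<odot>\<^bsub>M\<^esub> v \<in> V"
  have "s \<odot>\<^bsub>M\<^esub> (c \<odot>\<^bsub>M\<^esub> v) \<in> V" if c: "c \<in> carrier S" for c
  proof -
    have "s \<odot>\<^bsub>M\<^esub> (c \<odot>\<^bsub>M\<^esub> v) = c \<odot>\<^bsub>M\<^esub> (s \<odot>\<^bsub>M\<^esub> v)"
      using assms(1) c by (simp add: vec.smult_assoc1[symmetric] m_comm)
    then show ?thesis using subspace_smult[OF assms(2) c a] by simp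
  qed
  then show "near (line v) V" by (auto simp: near_def line_def)
qed

text \<open>If the points are not near, their generators are the first two vectors of a basis, and a
  plane through both must equal their span. If they are near, any plane through both can be tilted
  by a multiple of \<open>s\<close> into a third direction without losing either point.\<close>

lemma near_line_line_iff:
  assumes v: "unimodular v" and w: "unimodular w"
  shows "near (line v) (line w) \<longleftrightarrow>
    line v = line w \<or> \<not> (\<exists>!U. U \<in> verts \<and> rk U = 2 \<and> line v \<subseteq> U \<and> line w \<subseteq> U)"
proof (cases "near (line v) (line w)")
  case False
  note vc = unimodular_closed[OF v] and wc = unimodular_closed[OF w]
  have sv: "s \<odot>\<^bsub>M\<^esub> v \<notin> line w" using False near_line[OF vc line_subspace[OF w]] by simp
  obtain g where g: "lin_aut g" "line w = g ` std_space 1"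
    using line_subspace[OF w] by (auto simp: subspace_def)
  have "1 < d" using d_ge_3 by simp
  obtain h where h: "lin_aut h" "\<And>x. x \<in> std_space 1 \<Longrightarrow> h x = g x" "h (unit_vec 1) = v"
    using extend_image_std_space[OF g(1) \<open>1 < d\<close> vc] sv unfolding g(2) by blast
  have hw: "h ` std_space 1 = line w" using g(2) h(2) by simp
  let ?U = "h ` std_space 2"
  have U: "?U \<in> verts" "rk ?U = 2" using vertex_image[OF h(1)] rk_image[OF h(1)] d_ge_3 by auto
  have "line w \<subseteq> ?U" unfolding hw[symmetric] by (intro image_mono coord_space_mono) auto
  moreover have "v \<in> ?U" using h(3) unit_vec_in_coord_space[of 1 "{..<2}"] by (metis image_eqI lessThan_iff one_less_numeral_iff semiring_norm(76))
  then have "line v \<subseteq> ?U" using line_subset_iff[OF vertex_subspace[OF U(1)] vc] by simp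
  moreover have "U' = ?U" if U': "U' \<in> verts" "rk U' = 2" "line v \<subseteq> U'" "line w \<subseteq> U'" for U'
  proof -
    have "h (unit_vec i) \<in> U'" if "i \<in> {..<2}" for i
    proof (cases "i = 0")
      case True
      then have "h (unit_vec i) \<in> h ` std_space 1" by (intro imageI unit_vec_in_coord_space) auto
      then show ?thesis using hw U'(4) by blast
    next
      case False
      then have "i = 1" using that by auto
      then show ?thesis using h(3) U'(3) line_self[OF vc] by auto
    qed
    then have "?U \<subseteq> U'" by (rule image_coord_space_subset[OF h(1) vertex_subspace[OF U'(1)]])
    then show ?thesis using vertex_eqI[OF U(1) U'(1)] U'(2) U(2) by simp
  qed
  ultimately have "\<exists>!U. U \<in> verts \<and> rk U = 2 \<and> line v \<subseteq> U \<and> line w \<subseteq> U"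
    using U by blast
  moreover have "line v \<noteq> line w"
  proof
    assume "line v = line w"
    then have "s \<odot>\<^bsub>M\<^esub> v \<in> line w" using line_smult_mem[OF socle_closed, of v] by simp
    then show False using sv by simp
  qed
  ultimately show ?thesis using False by blast
next
  case True
  note vc = unimodular_closed[OF v] and wc = unimodular_closed[OF w]
  have sv: "s \<odot>\<^bsub>M\<^esub> v \<in> line w" using True near_line[OF vc line_subspace[OF w]] by simp
  have "\<not> (\<exists>!U. U \<in> verts \<and> rk U = 2 \<and> line v \<subseteq> U \<and> line w \<subseteq> U)"
  proof
    assume ex1: "\<exists>!U. U \<in> verts \<and> rk U = 2 \<and> line v \<subseteq> U \<and> line w \<subseteq> U"
    then obtain U where U: "U \<in> verts" "rk U = 2" "line v \<subseteq> U" "line w \<subseteq> U" by blast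
    have U2: "subspace 2 U" using vertex_subspace[OF U(1)] U(2) by simp
    obtain g where g: "lin_aut g" "line w = g ` std_space 1" "U = g ` std_space 2"
      using subspace_nested[OF line_subspace[OF w] U2 U(4)] by blast
    obtain u where u: "u \<in> std_space 2" "v = g u" using U(3) line_self[OF vc] g(3) by blast
    note uc = coord_space_closed[OF u(1)]
    have "s \<odot>\<^bsub>M\<^esub> u \<in> std_space 1"
    proof -
      have "g (s \<odot>\<^bsub>M\<^esub> u) \<in> g ` std_space 1" using sv g(2) u(2) semilinear_smult[OF g(1) socle_closed uc] by simp
      then obtain x where "x \<in> std_space 1" "g (s \<odot>\<^bsub>M\<^esub> u) = g x" by blast
      then show ?thesis using semilinear_eq_iff[OF g(1), of "s \<odot>\<^bsub>M\<^esub> u" x] uc coord_space_closed by auto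
    qed
    then have "(s \<odot>\<^bsub>M\<^esub> u) 1 = \<zero>" using d_ge_3 by (intro coord_space_nth) auto
    then have su1: "s \<otimes> u 1 = \<zero>" using d_ge_3 by simp
    \<comment> \<open>The tilt sends e_1 to e_1 + \<open>s\<close> e_2 and uses the third dimension.
      It fixes e_0, and it fixes \<open>u\<close> because \<open>s\<close> kills \<open>u 1\<close>;
      so the image plane contains both points. Equality with \<open>U\<close> would force
      \<open>s\<close>, the coordinate of this vector at index 2, to vanish.\<close>
    let ?e = "unit_vec 1 \<oplus>\<^bsub>M\<^esub> s \<odot>\<^bsub>M\<^esub> unit_vec 2"
    have t: "lin_aut (column_op 1 ?e)"
      using d_ge_3 by (intro lin_aut_column_op) auto
    let ?h = "g \<circ> column_op 1 ?e"
    have h: "lin_aut ?h" by (rule lin_aut_comp[OF g(1) t])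
    let ?U = "?h ` std_space 2"
    have U': "?U \<in> verts" "rk ?U = 2" using vertex_image[OF h] rk_image[OF h] d_ge_3 by auto
    have cu: "column_op 1 ?e u = u"
      using uc d_ge_3 su1 by (intro vec_eqI semilinear_closed[OF t]) (auto simp: column_op_def m_comm)
    have c0: "column_op 1 ?e (unit_vec 0) = unit_vec 0"
      using d_ge_3 by (intro vec_eqI semilinear_closed[OF t]) (auto simp: column_op_def)
    have c1: "column_op 1 ?e (unit_vec 1) = ?e"
      using d_ge_3 by (intro vec_eqI semilinear_closed[OF t]) (auto simp: column_op_def)
    have "v \<in> ?U" using u cu by (metis comp_apply imageI)
    then have 1: "line v \<subseteq> ?U" using line_subset_iff[OF vertex_subspace[OF U'(1)] vc] by simp
    have "line w = line (g (unit_vec 0))"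
      using g(2) std_space_1 line_image[OF g(1)] by simp
    also have "g (unit_vec 0) \<in> ?U"
      using c0 unit_vec_in_coord_space[of 0 "{..<2}"] by (metis comp_apply imageI lessThan_iff zero_less_numeral)
    then have "line (g (unit_vec 0)) \<subseteq> ?U"
      using line_subset_iff[OF vertex_subspace[OF U'(1)]] semilinear_closed[OF g(1)] by simp
    finally have "?U = U" using ex1 U U' 1 by blast
    moreover have "g ?e \<in> ?U"
      using c1 unit_vec_in_coord_space[of 1 "{..<2}"] by (metis comp_apply imageI lessThan_iff one_less_numeral_iff semiring_norm(76))
    ultimately obtain x where x: "x \<in> std_space 2" "g ?e = g x" using g(3) by blast
    then have "?e = x" using semilinear_eq_iff[OF g(1), of ?e x] coord_space_closed by auto
    then have "?e 2 = \<zero>" using x(1) d_ge_3 by (simp add: coord_space_nth)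
    then show False using d_ge_3 socle_nonzero by simp
  qed
  then show ?thesis using True by blast
qed

text \<open>In coordinates adapted to \<open>V\<close>, deleting the coordinates of the vector
  outside \<open>V\<close> does not change its product with \<open>s\<close>, so the truncated
  vector spans a congruent point inside \<open>V\<close>. Nearness to a vertex is thereby reduced to
  nearness of points.\<close>

lemma near_iff_point:
  assumes v: "unimodular v" and V: "V \<in> verts"
  shows "near (line v) V \<longleftrightarrow> (\<exists>w. unimodular w \<and> line w \<subseteq> V \<and> near (line v) (line w))"
proof
  note vc = unimodular_closed[OF v]
  assume "near (line v) V"
  then have sv: "s \<odot>\<^bsub>M\<^esub> v \<in> V" using near_line[OF vc vertex_subspace[OF V]] by simp
  obtain g where g: "lin_aut g" "V = g ` std_space (rk V)" by (rule vertex_standard[OF V])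
  obtain x where x: "x \<in> std_space (rk V)" "s \<odot>\<^bsub>M\<^esub> v = g x" using sv g(2) by blast
  let ?u = "inv_on_vecs g v"
  have u: "?u \<in> carrier M" "g ?u = v" using inv_on_vecs_closed[OF g(1) vc] inv_on_vecs_right[OF g(1) vc] by auto
  have "g (s \<odot>\<^bsub>M\<^esub> ?u) = g x" using semilinear_smult[OF g(1) socle_closed u(1)] u(2) x(2) by simp
  then have su: "s \<odot>\<^bsub>M\<^esub> ?u = x"
    using semilinear_eq_iff[OF g(1), of "s \<odot>\<^bsub>M\<^esub> ?u" x] u(1) coord_space_closed[OF x(1)] by simp
  let ?u' = "\<lambda>i\<in>{..<d}. if i < rk V then ?u i else \<zero>"
  have u': "?u' \<in> std_space (rk V)" using u(1) by (auto simp: coord_space_def intro!: vec_closedI)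
  note u'c = coord_space_closed[OF u']
  have "s \<odot>\<^bsub>M\<^esub> ?u' = s \<odot>\<^bsub>M\<^esub> ?u"
  proof (rule vec_eqI)
    fix i assume i: "i < d"
    have "s \<otimes> ?u i = \<zero>" if "\<not> i < rk V"
    proof -
      have "(s \<odot>\<^bsub>M\<^esub> ?u) i = \<zero>" using su coord_space_nth[OF x(1) i] that by simp
      then show ?thesis using i by simp
    qed
    then show "(s \<odot>\<^bsub>M\<^esub> ?u') i = (s \<odot>\<^bsub>M\<^esub> ?u) i" using i by simp
  qed (use u(1) u'c in auto)
  then have sg: "s \<odot>\<^bsub>M\<^esub> g ?u' = s \<odot>\<^bsub>M\<^esub> v"
    using semilinear_smult[OF g(1) socle_closed u'c] semilinear_smult[OF g(1) socle_closed u(1)] u(2) by simp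
  have w: "unimodular (g ?u')"
    using v semilinear_closed[OF g(1) u'c] sg by (simp add: unimodular_def)
  have "near (line v) (line (g ?u'))"
    using near_line[OF vc line_subspace[OF w]] sg line_smult_mem[OF socle_closed, of "g ?u'"] by simp
  moreover have "line (g ?u') \<subseteq> V"
    using line_subset_iff[OF vertex_subspace[OF V] unimodular_closed[OF w]] g(2) u' by blast
  ultimately show "\<exists>w. unimodular w \<and> line w \<subseteq> V \<and> near (line v) (line w)" using w by blast
qed (auto simp: near_def)

lemma order_aut_line:
  assumes "order_aut \<phi>" "unimodular v"
  obtains w where "unimodular w" "\<phi> (line v) = line w"
  using rk_1_line[OF order_aut_closed[OF assms(1) line_vertex[OF assms(2)]]]
    rk_order_aut[OF assms(1) line_vertex[OF assms(2)]] rk_line[OF assms(2)] by metis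

text \<open>\<open>near_line_line_iff\<close> describes nearness by points, planes, inclusion and
  unique existence, all of which an order automorphism carries over. Surjectivity on planes is what
  transfers the uniqueness to the image.\<close>

lemma order_aut_near_line:
  assumes \<phi>: "order_aut \<phi>" and v: "unimodular v" and w: "unimodular w"
  shows "near (\<phi> (line v)) (\<phi> (line w)) \<longleftrightarrow> near (line v) (line w)"
proof -
  obtain v' where v': "unimodular v'" "\<phi> (line v) = line v'" by (rule order_aut_line[OF \<phi> v])
  obtain w' where w': "unimodular w'" "\<phi> (line w) = line w'" by (rule order_aut_line[OF \<phi> w])
  note V = line_vertex[OF v] and W = line_vertex[OF w]
  let ?P = "\<lambda>U. U \<in> verts \<and> rk U = 2 \<and> line v \<subseteq> U \<and> line w \<subseteq> U"
  let ?P' = "\<lambda>U. U \<in> verts \<and> rk U = 2 \<and> \<phi> (line v) \<subseteq> U \<and> \<phi> (line w) \<subseteq> U"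
  have PP: "?P' (\<phi> U) \<longleftrightarrow> ?P U" if U: "U \<in> verts" for U
    using order_aut_closed[OF \<phi> U] rk_order_aut[OF \<phi> U] order_aut_subset_iff[OF \<phi> V U]
      order_aut_subset_iff[OF \<phi> W U] U by simp
  have "(\<exists>!U. ?P' U) \<longleftrightarrow> (\<exists>!U. ?P U)"
  proof
    assume ex: "\<exists>!U. ?P' U"
    then obtain U' where U': "?P' U'" by blast
    obtain U where U: "U \<in> verts" "\<phi> U = U'" using order_aut_surj[OF \<phi>] U' by blast
    show "\<exists>!U. ?P U"
    proof (rule ex1I[of _ U])
      show "?P U" using PP[OF U(1)] U' U(2) by blast
      fix Z assume Z: "?P Z"
      then have "?P' (\<phi> Z)" using PP[of Z] by blast
      then have "\<phi> Z = \<phi> U" using ex U' U(2) by blast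
      then show "Z = U" using order_aut_eq_iff[OF \<phi> _ U(1)] Z by blast
    qed
  next
    assume ex: "\<exists>!U. ?P U"
    then obtain U where U: "?P U" by blast
    show "\<exists>!U. ?P' U"
    proof (rule ex1I[of _ "\<phi> U"])
      show "?P' (\<phi> U)" using PP[of U] U by blast
      fix Z' assume Z': "?P' Z'"
      then obtain Z where Z: "Z \<in> verts" "\<phi> Z = Z'" using order_aut_surj[OF \<phi>] by blast
      then have "?P Z" using PP[of Z] Z' by blast
      then have "Z = U" using ex U by blast
      then show "Z' = \<phi> U" using Z by simp
    qed
  qed
  then show ?thesis
    using near_line_line_iff[OF v w] near_line_line_iff[OF v'(1) w'(1)] v'(2) w'(2) order_aut_eq_iff[OF \<phi> V W]
    by simp
qed

lemma order_aut_near: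
  assumes \<phi>: "order_aut \<phi>" and v: "unimodular v" and V: "V \<in> verts"
  shows "near (\<phi> (line v)) (\<phi> V) \<longleftrightarrow> near (line v) V"
proof -
  obtain v' where v': "unimodular v'" "\<phi> (line v) = line v'" by (rule order_aut_line[OF \<phi> v])
  have "near (\<phi> (line v)) (\<phi> V) \<longleftrightarrow> (\<exists>w'. unimodular w' \<and> line w' \<subseteq> \<phi> V \<and> near (\<phi> (line v)) (line w'))"
    using near_iff_point[OF v'(1) order_aut_closed[OF \<phi> V]] v'(2) by simp
  also have "\<dots> \<longleftrightarrow> (\<exists>w. unimodular w \<and> \<phi> (line w) \<subseteq> \<phi> V \<and> near (\<phi> (line v)) (\<phi> (line w)))"
  proof
    assume "\<exists>w'. unimodular w' \<and> line w' \<subseteq> \<phi> V \<and> near (\<phi> (line v)) (line w')"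
    then obtain w' where w': "unimodular w'" "line w' \<subseteq> \<phi> V" "near (\<phi> (line v)) (line w')" by blast
    obtain W where W: "W \<in> verts" "\<phi> W = line w'" using order_aut_surj[OF \<phi> line_vertex[OF w'(1)]] .
    then have "rk W = 1" using rk_order_aut[OF \<phi> W(1)] rk_line[OF w'(1)] by simp
    then obtain w where "unimodular w" "W = line w" using rk_1_line[OF W(1)] by blast
    then show "\<exists>w. unimodular w \<and> \<phi> (line w) \<subseteq> \<phi> V \<and> near (\<phi> (line v)) (\<phi> (line w))"
      using w' W(2) by (intro exI[of _ w]) simp
  next
    assume "\<exists>w. unimodular w \<and> \<phi> (line w) \<subseteq> \<phi> V \<and> near (\<phi> (line v)) (\<phi> (line w))"
    then obtain w where w: "unimodular w" "\<phi> (line w) \<subseteq> \<phi> V" "near (\<phi> (line v)) (\<phi> (line w))" by blast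
    obtain w' where "unimodular w'" "\<phi> (line w) = line w'" by (rule order_aut_line[OF \<phi> w(1)])
    then show "\<exists>w'. unimodular w' \<and> line w' \<subseteq> \<phi> V \<and> near (\<phi> (line v)) (line w')"
      using w by auto
  qed
  also have "\<dots> \<longleftrightarrow> (\<exists>w. unimodular w \<and> line w \<subseteq> V \<and> near (line v) (line w))"
    using order_aut_subset_iff[OF \<phi> line_vertex V] order_aut_near_line[OF \<phi> v] by blast
  also have "\<dots> \<longleftrightarrow> near (line v) V" using near_iff_point[OF v V] by simp
  finally show ?thesis .
qed

text \<open>Adjoining \<open>v\<close> to a basis of \<open>V\<close> gives a free submodule of rank
  \<open>Suc k\<close> inside \<open>W\<close>, hence all of \<open>W\<close>; expanding
  \<open>w\<close> in this basis gives the decomposition.\<close>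

lemma subspace_join:
  assumes V: "subspace k V" and W: "subspace (Suc k) W" and sub: "V \<subseteq> W"
    and v: "v \<in> W" and n: "s \<odot>\<^bsub>M\<^esub> v \<notin> V" and w: "w \<in> W"
  obtains x c where "x \<in> V" "c \<in> carrier S" "w = x \<oplus>\<^bsub>M\<^esub> c \<odot>\<^bsub>M\<^esub> v"
proof -
  obtain g where g: "lin_aut g" "V = g ` std_space k" using V by (auto simp: subspace_def)
  have kd: "k < d" using subspace_dim_le[OF W] by simp
  note vc = subspace_closed[OF W v]
  obtain h where h: "lin_aut h" "\<And>x. x \<in> std_space k \<Longrightarrow> h x = g x" "h (unit_vec k) = v"
    using extend_image_std_space[OF g(1) kd vc] n unfolding g(2) by blast
  have "h ` std_space (Suc k) \<subseteq> W"
  proof (rule image_coord_space_subset[OF h(1) W])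
    fix i assume "i \<in> {..<Suc k}" "i < d"
    show "h (unit_vec i) \<in> W"
    proof (cases "i = k")
      case False
      then have "i \<in> {..<k}" using \<open>i \<in> {..<Suc k}\<close> by auto
      then have "h (unit_vec i) \<in> V" using g(2) h(2) unit_vec_in_coord_space by simp
      then show ?thesis using sub by blast
    qed (use h(3) v in simp)
  qed
  then have "h ` std_space (Suc k) = W"
    using subspace_nested_eq[OF subspace_image[OF h(1)] W] kd by simp
  then obtain y where y: "y \<in> std_space (Suc k)" "w = h y" using w by blast
  obtain y' where y': "y' \<in> std_space k" "y = y' \<oplus>\<^bsub>M\<^esub> y k \<odot>\<^bsub>M\<^esub> unit_vec k"
    using std_space_Suc[OF kd y(1)] by metis
  have yk: "y k \<in> carrier S" using coord_space_closed[OF y(1)] kd by auto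
  have "w = h (y' \<oplus>\<^bsub>M\<^esub> y k \<odot>\<^bsub>M\<^esub> unit_vec k)" using y(2) y'(2) by simp
  also have "\<dots> = h y' \<oplus>\<^bsub>M\<^esub> y k \<odot>\<^bsub>M\<^esub> v"
    using semilinear_add[OF h(1)] semilinear_smult[OF h(1)] yk coord_space_closed[OF y'(1)] h(3) by simp
  finally show thesis using that[of "h y'" "y k"] yk h(2)[OF y'(1)] g(2) y'(1) by simp
qed

lemma plane_exists:
  assumes u: "unimodular u" and v: "v \<in> carrier M" and n: "s \<odot>\<^bsub>M\<^esub> v \<notin> line u"
  obtains W where "W \<in> verts" "rk W = 2" "u \<in> W" "v \<in> W"
proof -
  obtain g where g: "lin_aut g" "line u = g ` std_space 1"
    using line_subspace[OF u] by (auto simp: subspace_def)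
  have d1: "1 < d" using d_ge_3 by simp
  obtain h where h: "lin_aut h" "\<And>x. x \<in> std_space 1 \<Longrightarrow> h x = g x" "h (unit_vec 1) = v"
    using extend_image_std_space[OF g(1) d1 v] n unfolding g(2) by blast
  have "h ` std_space 1 = line u" using g(2) h(2) by simp
  moreover have "h ` std_space 1 \<subseteq> h ` std_space 2" by (intro image_mono coord_space_mono) auto
  ultimately have "u \<in> h ` std_space 2" using line_self[OF unimodular_closed[OF u]] by blast
  moreover have "h (unit_vec 1) \<in> h ` std_space 2" by (intro imageI unit_vec_in_coord_space) simp
  ultimately show thesis using that[of "h ` std_space 2"] vertex_image[OF h(1)] rk_image[OF h(1)] d_ge_3 h(3)
    by simp
qed

text \<open>A plane through \<open>u\<close> and \<open>v\<close> also contains \<open>w\<close>.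
  Its image is a plane through the three image points, in which \<open>u'\<close> and
  \<open>v'\<close> are again independent because nearness is preserved. This is how linear
  relations are transported; the new coefficients stay unknown and are found later by comparing
  coordinates.\<close>

lemma order_aut_collinear:
  assumes \<phi>: "order_aut \<phi>" and uni: "unimodular u" "unimodular v" "unimodular w"
    and uni': "unimodular u'" "unimodular v'" "unimodular w'"
    and im: "\<phi> (line u) = line u'" "\<phi> (line v) = line v'" "\<phi> (line w) = line w'"
    and n: "s \<odot>\<^bsub>M\<^esub> v \<notin> line u"
    and ab: "a \<in> carrier S" "b \<in> carrier S" "w = a \<odot>\<^bsub>M\<^esub> u \<oplus>\<^bsub>M\<^esub> b \<odot>\<^bsub>M\<^esub> v"
  obtains a' b' where "a' \<in> carrier S" "b' \<in> carrier S" "w' = a' \<odot>\<^bsub>M\<^esub> u' \<oplus>\<^bsub>M\<^esub> b' \<odot>\<^bsub>M\<^esub> v'"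
proof -
  obtain W where W: "W \<in> verts" "rk W = 2" "u \<in> W" "v \<in> W"
    by (rule plane_exists[OF uni(1) unimodular_closed[OF uni(2)] n])
  note W2 = vertex_subspace[OF W(1)]
  have "w \<in> W" unfolding ab(3) using W(3,4) ab by (intro subspace_add[OF W2] subspace_smult[OF W2])
  note W' = order_aut_closed[OF \<phi> W(1)]
  have sub: "\<phi> (line x) \<subseteq> \<phi> W" if "unimodular x" "x \<in> W" for x
    using order_aut_subset_iff[OF \<phi> line_vertex[OF that(1)] W(1)]
      line_subset_iff[OF W2 unimodular_closed[OF that(1)]] that(2) by simp
  have W'2: "subspace (Suc 1) (\<phi> W)" using vertex_subspace[OF W'] rk_order_aut[OF \<phi> W(1)] W(2) by (simp add: numeral_2_eq_2)
  have mem: "v' \<in> \<phi> W" "w' \<in> \<phi> W"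
    using sub[OF uni(2) W(4)] sub[OF uni(3) \<open>w \<in> W\<close>] im line_self unimodular_closed uni' by auto
  have "\<not> near (line v) (line u)" using near_line[OF unimodular_closed[OF uni(2)] line_subspace[OF uni(1)]] n by simp
  then have "\<not> near (line v') (line u')" using order_aut_near_line[OF \<phi> uni(2,1)] im by simp
  then have "s \<odot>\<^bsub>M\<^esub> v' \<notin> line u'" using near_line[OF unimodular_closed[OF uni'(2)] line_subspace[OF uni'(1)]] by simp
  from subspace_join[OF line_subspace[OF uni'(1)] W'2 _ mem(1) this mem(2)] sub[OF uni(1) W(3)] im(1)
  obtain x c where "x \<in> line u'" "c \<in> carrier S" "w' = x \<oplus>\<^bsub>M\<^esub> c \<odot>\<^bsub>M\<^esub> v'" by metis
  then show thesis using that by (auto simp: line_def)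
qed


section \<open>Automorphisms fixing a projective frame\<close>

lemma Unit_nonzero: "x \<in> Units S \<Longrightarrow> x \<noteq> \<zero>"
  using Unit_iff[of x] Units_closed[of x] socle_closed by auto

text \<open>A coordinate where \<open>u\<close> vanishes and \<open>v\<close> is a unit survives
  multiplication by \<open>s\<close>, so it certifies independence modulo the maximal ideal.\<close>

lemma not_in_lineI:
  assumes "i < d" "v i \<in> Units S" "u i = \<zero>" shows "s \<odot>\<^bsub>M\<^esub> v \<notin> line u"
proof
  assume "s \<odot>\<^bsub>M\<^esub> v \<in> line u"
  then obtain c where c: "c \<in> carrier S" "s \<odot>\<^bsub>M\<^esub> v = c \<odot>\<^bsub>M\<^esub> u" by (auto simp: line_def)
  then have "(s \<odot>\<^bsub>M\<^esub> v) i = (c \<odot>\<^bsub>M\<^esub> u) i" by simp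
  then have "s \<otimes> v i = \<zero>" using assms(1,3) c(1) by simp
  then show False using Unit_iff[of "v i"] Units_closed assms(2) by auto
qed

lemma line_eq_normalized:
  assumes "unimodular u" "unimodular v" "u 0 = \<one>" "v 0 = \<one>" "line u = line v"
  shows "u = v"
proof -
  obtain c where c: "c \<in> carrier S" "u = c \<odot>\<^bsub>M\<^esub> v"
    using assms(5) line_self[OF unimodular_closed[OF assms(1)]] by (auto simp: line_def)
  have "u 0 = c \<otimes> v 0" using c d_ge_3 by simp
  then have "c = \<one>" using assms(3,4) c by simp
  then show ?thesis using c(2) unimodular_closed[OF assms(2)] by simp
qed

lemma unimodularI: "v \<in> carrier M \<Longrightarrow> i < d \<Longrightarrow> v i \<in> Units S \<Longrightarrow> unimodular v"
  by (auto simp: unimodular_iff)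

text \<open>The image of the point e_0 + e_i lies on the join of the images of e_0 and e_i but is
  near neither, so both its coefficients are units. Their ratio is absorbed into the generator of
  the image of e_i; the generator \<open>a0\<close> is chosen once and shared by all
  \<open>i\<close>.\<close>

lemma exists_frame:
  assumes \<phi>: "order_aut \<phi>"
  obtains a where "\<And>i. i < d \<Longrightarrow> unimodular (a i) \<and> \<phi> (line (unit_vec i)) = line (a i)"
    "\<And>i. 0 < i \<Longrightarrow> i < d \<Longrightarrow> \<phi> (line (unit_vec 0 \<oplus>\<^bsub>M\<^esub> unit_vec i)) = line (a 0 \<oplus>\<^bsub>M\<^esub> a i)"
proof -
  have d0: "0 < d" using d_ge_3 by simp
  obtain a0 where a0: "unimodular a0" "\<phi> (line (unit_vec 0)) = line a0"
    by (rule order_aut_line[OF \<phi> unimodular_unit_vec[OF d0]])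
  note a0c = unimodular_closed[OF a0(1)]
  have "\<exists>x. unimodular x \<and> \<phi> (line (unit_vec i)) = line x \<and>
      \<phi> (line (unit_vec 0 \<oplus>\<^bsub>M\<^esub> unit_vec i)) = line (a0 \<oplus>\<^bsub>M\<^esub> x)" if i: "0 < i" "i < d" for i
  proof -
    let ?w = "unit_vec 0 \<oplus>\<^bsub>M\<^esub> unit_vec i"
    have wu: "unimodular ?w" using d0 by (intro unimodularI[of _ 0]) (use i in auto)
    obtain b where b: "unimodular b" "\<phi> (line (unit_vec i)) = line b"
      by (rule order_aut_line[OF \<phi> unimodular_unit_vec[OF i(2)]])
    note bc = unimodular_closed[OF b(1)]
    obtain w where w: "unimodular w" "\<phi> (line ?w) = line w"
      by (rule order_aut_line[OF \<phi> wu])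
    note wc = unimodular_closed[OF w(1)]
    have n: "s \<odot>\<^bsub>M\<^esub> unit_vec i \<notin> line (unit_vec 0)"
      by (rule not_in_lineI[of i]) (use i in auto)
    obtain \<alpha> \<beta> where ab: "\<alpha> \<in> carrier S" "\<beta> \<in> carrier S" "w = \<alpha> \<odot>\<^bsub>M\<^esub> a0 \<oplus>\<^bsub>M\<^esub> \<beta> \<odot>\<^bsub>M\<^esub> b"
      by (rule order_aut_collinear[OF \<phi> unimodular_unit_vec[OF d0] unimodular_unit_vec[OF i(2)] wu
            a0(1) b(1) w(1) a0(2) b(2) w(2) n, of \<one> \<one>]) auto
    \<comment> \<open>A non-unit coefficient disappears after multiplication by \<open>s\<close>.
      The image point would then be near the image of e_i, whereas e_0 + e_i is not near
      e_i.\<close>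
    have "\<alpha> \<in> Units S"
    proof (rule ccontr)
      assume "\<alpha> \<notin> Units S"
      then have "s \<otimes> \<alpha> = \<zero>" using Unit_or_annihilates_socle ab(1) by blast
      then have "s \<odot>\<^bsub>M\<^esub> w = (s \<otimes> \<beta>) \<odot>\<^bsub>M\<^esub> b"
        unfolding ab(3) using ab(1,2) a0c bc by (simp add: vec.smult_r_distr vec.smult_assoc1[symmetric])
      then have "s \<odot>\<^bsub>M\<^esub> w \<in> line b" using line_smult_mem[of "s \<otimes> \<beta>" b] ab(2) by simp
      then have "near (line w) (line b)" using near_line[OF wc line_subspace[OF b(1)]] by simp
      then have "near (line ?w) (line (unit_vec i))"
        using order_aut_near_line[OF \<phi> wu unimodular_unit_vec[OF i(2)]] w(2) b(2) by simp
      then have "s \<odot>\<^bsub>M\<^esub> ?w \<in> line (unit_vec i)"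
        using near_line[OF unimodular_closed[OF wu] line_subspace[OF unimodular_unit_vec[OF i(2)]]] by simp
      moreover have "s \<odot>\<^bsub>M\<^esub> ?w \<notin> line (unit_vec i)"
        by (rule not_in_lineI[of 0]) (use i d0 in auto)
      ultimately show False by simp
    qed
    have "\<beta> \<in> Units S"
    proof (rule ccontr)
      assume "\<beta> \<notin> Units S"
      then have "s \<otimes> \<beta> = \<zero>" using Unit_or_annihilates_socle ab(2) by blast
      then have "s \<odot>\<^bsub>M\<^esub> w = (s \<otimes> \<alpha>) \<odot>\<^bsub>M\<^esub> a0"
        unfolding ab(3) using ab(1,2) a0c bc by (simp add: vec.smult_r_distr vec.smult_assoc1[symmetric])
      then have "s \<odot>\<^bsub>M\<^esub> w \<in> line a0" using line_smult_mem[of "s \<otimes> \<alpha>" a0] ab(1) by simp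
      then have "near (line w) (line a0)" using near_line[OF wc line_subspace[OF a0(1)]] by simp
      then have "near (line ?w) (line (unit_vec 0))"
        using order_aut_near_line[OF \<phi> wu unimodular_unit_vec[OF d0]] w(2) a0(2) by simp
      then have "s \<odot>\<^bsub>M\<^esub> ?w \<in> line (unit_vec 0)"
        using near_line[OF unimodular_closed[OF wu] line_subspace[OF unimodular_unit_vec[OF d0]]] by simp
      moreover have "s \<odot>\<^bsub>M\<^esub> ?w \<notin> line (unit_vec 0)"
        by (rule not_in_lineI[of i]) (use i in auto)
      ultimately show False by simp
    qed
    \<comment> \<open>Dividing by \<alpha> makes the coefficient of \<open>a0\<close> equal to 1;
      the remaining factor rescales \<open>b\<close>.\<close>
    let ?c = "inv \<alpha> \<otimes> \<beta>"
    have c: "?c \<in> Units S" using \<open>\<alpha> \<in> Units S\<close> \<open>\<beta> \<in> Units S\<close> by simp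
    have "inv \<alpha> \<odot>\<^bsub>M\<^esub> w = a0 \<oplus>\<^bsub>M\<^esub> ?c \<odot>\<^bsub>M\<^esub> b"
      unfolding ab(3) using ab(1,2) a0c bc \<open>\<alpha> \<in> Units S\<close>
      by (simp add: vec.smult_r_distr vec.smult_assoc1[symmetric])
    moreover have "line (inv \<alpha> \<odot>\<^bsub>M\<^esub> w) = line w" using line_smult[OF w(1)] \<open>\<alpha> \<in> Units S\<close> by simp
    ultimately have "\<phi> (line ?w) = line (a0 \<oplus>\<^bsub>M\<^esub> ?c \<odot>\<^bsub>M\<^esub> b)" using w(2) by simp
    then show ?thesis using unimodular_smult[OF b(1) c] line_smult[OF b(1) c] b(2)
      by (intro exI[of _ "?c \<odot>\<^bsub>M\<^esub> b"]) simp
  qed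
  then obtain a where a: "\<And>i. 0 < i \<Longrightarrow> i < d \<Longrightarrow> unimodular (a i) \<and> \<phi> (line (unit_vec i)) = line (a i) \<and>
      \<phi> (line (unit_vec 0 \<oplus>\<^bsub>M\<^esub> unit_vec i)) = line (a0 \<oplus>\<^bsub>M\<^esub> a i)" by metis
  show thesis
    by (rule that[of "a(0 := a0)"]) (use a a0 in auto)
qed

text \<open>Inductively, the images of the first \<open>k\<close> frame points span the image of
  \<open>std_space k\<close>, by inclusion and rank. Since e_k is not near
  \<open>std_space k\<close>, its image is not near that span and can be taken as the next basis
  vector.\<close>

lemma exists_lin_aut_frame:
  assumes \<phi>: "order_aut \<phi>"
    and a: "\<And>i. i < d \<Longrightarrow> unimodular (a i) \<and> \<phi> (line (unit_vec i)) = line (a i)"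
    and k: "k \<le> d"
  shows "\<exists>g. lin_aut g \<and> (\<forall>i<k. g (unit_vec i) = a i)"
  using k
proof (induction k)
  case 0
  then show ?case using lin_aut_id by blast
next
  case (Suc k)
  then obtain g where g: "lin_aut g" "\<And>i. i < k \<Longrightarrow> g (unit_vec i) = a i" by auto
  have kd: "k < d" using Suc.prems by simp
  note ak = a[OF kd, THEN conjunct1]
  note akc = unimodular_closed[OF ak]
  have "s \<odot>\<^bsub>M\<^esub> a k \<notin> g ` std_space k"
  proof (cases "k = 0")
    case True
    then show ?thesis using ak lin_aut_zero[OF g(1)] by (simp add: unimodular_def)
  next
    case False
    have E: "std_space k \<in> verts" "rk (std_space k) = k"
      using vertexI[OF subspace_std] rk_eq[OF subspace_std] False kd by auto
    note E' = order_aut_closed[OF \<phi> E(1)]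
    have "g (unit_vec i) \<in> \<phi> (std_space k)" if i: "i \<in> {..<k}" "i < d" for i
    proof -
      have "unit_vec i \<in> std_space k" using i by (intro unit_vec_in_coord_space)
      then have "line (unit_vec i) \<subseteq> std_space k"
        using line_subset_iff[OF vertex_subspace[OF E(1)]] by simp
      then have "line (a i) \<subseteq> \<phi> (std_space k)"
        using order_aut_subset_iff[OF \<phi> line_vertex[OF unimodular_unit_vec[OF i(2)]] E(1)] a[OF i(2)] by simp
      then show ?thesis using g(2) i line_self unimodular_closed a by auto
    qed
    then have "g ` std_space k \<subseteq> \<phi> (std_space k)"
      by (rule image_coord_space_subset[OF g(1) vertex_subspace[OF E']])
    then have eq: "g ` std_space k = \<phi> (std_space k)"
      using vertex_eqI[OF vertex_image[OF g(1)] E'] rk_image[OF g(1)] rk_order_aut[OF \<phi> E(1)] E(2) False kd by simp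
    have "s \<odot>\<^bsub>M\<^esub> unit_vec k \<notin> std_space k"
    proof
      assume "s \<odot>\<^bsub>M\<^esub> unit_vec k \<in> std_space k"
      then have "(s \<odot>\<^bsub>M\<^esub> unit_vec k) k = \<zero>" using kd by (intro coord_space_nth) auto
      then show False using kd socle_nonzero by simp
    qed
    then have "\<not> near (line (unit_vec k)) (std_space k)"
      using near_line[OF unit_vec_closed vertex_subspace[OF E(1)]] by simp
    then have "\<not> near (line (a k)) (\<phi> (std_space k))"
      using order_aut_near[OF \<phi> unimodular_unit_vec[OF kd] E(1)] a[OF kd] by simp
    then show ?thesis using near_line[OF akc vertex_subspace[OF E']] eq by simp
  qed
  then obtain h where h: "lin_aut h" "\<And>x. x \<in> std_space k \<Longrightarrow> h x = g x" "h (unit_vec k) = a k"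
    using extend_image_std_space[OF g(1) kd akc] by blast
  have "h (unit_vec i) = a i" if "i < Suc k" for i
  proof (cases "i = k")
    case False
    then show ?thesis using that h(2) g(2) unit_vec_in_coord_space[of i "{..<k}"] by simp
  qed (simp add: h(3))
  then show ?case using h(1) by blast
qed

text \<open>The points e_0 + e_i do the work of the single unit point of a classical frame: each of
  them fixes the unit on one coordinate axis, so the axes can be treated separately.\<close>

definition fixes_frame :: "((nat \<Rightarrow> 'a) set \<Rightarrow> (nat \<Rightarrow> 'a) set) \<Rightarrow> bool" where
  "fixes_frame \<psi> \<longleftrightarrow> order_aut \<psi> \<and> (\<forall>i<d. \<psi> (line (unit_vec i)) = line (unit_vec i)) \<and>
     (\<forall>i. 0 < i \<longrightarrow> i < d \<longrightarrow> \<psi> (line (unit_vec 0 \<oplus>\<^bsub>M\<^esub> unit_vec i)) = line (unit_vec 0 \<oplus>\<^bsub>M\<^esub> unit_vec i))"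

abbreviation axis :: "nat \<Rightarrow> 'a \<Rightarrow> nat \<Rightarrow> 'a" where
  "axis i x \<equiv> unit_vec 0 \<oplus>\<^bsub>M\<^esub> x \<odot>\<^bsub>M\<^esub> unit_vec i"

lemma axis_unimodular: "0 < i \<Longrightarrow> i < d \<Longrightarrow> x \<in> carrier S \<Longrightarrow> unimodular (axis i x)"
  using d_ge_3 by (intro unimodularI[of _ 0]) auto

lemma axis_0: "i < d \<Longrightarrow> 0 < i \<Longrightarrow> x \<in> carrier S \<Longrightarrow> axis i x 0 = \<one>"
  using d_ge_3 by simp

lemma axis_i: "i < d \<Longrightarrow> 0 < i \<Longrightarrow> x \<in> carrier S \<Longrightarrow> axis i x i = x"
  using d_ge_3 by simp

lemma axis_eqD: "0 < i \<Longrightarrow> i < d \<Longrightarrow> x \<in> carrier S \<Longrightarrow> y \<in> carrier S \<Longrightarrow> line (axis i x) = line (axis i y) \<Longrightarrow> x = y"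
  using line_eq_normalized[of "axis i x" "axis i y"] axis_unimodular axis_0 axis_i by metis

text \<open>The image stays on the join of e_0 and e_i and is not near e_i, so its coefficient at
  e_0 is a unit and can be scaled to 1. A generator with first coordinate 1 is unique.\<close>

lemma fixes_frame_axis:
  assumes \<psi>: "fixes_frame \<psi>" and i: "0 < i" "i < d" and x: "x \<in> carrier S"
  shows "\<exists>!y. y \<in> carrier S \<and> \<psi> (line (axis i x)) = line (axis i y)"
proof -
  have \<phi>: "order_aut \<psi>" and fix_e: "\<And>j. j < d \<Longrightarrow> \<psi> (line (unit_vec j)) = line (unit_vec j)"
    using \<psi> by (auto simp: fixes_frame_def)
  have d0: "0 < d" using d_ge_3 by simp
  note ux = axis_unimodular[OF i x]
  obtain w where w: "unimodular w" "\<psi> (line (axis i x)) = line w"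
    by (rule order_aut_line[OF \<phi> ux])
  note wc = unimodular_closed[OF w(1)]
  have n: "s \<odot>\<^bsub>M\<^esub> unit_vec i \<notin> line (unit_vec 0)"
    by (rule not_in_lineI[of i]) (use i in auto)
  obtain a b where ab: "a \<in> carrier S" "b \<in> carrier S" "w = a \<odot>\<^bsub>M\<^esub> unit_vec 0 \<oplus>\<^bsub>M\<^esub> b \<odot>\<^bsub>M\<^esub> unit_vec i"
    by (rule order_aut_collinear[OF \<phi> unimodular_unit_vec[OF d0] unimodular_unit_vec[OF i(2)] ux
          unimodular_unit_vec[OF d0] unimodular_unit_vec[OF i(2)] w(1) fix_e[OF d0] fix_e[OF i(2)] w(2) n, of \<one> x])
       (use x in auto)
  have "s \<odot>\<^bsub>M\<^esub> axis i x \<notin> line (unit_vec i)"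
    by (rule not_in_lineI[of 0]) (use i d0 x in auto)
  then have "\<not> near (line (axis i x)) (line (unit_vec i))"
    using near_line[OF unimodular_closed[OF ux] line_subspace[OF unimodular_unit_vec[OF i(2)]]] by simp
  then have "\<not> near (line w) (line (unit_vec i))"
    using order_aut_near_line[OF \<phi> ux unimodular_unit_vec[OF i(2)]] w(2) fix_e[OF i(2)] by simp
  then have n': "s \<odot>\<^bsub>M\<^esub> w \<notin> line (unit_vec i)"
    using near_line[OF wc line_subspace[OF unimodular_unit_vec[OF i(2)]]] by simp
  have a: "a \<in> Units S"
  proof (rule ccontr)
    assume "a \<notin> Units S"
    then have "s \<otimes> a = \<zero>" using Unit_or_annihilates_socle ab(1) by blast
    then have "s \<odot>\<^bsub>M\<^esub> w = (s \<otimes> b) \<odot>\<^bsub>M\<^esub> unit_vec i"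
      unfolding ab(3) using ab(1,2) by (simp add: vec.smult_r_distr vec.smult_assoc1[symmetric])
    then show False using n' line_smult_mem[of "s \<otimes> b" "unit_vec i"] ab(2) by simp
  qed
  have "inv a \<odot>\<^bsub>M\<^esub> w = axis i (inv a \<otimes> b)"
    unfolding ab(3) using ab(1,2) a by (simp add: vec.smult_r_distr vec.smult_assoc1[symmetric])
  moreover have "line (inv a \<odot>\<^bsub>M\<^esub> w) = line w" using line_smult[OF w(1)] a by simp
  ultimately have "\<psi> (line (axis i x)) = line (axis i (inv a \<otimes> b))" using w(2) by simp
  then show ?thesis
    using a ab(2) axis_eqD[OF i] by (intro ex1I[of _ "inv a \<otimes> b"]) auto
qed

definition coord_map :: "((nat \<Rightarrow> 'a) set \<Rightarrow> (nat \<Rightarrow> 'a) set) \<Rightarrow> nat \<Rightarrow> 'a \<Rightarrow> 'a" where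
  "coord_map \<psi> i x = (THE y. y \<in> carrier S \<and> \<psi> (line (axis i x)) = line (axis i y))"

lemma coord_map:
  assumes "fixes_frame \<psi>" "0 < i" "i < d" "x \<in> carrier S"
  shows "coord_map \<psi> i x \<in> carrier S" "\<psi> (line (axis i x)) = line (axis i (coord_map \<psi> i x))"
  using theI'[OF fixes_frame_axis[OF assms]] unfolding coord_map_def by auto

lemma coord_map_eqI:
  assumes "fixes_frame \<psi>" "0 < i" "i < d" "x \<in> carrier S" "y \<in> carrier S" "\<psi> (line (axis i x)) = line (axis i y)"
  shows "coord_map \<psi> i x = y"
  using fixes_frame_axis[OF assms(1-4)] coord_map[OF assms(1-4)] assms(5,6) by auto

lemma coord_map_0_1:
  assumes \<psi>: "fixes_frame \<psi>" and i: "0 < i" "i < d"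
  shows "coord_map \<psi> i \<zero> = \<zero>" "coord_map \<psi> i \<one> = \<one>"
proof -
  show "coord_map \<psi> i \<zero> = \<zero>"
    by (rule coord_map_eqI[OF \<psi> i]) (use \<psi> i d_ge_3 in \<open>auto simp: fixes_frame_def\<close>)
  show "coord_map \<psi> i \<one> = \<one>"
    by (rule coord_map_eqI[OF \<psi> i]) (use \<psi> i d_ge_3 in \<open>auto simp: fixes_frame_def\<close>)
qed

section \<open>Hyperplanes that cut out affine points\<close>

definition graph_hyperplane :: "nat \<Rightarrow> 'a \<Rightarrow> (nat \<Rightarrow> 'a) set" where
  "graph_hyperplane i y = {v \<in> carrier M. v i = y \<otimes> v 0}"

text \<open>This hyperplane is spanned by \<open>axis i y\<close> and by the e_j with
  \<open>j\<close> different from 0 and \<open>i\<close>, hence by points that a frame-fixing map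
  controls. The shear \<open>column_op 0 (axis i y)\<close> carries the coordinate hyperplane v_i =
  0 to it, which shows that it is free.\<close>

lemma graph_hyperplane:
  assumes i: "0 < i" "i < d" and y: "y \<in> carrier S"
  shows "graph_hyperplane i y = column_op 0 (axis i y) ` coord_space ({..<d} - {i})"
    and "lin_aut (column_op 0 (axis i y))"
    and "graph_hyperplane i y \<in> verts" "rk (graph_hyperplane i y) = d - 1"
proof -
  have d0: "0 < d" using d_ge_3 by simp
  let ?c = "column_op 0 (axis i y)"
  show c: "lin_aut ?c" by (rule lin_aut_column_op) (use i y d0 in auto)
  have cn: "?c v j = (if j = i then v i \<oplus> v 0 \<otimes> y else v j)" if "j < d" "v \<in> carrier M" for v j
    using that i y d0 by (auto simp: column_op_def)
  have iff: "?c v \<in> graph_hyperplane i y \<longleftrightarrow> v \<in> coord_space ({..<d} - {i})" if v: "v \<in> carrier M" for v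
  proof -
    have "v i \<oplus> v 0 \<otimes> y = y \<otimes> v 0 \<longleftrightarrow> v i = \<zero>"
    proof -
      have "v i \<oplus> v 0 \<otimes> y = y \<otimes> v 0 \<longleftrightarrow> v i \<oplus> v 0 \<otimes> y = \<zero> \<oplus> v 0 \<otimes> y"
        using v i d0 y by (simp add: m_comm)
      also have "\<dots> \<longleftrightarrow> v i = \<zero>" using v i d0 y by (intro add.right_cancel) auto
      finally show ?thesis .
    qed
    moreover have "?c v i = v i \<oplus> v 0 \<otimes> y" "?c v 0 = v 0" using cn v i d0 by auto
    ultimately show ?thesis
      using semilinear_closed[OF c v] v i unfolding graph_hyperplane_def coord_space_def by auto
  qed
  show eq: "graph_hyperplane i y = ?c ` coord_space ({..<d} - {i})"
  proof (intro equalityI subsetI)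
    fix w assume w: "w \<in> graph_hyperplane i y"
    then have wc: "w \<in> carrier M" by (simp add: graph_hyperplane_def)
    have "inv_on_vecs ?c w \<in> coord_space ({..<d} - {i})"
      using iff[OF inv_on_vecs_closed[OF c wc]] inv_on_vecs_right[OF c wc] w by simp
    then show "w \<in> ?c ` coord_space ({..<d} - {i})"
      using inv_on_vecs_right[OF c wc] by (intro image_eqI[of _ _ "inv_on_vecs ?c w"]) simp_all
  next
    fix w assume "w \<in> ?c ` coord_space ({..<d} - {i})"
    then obtain v where v: "v \<in> coord_space ({..<d} - {i})" "w = ?c v" by blast
    show "w \<in> graph_hyperplane i y" unfolding v(2) using iff[OF coord_space_closed[OF v(1)]] v(1) by blast
  qed
  have "subspace (d - 1) (coord_space ({..<d} - {i}))"
    using subspace_coord_space[of "{..<d} - {i}"] i by (simp add: card_Diff_subset)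
  then obtain g where g: "lin_aut g" "coord_space ({..<d} - {i}) = g ` std_space (d - 1)"
    by (auto simp: subspace_def)
  have im: "graph_hyperplane i y = (?c \<circ> g) ` std_space (d - 1)"
    unfolding eq g(2) by (simp add: image_comp)
  show "graph_hyperplane i y \<in> verts" "rk (graph_hyperplane i y) = d - 1"
    unfolding im using vertex_image[OF lin_aut_comp[OF c g(1)]] rk_image[OF lin_aut_comp[OF c g(1)]] d_ge_3 by auto
qed

text \<open>The points that span the hyperplane on the right are images of points of the hyperplane
  on the left. This gives one inclusion, and equal ranks give the other.\<close>

lemma fixes_frame_graph_hyperplane:
  assumes \<psi>: "fixes_frame \<psi>" and i: "0 < i" "i < d" and x: "x \<in> carrier S"
  shows "\<psi> (graph_hyperplane i x) = graph_hyperplane i (coord_map \<psi> i x)"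
proof -
  have \<phi>: "order_aut \<psi>" and fix_e: "\<And>j. j < d \<Longrightarrow> \<psi> (line (unit_vec j)) = line (unit_vec j)"
    using \<psi> by (auto simp: fixes_frame_def)
  have d0: "0 < d" using d_ge_3 by simp
  let ?y = "coord_map \<psi> i x"
  note y = coord_map[OF \<psi> i x]
  note H = graph_hyperplane[OF i x] and H' = graph_hyperplane[OF i y(1)]
  note \<psi>H = order_aut_closed[OF \<phi> H(3)]
  have mem: "v' \<in> \<psi> (graph_hyperplane i x)" if "unimodular v" "v \<in> graph_hyperplane i x" "\<psi> (line v) = line v'" "v' \<in> carrier M" for v v'
  proof -
    have "line v \<subseteq> graph_hyperplane i x"
      using line_subset_iff[OF vertex_subspace[OF H(3)] unimodular_closed[OF that(1)]] that(2) by simp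
    then have "line v' \<subseteq> \<psi> (graph_hyperplane i x)"
      using order_aut_subset_iff[OF \<phi> line_vertex[OF that(1)] H(3)] that(3) by simp
    then show ?thesis using line_self[OF that(4)] by blast
  qed
  have "column_op 0 (axis i ?y) (unit_vec j) \<in> \<psi> (graph_hyperplane i x)" if j: "j \<in> {..<d} - {i}" "j < d" for j
  proof (cases "j = 0")
    case True
    have "column_op 0 (axis i ?y) (unit_vec 0) = axis i ?y"
      by (intro vec_eqI semilinear_closed[OF H'(2)]) (use i d0 y(1) in \<open>auto simp: column_op_def\<close>)
    moreover have "axis i ?y \<in> \<psi> (graph_hyperplane i x)"
      by (rule mem[OF axis_unimodular[OF i x] _ y(2)]) (use i d0 x y(1) in \<open>auto simp: graph_hyperplane_def\<close>)
    ultimately show ?thesis using True by simp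
  next
    case False
    have "column_op 0 (axis i ?y) (unit_vec j) = unit_vec j"
      by (intro vec_eqI semilinear_closed[OF H'(2)]) (use i d0 y(1) False in \<open>auto simp: column_op_def\<close>)
    moreover have "unit_vec j \<in> \<psi> (graph_hyperplane i x)"
      by (rule mem[OF unimodular_unit_vec[OF j(2)] _ fix_e[OF j(2)]]) (use i d0 x False j in \<open>auto simp: graph_hyperplane_def\<close>)
    ultimately show ?thesis by simp
  qed
  then have "graph_hyperplane i ?y \<subseteq> \<psi> (graph_hyperplane i x)"
    unfolding H'(1) by (rule image_coord_space_subset[OF H'(2) vertex_subspace[OF \<psi>H]])
  then show ?thesis
    using vertex_eqI[OF H'(3) \<psi>H] rk_order_aut[OF \<phi> H(3)] H(4) H'(4) by simp
qed

text \<open>The hyperplane at infinity v_0 = 0 is spanned by fixed frame points. The points not near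
  it are those with a unit at index 0, so being affine is preserved.\<close>

lemma fixes_frame_coord_hyperplane:
  assumes \<psi>: "fixes_frame \<psi>"
  defines "K \<equiv> coord_space ({..<d} - {0})"
  shows "K \<in> verts" "\<psi> K = K"
proof -
  have \<phi>: "order_aut \<psi>" and fix_e: "\<And>j. j < d \<Longrightarrow> \<psi> (line (unit_vec j)) = line (unit_vec j)"
    using \<psi> by (auto simp: fixes_frame_def)
  have sub: "subspace (d - 1) K"
    unfolding K_def using subspace_coord_space[of "{..<d} - {0}"] d_ge_3 by (simp add: card_Diff_subset)
  show K: "K \<in> verts" using vertexI[OF sub] d_ge_3 by simp
  have "unit_vec j \<in> \<psi> K" if j: "j \<in> {..<d} - {0}" "j < d" for j
  proof -
    have "line (unit_vec j) \<subseteq> K"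
      using line_subset_iff[OF sub unit_vec_closed] unit_vec_in_coord_space j(1) by (simp add: K_def)
    then have "line (unit_vec j) \<subseteq> \<psi> K"
      using order_aut_subset_iff[OF \<phi> line_vertex[OF unimodular_unit_vec[OF j(2)]] K] fix_e[OF j(2)] by simp
    then show ?thesis using line_self by blast
  qed
  then have "(\<lambda>v. v) ` K \<subseteq> \<psi> K"
    unfolding K_def by (rule image_coord_space_subset[OF lin_aut_id vertex_subspace[OF order_aut_closed[OF \<phi> K], unfolded K_def]])
  then show "\<psi> K = K"
    using vertex_eqI[OF K order_aut_closed[OF \<phi> K]] rk_order_aut[OF \<phi> K] by simp
qed

text \<open>An affine point lies on the hyperplanes v_i = x_i v_0 given by its coordinates x_i, and
  their images are known; so each coordinate of the image vector \<open>w\<close> is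
  \<open>w 0\<close> times a value of \<open>coord_map\<close>. Not being near the hyperplane at
  infinity makes \<open>w 0\<close> a unit.\<close>

lemma fixes_frame_affine:
  assumes \<psi>: "fixes_frame \<psi>" and v: "v \<in> carrier M" "v 0 = \<one>"
  defines "v' \<equiv> \<lambda>i\<in>{..<d}. if i = 0 then \<one> else coord_map \<psi> i (v i)"
  shows "unimodular v" "unimodular v'" "\<psi> (line v) = line v'"
proof -
  have \<phi>: "order_aut \<psi>" using \<psi> by (auto simp: fixes_frame_def)
  have d0: "0 < d" using d_ge_3 by simp
  show vu: "unimodular v" by (rule unimodularI[of _ 0]) (use v d0 in auto)
  have v'c: "v' \<in> carrier M"
    unfolding v'_def using coord_map(1)[OF \<psi>] v by (intro vec_closedI) auto
  show "unimodular v'" by (rule unimodularI[of _ 0]) (use v'c d0 in \<open>auto simp: v'_def\<close>)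
  obtain w where w: "unimodular w" "\<psi> (line v) = line w" by (rule order_aut_line[OF \<phi> vu])
  note wc = unimodular_closed[OF w(1)]
  let ?K = "coord_space ({..<d} - {0})"
  note K = fixes_frame_coord_hyperplane[OF \<psi>]
  have "s \<odot>\<^bsub>M\<^esub> v \<notin> ?K"
  proof
    assume "s \<odot>\<^bsub>M\<^esub> v \<in> ?K"
    then have "(s \<odot>\<^bsub>M\<^esub> v) 0 = \<zero>" using d0 by (intro coord_space_nth) auto
    then show False using d0 v socle_nonzero by simp
  qed
  then have "\<not> near (line v) ?K" using near_line[OF v(1) vertex_subspace[OF K(1)]] by simp
  then have "\<not> near (line w) ?K" using order_aut_near[OF \<phi> vu K(1)] K(2) w(2) by simp
  then have "s \<odot>\<^bsub>M\<^esub> w \<notin> ?K" using near_line[OF wc vertex_subspace[OF K(1)]] by simp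
  then have "s \<otimes> w 0 \<noteq> \<zero>" using wc d0 by (auto simp: coord_space_def)
  then have w0: "w 0 \<in> Units S" using Unit_iff[of "w 0"] wc d0 by auto
  have "w = w 0 \<odot>\<^bsub>M\<^esub> v'"
  proof (rule vec_eqI[OF wc])
    show "w 0 \<odot>\<^bsub>M\<^esub> v' \<in> carrier M" using v'c wc d0 by auto
    fix i assume i: "i < d"
    show "w i = (w 0 \<odot>\<^bsub>M\<^esub> v') i"
    proof (cases "i = 0")
      case True
      then show ?thesis using d0 wc by (simp add: v'_def)
    next
      case False
      then have i0: "0 < i" by simp
      have vi: "v i \<in> carrier S" using v i by auto
      note H = graph_hyperplane[OF i0 i vi]
      have "v \<in> graph_hyperplane i (v i)" using v vi by (simp add: graph_hyperplane_def)
      then have "line v \<subseteq> graph_hyperplane i (v i)"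
        using line_subset_iff[OF vertex_subspace[OF H(3)] v(1)] by simp
      then have "line w \<subseteq> \<psi> (graph_hyperplane i (v i))"
        using order_aut_subset_iff[OF \<phi> line_vertex[OF vu] H(3)] w(2) by simp
      then have "w \<in> graph_hyperplane i (coord_map \<psi> i (v i))"
        using fixes_frame_graph_hyperplane[OF \<psi> i0 i vi] line_self[OF wc] by auto
      then have "w i = coord_map \<psi> i (v i) \<otimes> w 0" by (simp add: graph_hyperplane_def)
      then show ?thesis using i False coord_map(1)[OF \<psi> i0 i vi] wc d0 by (simp add: v'_def m_comm)
    qed
  qed
  then show "\<psi> (line v) = line v'"
    using w(2) line_smult[OF \<open>unimodular v'\<close> w0] by simp
qed


section \<open>The ring automorphism of a frame-fixing automorphism\<close>

text \<open>A point at infinity is the intersection of two joins: that of e_i and e_j, and that of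
  e_0 with the affine point e_0 + e_i + x e_j, whose image is known. The two expansions of the image
  vector are compared at the indices \<open>i\<close> and \<open>j\<close>.\<close>

lemma coord_map_plane:
  assumes \<psi>: "fixes_frame \<psi>" and i: "0 < i" "i < d" and j: "0 < j" "j < d" and ij: "i \<noteq> j"
    and x: "x \<in> carrier S"
  shows "\<psi> (line (unit_vec i \<oplus>\<^bsub>M\<^esub> x \<odot>\<^bsub>M\<^esub> unit_vec j)) = line (unit_vec i \<oplus>\<^bsub>M\<^esub> coord_map \<psi> j x \<odot>\<^bsub>M\<^esub> unit_vec j)"
proof -
  have \<phi>: "order_aut \<psi>" and fix_e: "\<And>j. j < d \<Longrightarrow> \<psi> (line (unit_vec j)) = line (unit_vec j)"
    using \<psi> by (auto simp: fixes_frame_def)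
  have d0: "0 < d" using d_ge_3 by simp
  let ?y = "coord_map \<psi> j x"
  have y: "?y \<in> carrier S" using coord_map(1)[OF \<psi> j x] .
  let ?u = "unit_vec i \<oplus>\<^bsub>M\<^esub> x \<odot>\<^bsub>M\<^esub> unit_vec j" and ?u' = "unit_vec i \<oplus>\<^bsub>M\<^esub> ?y \<odot>\<^bsub>M\<^esub> unit_vec j"
  have uu: "unimodular ?u" "unimodular ?u'"
    using i j ij x y by (auto intro!: unimodularI[of _ i])
  obtain w where w: "unimodular w" "\<psi> (line ?u) = line w" by (rule order_aut_line[OF \<phi> uu(1)])
  let ?v = "unit_vec 0 \<oplus>\<^bsub>M\<^esub> ?u"
  have vc: "?v \<in> carrier M" using x by simp
  have v0: "?v 0 = \<one>" using d0 i j x by simp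
  have eq: "(\<lambda>k\<in>{..<d}. if k = 0 then \<one> else coord_map \<psi> k (?v k)) = unit_vec 0 \<oplus>\<^bsub>M\<^esub> ?u'"
    by (rule vec_eqI)
       (use i j ij x y d0 coord_map_0_1[OF \<psi>] coord_map(1)[OF \<psi>] in \<open>auto intro!: vec_closedI\<close>)
  have v: "unimodular ?v" "unimodular (unit_vec 0 \<oplus>\<^bsub>M\<^esub> ?u')" "\<psi> (line ?v) = line (unit_vec 0 \<oplus>\<^bsub>M\<^esub> ?u')"
    using fixes_frame_affine[OF \<psi> vc v0] unfolding eq by auto
  have n1: "s \<odot>\<^bsub>M\<^esub> unit_vec j \<notin> line (unit_vec i)"
    by (rule not_in_lineI[of j]) (use ij j in auto)
  obtain a b where ab: "a \<in> carrier S" "b \<in> carrier S" "w = a \<odot>\<^bsub>M\<^esub> unit_vec i \<oplus>\<^bsub>M\<^esub> b \<odot>\<^bsub>M\<^esub> unit_vec j"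
    by (rule order_aut_collinear[OF \<phi> unimodular_unit_vec[OF i(2)] unimodular_unit_vec[OF j(2)] uu(1)
          unimodular_unit_vec[OF i(2)] unimodular_unit_vec[OF j(2)] w(1) fix_e[OF i(2)] fix_e[OF j(2)] w(2) n1, of \<one> x])
       (use x in auto)
  have n2: "s \<odot>\<^bsub>M\<^esub> ?v \<notin> line (unit_vec 0)"
    by (rule not_in_lineI[of i]) (use i ij x in auto)
  have "?u = \<ominus> \<one> \<odot>\<^bsub>M\<^esub> unit_vec 0 \<oplus>\<^bsub>M\<^esub> \<one> \<odot>\<^bsub>M\<^esub> ?v"
    by (rule vec_eqI) (use i j d0 x in \<open>auto simp: l_neg\<close>)
  then obtain a' b' where ab': "a' \<in> carrier S" "b' \<in> carrier S"
      "w = a' \<odot>\<^bsub>M\<^esub> unit_vec 0 \<oplus>\<^bsub>M\<^esub> b' \<odot>\<^bsub>M\<^esub> (unit_vec 0 \<oplus>\<^bsub>M\<^esub> ?u')"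
    by (rule order_aut_collinear[OF \<phi> unimodular_unit_vec[OF d0] v(1) uu(1)
          unimodular_unit_vec[OF d0] v(2) w(1) fix_e[OF d0] v(3) w(2) n2, of "\<ominus> \<one>" \<one>, rotated 2]) auto
  have wi: "a = b'"
  proof -
    have "w i = a" using ab i j ij by simp
    moreover have "w i = b'" using ab' i j ij y by simp
    ultimately show ?thesis by simp
  qed
  have wj: "b = b' \<otimes> ?y"
  proof -
    have "w j = b" using ab i j ij by simp
    moreover have "w j = b' \<otimes> ?y" using ab' i j ij y by simp
    ultimately show ?thesis by simp
  qed
  have "w = b' \<odot>\<^bsub>M\<^esub> ?u'"
    unfolding ab(3) wi wj using ab'(2) y by (simp add: vec.smult_r_distr vec.smult_assoc1)
  then have "w \<in> line ?u'" using line_smult_mem[OF ab'(2)] by simp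
  then show ?thesis using line_unimodular_eq[OF uu(2) _ w(1)] w(2) by simp
qed

text \<open>The affine point with coordinates y and yx lies on the join of e_0 and e_i + x e_j.
  Reading this incidence after the map gives the product rule, at first with the coordinate maps of
  two different axes.\<close>

lemma coord_map_mult:
  assumes \<psi>: "fixes_frame \<psi>" and i: "0 < i" "i < d" and j: "0 < j" "j < d" and ij: "i \<noteq> j"
    and x: "x \<in> carrier S" and y: "y \<in> carrier S"
  shows "coord_map \<psi> j (y \<otimes> x) = coord_map \<psi> i y \<otimes> coord_map \<psi> j x"
proof -
  have \<phi>: "order_aut \<psi>" and fix_e: "\<And>j. j < d \<Longrightarrow> \<psi> (line (unit_vec j)) = line (unit_vec j)"
    using \<psi> by (auto simp: fixes_frame_def)
  have d0: "0 < d" using d_ge_3 by simp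
  let ?x = "coord_map \<psi> j x" and ?y = "coord_map \<psi> i y" and ?z = "coord_map \<psi> j (y \<otimes> x)"
  have x': "?x \<in> carrier S" and y': "?y \<in> carrier S" and z': "?z \<in> carrier S"
    using coord_map(1)[OF \<psi>] i j x y by auto
  let ?u = "unit_vec i \<oplus>\<^bsub>M\<^esub> x \<odot>\<^bsub>M\<^esub> unit_vec j" and ?u' = "unit_vec i \<oplus>\<^bsub>M\<^esub> ?x \<odot>\<^bsub>M\<^esub> unit_vec j"
  have uu: "unimodular ?u" "unimodular ?u'"
    using i j ij x x' by (auto intro!: unimodularI[of _ i])
  let ?v = "unit_vec 0 \<oplus>\<^bsub>M\<^esub> (y \<odot>\<^bsub>M\<^esub> unit_vec i \<oplus>\<^bsub>M\<^esub> (y \<otimes> x) \<odot>\<^bsub>M\<^esub> unit_vec j)"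
  let ?v' = "unit_vec 0 \<oplus>\<^bsub>M\<^esub> (?y \<odot>\<^bsub>M\<^esub> unit_vec i \<oplus>\<^bsub>M\<^esub> ?z \<odot>\<^bsub>M\<^esub> unit_vec j)"
  have vc: "?v \<in> carrier M" using x y by simp
  have v0: "?v 0 = \<one>" using d0 i j x y by simp
  have eq: "(\<lambda>k\<in>{..<d}. if k = 0 then \<one> else coord_map \<psi> k (?v k)) = ?v'"
    by (rule vec_eqI)
       (use i j ij x y y' z' d0 coord_map_0_1[OF \<psi>] coord_map(1)[OF \<psi>] in \<open>auto intro!: vec_closedI\<close>)
  have v: "unimodular ?v" "unimodular ?v'" "\<psi> (line ?v) = line ?v'"
    using fixes_frame_affine[OF \<psi> vc v0] unfolding eq by auto
  have n: "s \<odot>\<^bsub>M\<^esub> ?u \<notin> line (unit_vec 0)"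
    by (rule not_in_lineI[of i]) (use i ij x in auto)
  have "?v = \<one> \<odot>\<^bsub>M\<^esub> unit_vec 0 \<oplus>\<^bsub>M\<^esub> y \<odot>\<^bsub>M\<^esub> ?u"
    by (rule vec_eqI) (use x y ij in auto)
  then obtain a b where ab: "a \<in> carrier S" "b \<in> carrier S" "?v' = a \<odot>\<^bsub>M\<^esub> unit_vec 0 \<oplus>\<^bsub>M\<^esub> b \<odot>\<^bsub>M\<^esub> ?u'"
    by (rule order_aut_collinear[OF \<phi> unimodular_unit_vec[OF d0] uu(1) v(1)
          unimodular_unit_vec[OF d0] uu(2) v(2) fix_e[OF d0] coord_map_plane[OF \<psi> i j ij x] v(3) n, of \<one> y, rotated 2])
       (use y in auto)
  have "?v' i = (a \<odot>\<^bsub>M\<^esub> unit_vec 0 \<oplus>\<^bsub>M\<^esub> b \<odot>\<^bsub>M\<^esub> ?u') i" "?v' j = (a \<odot>\<^bsub>M\<^esub> unit_vec 0 \<oplus>\<^bsub>M\<^esub> b \<odot>\<^bsub>M\<^esub> ?u') j"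
    using ab(3) by simp_all
  then have "?y = b" "?z = b \<otimes> ?x" using i j ij y' z' x' ab(1,2) by simp_all
  then show ?thesis by simp
qed

text \<open>In the product rule the factor on axis \<open>j\<close> is set to 1, which its
  coordinate map fixes; what remains relates the two axes.\<close>

lemma coord_map_indep:
  assumes \<psi>: "fixes_frame \<psi>" and i: "0 < i" "i < d" and j: "0 < j" "j < d"
    and x: "x \<in> carrier S"
  shows "coord_map \<psi> i x = coord_map \<psi> j x"
proof (cases "i = j")
  case False
  then show ?thesis
    using coord_map_mult[OF \<psi> i j False one_closed x] coord_map_0_1(2)[OF \<psi> j] coord_map(1)[OF \<psi> i x] x by simp
qed simp

text \<open>The affine point with coordinates x and x + y lies on the join of e_0 + y e_j and the
  fixed point at infinity e_i + e_j. Comparing its image at 0, \<open>i\<close> and \<open>j\<close>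
  gives additivity; the auxiliary index \<open>j\<close> exists because
  \<open>d \<ge> 3\<close>.\<close>

lemma coord_map_add:
  assumes \<psi>: "fixes_frame \<psi>" and i: "0 < i" "i < d" and x: "x \<in> carrier S" and y: "y \<in> carrier S"
  shows "coord_map \<psi> i (x \<oplus> y) = coord_map \<psi> i x \<oplus> coord_map \<psi> i y"
proof -
  obtain j where j: "0 < j" "j < d" and ij: "i \<noteq> j"
    using d_ge_3 that[of 1] that[of 2] by (cases "i = 1") auto
  have \<phi>: "order_aut \<psi>" using \<psi> by (auto simp: fixes_frame_def)
  have d0: "0 < d" using d_ge_3 by simp
  let ?x = "coord_map \<psi> i x" and ?y = "coord_map \<psi> j y" and ?z = "coord_map \<psi> j (x \<oplus> y)"
  have x': "?x \<in> carrier S" and y': "?y \<in> carrier S" and z': "?z \<in> carrier S"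
    using coord_map(1)[OF \<psi>] i j x y by auto
  let ?u = "unit_vec i \<oplus>\<^bsub>M\<^esub> \<one> \<odot>\<^bsub>M\<^esub> unit_vec j"
  have uu: "unimodular ?u"
    using i j ij by (auto intro!: unimodularI[of _ i])
  have fu: "\<psi> (line ?u) = line ?u"
    using coord_map_plane[OF \<psi> i j ij one_closed] coord_map_0_1(2)[OF \<psi> j] by simp
  let ?v = "unit_vec 0 \<oplus>\<^bsub>M\<^esub> (x \<odot>\<^bsub>M\<^esub> unit_vec i \<oplus>\<^bsub>M\<^esub> (x \<oplus> y) \<odot>\<^bsub>M\<^esub> unit_vec j)"
  let ?v' = "unit_vec 0 \<oplus>\<^bsub>M\<^esub> (?x \<odot>\<^bsub>M\<^esub> unit_vec i \<oplus>\<^bsub>M\<^esub> ?z \<odot>\<^bsub>M\<^esub> unit_vec j)"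
  have vc: "?v \<in> carrier M" using x y by simp
  have v0: "?v 0 = \<one>" using d0 i j x y by simp
  have eq: "(\<lambda>k\<in>{..<d}. if k = 0 then \<one> else coord_map \<psi> k (?v k)) = ?v'"
    by (rule vec_eqI)
       (use i j ij x y x' z' d0 coord_map_0_1[OF \<psi>] coord_map(1)[OF \<psi>] in \<open>auto intro!: vec_closedI\<close>)
  have v: "unimodular ?v" "unimodular ?v'" "\<psi> (line ?v) = line ?v'"
    using fixes_frame_affine[OF \<psi> vc v0] unfolding eq by auto
  have n: "s \<odot>\<^bsub>M\<^esub> ?u \<notin> line (axis j y)"
    by (rule not_in_lineI[of i]) (use i j ij y in auto)
  have "?v = \<one> \<odot>\<^bsub>M\<^esub> axis j y \<oplus>\<^bsub>M\<^esub> x \<odot>\<^bsub>M\<^esub> ?u"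
    by (rule vec_eqI) (use x y i j ij d0 in \<open>auto simp: a_comm\<close>)
  then obtain a b where ab: "a \<in> carrier S" "b \<in> carrier S" "?v' = a \<odot>\<^bsub>M\<^esub> axis j ?y \<oplus>\<^bsub>M\<^esub> b \<odot>\<^bsub>M\<^esub> ?u"
    by (rule order_aut_collinear[OF \<phi> axis_unimodular[OF j y] uu v(1)
          axis_unimodular[OF j y'] uu v(2) coord_map(2)[OF \<psi> j y] fu v(3) n, of \<one> x, rotated 2])
       (use x in auto)
  have "?v' k = (a \<odot>\<^bsub>M\<^esub> axis j ?y \<oplus>\<^bsub>M\<^esub> b \<odot>\<^bsub>M\<^esub> ?u) k" for k
    using ab(3) by simp
  note at = this
  have "a = \<one>" using at[of 0] i j d0 y' z' x' ab(1,2) by simp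
  moreover have "?x = b" using at[of i] i j ij y' z' x' ab(1,2) by simp
  moreover have "?z = a \<otimes> ?y \<oplus> b" using at[of j] i j ij y' z' x' ab(1,2) by simp
  ultimately have "?z = ?x \<oplus> ?y" using x' y' by (simp add: a_comm)
  then show ?thesis using coord_map_indep[OF \<psi> i j] x y by simp
qed

text \<open>The coordinate map of the inverse supplies the preimages that make
  \<open>frame_ring_aut\<close> surjective.\<close>

lemma fixes_frame_inv:
  assumes \<psi>: "fixes_frame \<psi>"
  shows "fixes_frame (inv_into verts \<psi>)"
proof -
  have \<phi>: "order_aut \<psi>" using \<psi> by (auto simp: fixes_frame_def)
  have inv: "inv_into verts \<psi> V = V" if "V \<in> verts" "\<psi> V = V" for V
    using bij_betw_inv_into_left[OF order_aut_bij[OF \<phi>] that(1)] that(2) by simp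
  have "unimodular (unit_vec 0 \<oplus>\<^bsub>M\<^esub> unit_vec i)" if "0 < i" "i < d" for i
    using that d_ge_3 by (intro unimodularI[of _ 0]) auto
  then show ?thesis
    using \<psi> order_aut_inv[OF \<phi>] unfolding fixes_frame_def
    by (auto intro!: inv line_vertex unimodular_unit_vec)
qed

text \<open>Elements of \<open>ring_Aut\<close> are extensional, hence the restriction. Axis 1
  represents all axes by \<open>coord_map_indep\<close>.\<close>

definition frame_ring_aut :: "((nat \<Rightarrow> 'a) set \<Rightarrow> (nat \<Rightarrow> 'a) set) \<Rightarrow> 'a \<Rightarrow> 'a" where
  "frame_ring_aut \<psi> = restrict (coord_map \<psi> 1) (carrier S)"

lemma frame_ring_aut_in_ring_Aut:
  assumes \<psi>: "fixes_frame \<psi>"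
  shows "frame_ring_aut \<psi> \<in> carrier (ring_Aut S)"
proof -
  have \<phi>: "order_aut \<psi>" using \<psi> by (auto simp: fixes_frame_def)
  have d1: "0 < (1::nat)" "1 < d" and d2: "0 < (2::nat)" "2 < d" using d_ge_3 by auto
  note \<psi>' = fixes_frame_inv[OF \<psi>]
  let ?t = "coord_map \<psi> 1"
  have "bij_betw ?t (carrier S) (carrier S)"
  proof (rule bij_betw_imageI)
    show "inj_on ?t (carrier S)"
    proof (rule inj_onI)
      fix x y assume x: "x \<in> carrier S" and y: "y \<in> carrier S" and "?t x = ?t y"
      then have "\<psi> (line (axis 1 x)) = \<psi> (line (axis 1 y))" using coord_map(2)[OF \<psi> d1] by simp
      then have "line (axis 1 x) = line (axis 1 y)"
        using order_aut_eq_iff[OF \<phi> line_vertex[OF axis_unimodular[OF d1 x]] line_vertex[OF axis_unimodular[OF d1 y]]] by simp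
      then show "x = y" using axis_eqD[OF d1 x y] by simp
    qed
    show "?t ` carrier S = carrier S"
    proof (intro equalityI subsetI)
      fix x assume x: "x \<in> carrier S"
      let ?y = "coord_map (inv_into verts \<psi>) 1 x"
      note y = coord_map[OF \<psi>' d1 x]
      have "\<psi> (line (axis 1 ?y)) = line (axis 1 x)"
        using y(2)[symmetric] bij_betw_inv_into_right[OF order_aut_bij[OF \<phi>] line_vertex[OF axis_unimodular[OF d1 x]]] by simp
      then have "?t ?y = x" using coord_map_eqI[OF \<psi> d1 y(1) x] by simp
      then show "x \<in> ?t ` carrier S" using y(1) by (intro image_eqI[of _ _ ?y]) simp_all
    qed (use coord_map(1)[OF \<psi> d1] in auto)
  qed
  then have "bij_betw (frame_ring_aut \<psi>) (carrier S) (carrier S)"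
    unfolding frame_ring_aut_def by simp
  moreover have "frame_ring_aut \<psi> \<in> ring_hom S S"
  proof (rule ring_hom_memI)
    fix x y assume x: "x \<in> carrier S" and y: "y \<in> carrier S"
    show "frame_ring_aut \<psi> x \<in> carrier S" using coord_map(1)[OF \<psi> d1 x] x by (simp add: frame_ring_aut_def)
    \<comment> \<open>The product rule needs two different axes, so the left factor is read on axis
      2 and then moved to axis 1.\<close>
    show "frame_ring_aut \<psi> (x \<otimes> y) = frame_ring_aut \<psi> x \<otimes> frame_ring_aut \<psi> y"
      using coord_map_mult[OF \<psi> d2 d1 _ y x] coord_map_indep[OF \<psi> d2 d1 x] x y by (simp add: frame_ring_aut_def)
    show "frame_ring_aut \<psi> (x \<oplus> y) = frame_ring_aut \<psi> x \<oplus> frame_ring_aut \<psi> y"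
      using coord_map_add[OF \<psi> d1 x y] x y by (simp add: frame_ring_aut_def)
  qed (use coord_map_0_1[OF \<psi> d1] in \<open>simp add: frame_ring_aut_def\<close>)
  ultimately show ?thesis
    unfolding ring_Aut_def Bij_def by (simp add: frame_ring_aut_def)
qed

section \<open>Ring automorphisms and semilinear maps\<close>

lemma ring_Aut_iff:
  "\<tau> \<in> carrier (ring_Aut S) \<longleftrightarrow> \<tau> \<in> ring_hom S S \<and> bij_betw \<tau> (carrier S) (carrier S) \<and> \<tau> \<in> extensional (carrier S)"
  by (auto simp: ring_Aut_def Bij_def)

lemma ring_Aut_closed: "\<tau> \<in> carrier (ring_Aut S) \<Longrightarrow> x \<in> carrier S \<Longrightarrow> \<tau> x \<in> carrier S"
  by (auto simp: ring_Aut_iff ring_hom_def)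

lemma ring_Aut_add: "\<tau> \<in> carrier (ring_Aut S) \<Longrightarrow> x \<in> carrier S \<Longrightarrow> y \<in> carrier S \<Longrightarrow> \<tau> (x \<oplus> y) = \<tau> x \<oplus> \<tau> y"
  by (auto simp: ring_Aut_iff ring_hom_def)

lemma ring_Aut_mult: "\<tau> \<in> carrier (ring_Aut S) \<Longrightarrow> x \<in> carrier S \<Longrightarrow> y \<in> carrier S \<Longrightarrow> \<tau> (x \<otimes> y) = \<tau> x \<otimes> \<tau> y"
  by (auto simp: ring_Aut_iff ring_hom_def)

lemma ring_Aut_one: "\<tau> \<in> carrier (ring_Aut S) \<Longrightarrow> \<tau> \<one> = \<one>"
  by (auto simp: ring_Aut_iff ring_hom_def)

lemma ring_Aut_bij: "\<tau> \<in> carrier (ring_Aut S) \<Longrightarrow> bij_betw \<tau> (carrier S) (carrier S)"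
  by (auto simp: ring_Aut_iff)

lemma ring_Aut_zero:
  assumes "\<tau> \<in> carrier (ring_Aut S)" shows "\<tau> \<zero> = \<zero>"
proof -
  have "\<tau> \<zero> \<oplus> \<tau> \<zero> = \<zero> \<oplus> \<tau> \<zero>"
    using ring_Aut_add[OF assms zero_closed zero_closed, symmetric] ring_Aut_closed[OF assms zero_closed] by simp
  then show ?thesis using ring_Aut_closed[OF assms zero_closed] add.right_cancel by blast
qed

lemma ring_Aut_Units:
  assumes \<tau>: "\<tau> \<in> carrier (ring_Aut S)" and u: "u \<in> Units S" shows "\<tau> u \<in> Units S"
proof -
  have "\<tau> u \<otimes> \<tau> (inv u) = \<one>"
    using ring_Aut_mult[OF \<tau>, of u "inv u"] u Units_closed[OF u] ring_Aut_one[OF \<tau>] by simp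
  moreover have "\<tau> u \<in> carrier S" "\<tau> (inv u) \<in> carrier S"
    using ring_Aut_closed[OF \<tau>] u Units_closed[OF u] by auto
  ultimately show ?thesis unfolding Units_def using m_comm[of "\<tau> u" "\<tau> (inv u)"] by auto
qed

abbreviation "vmap \<equiv> vec_map d"

lemma vmap_nth [simp]: "i < d \<Longrightarrow> vmap \<tau> v i = \<tau> (v i)"
  by (simp add: vec_map_def)

lemma vmap_closed: "\<tau> \<in> carrier (ring_Aut S) \<Longrightarrow> v \<in> carrier M \<Longrightarrow> vmap \<tau> v \<in> carrier M"
  unfolding vec_map_def using ring_Aut_closed by (intro vec_closedI) auto

lemma semilinear_vmap:
  assumes \<tau>: "\<tau> \<in> carrier (ring_Aut S)"
  shows "semilinear \<tau> (vmap \<tau>)"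
  unfolding semilinear_def
proof (intro conjI ballI)
  have inv: "inv_into (carrier S) \<tau> x \<in> carrier S" "\<tau> (inv_into (carrier S) \<tau> x) = x" if "x \<in> carrier S" for x
    using that bij_betwE[OF bij_betw_inv_into[OF ring_Aut_bij[OF \<tau>]]] bij_betw_inv_into_right[OF ring_Aut_bij[OF \<tau>]] by auto
  have inv': "inv_into (carrier S) \<tau> (\<tau> x) = x" if "x \<in> carrier S" for x
    using that bij_betw_inv_into_left[OF ring_Aut_bij[OF \<tau>]] by auto
  show "bij_betw (vmap \<tau>) (carrier M) (carrier M)"
    by (rule bij_betw_byWitness[where f' = "vmap (inv_into (carrier S) \<tau>)"])
       (auto intro!: vec_eqI vec_closedI simp: vec_map_def inv inv' ring_Aut_closed[OF \<tau>])
  show "vmap \<tau> (v \<oplus>\<^bsub>M\<^esub> w) = vmap \<tau> v \<oplus>\<^bsub>M\<^esub> vmap \<tau> w" if "v \<in> carrier M" "w \<in> carrier M" for v w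
    using that by (intro vec_eqI) (auto simp: vmap_closed[OF \<tau>] ring_Aut_add[OF \<tau>])
  show "vmap \<tau> (c \<odot>\<^bsub>M\<^esub> v) = \<tau> c \<odot>\<^bsub>M\<^esub> vmap \<tau> v" if "c \<in> carrier S" "v \<in> carrier M" for c v
    using that by (intro vec_eqI) (auto simp: vmap_closed[OF \<tau>] ring_Aut_mult[OF \<tau>] ring_Aut_closed[OF \<tau>])
qed

lemma vmap_std_space:
  assumes \<tau>: "\<tau> \<in> carrier (ring_Aut S)"
  shows "vmap \<tau> ` std_space k = std_space k"
proof (intro equalityI subsetI)
  fix w assume "w \<in> vmap \<tau> ` std_space k"
  then show "w \<in> std_space k"
    using vmap_closed[OF \<tau>] ring_Aut_zero[OF \<tau>] by (auto simp: coord_space_def)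
next
  note f = semilinear_vmap[OF \<tau>]
  fix w assume w: "w \<in> std_space k"
  note wc = coord_space_closed[OF w]
  let ?v = "inv_on_vecs (vmap \<tau>) w"
  have v: "?v \<in> carrier M" "vmap \<tau> ?v = w" using inv_on_vecs_closed[OF f wc] inv_on_vecs_right[OF f wc] by auto
  have "?v i = \<zero>" if "i < d" "i \<notin> {..<k}" for i
  proof -
    have "\<tau> (?v i) = \<tau> \<zero>"
      using coord_space_nth[OF w that] v(2) that(1) ring_Aut_zero[OF \<tau>] vmap_nth by metis
    then show ?thesis
      using ring_Aut_bij[OF \<tau>] v(1) that(1) unfolding bij_betw_def inj_on_def by auto
  qed
  then have "?v \<in> std_space k" using v(1) by (auto simp: coord_space_def)
  then show "w \<in> vmap \<tau> ` std_space k" using v(2) by (intro image_eqI[of _ _ ?v]) simp_all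
qed

text \<open>\<open>vmap \<tau>\<close> preserves coordinate subspaces, so its inverse can be
  inserted between \<open>std_space k\<close> and the map \<open>f \<circ> g\<close> without
  changing the image. The scalar twists cancel and the composite is linear.\<close>

lemma semilinear_subspace:
  assumes \<tau>: "\<tau> \<in> carrier (ring_Aut S)" and f: "semilinear \<tau> f" and V: "subspace k V"
  shows "subspace k (f ` V)"
proof -
  obtain g where g: "k \<le> d" "lin_aut g" "V = g ` std_space k" using V by (auto simp: subspace_def)
  let ?\<rho> = "inv_into (carrier S) \<tau>"
  have \<rho>: "?\<rho> x \<in> carrier S \<and> \<tau> (?\<rho> x) = x" if "x \<in> carrier S" for x
    using that bij_betwE[OF bij_betw_inv_into[OF ring_Aut_bij[OF \<tau>]]] bij_betw_inv_into_right[OF ring_Aut_bij[OF \<tau>]] by auto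
  let ?t = "inv_on_vecs (vmap \<tau>)"
  have t: "semilinear ?\<rho> ?t" by (rule semilinear_inv[OF semilinear_vmap[OF \<tau>] \<rho>])
  have gt: "semilinear ?\<rho> (g \<circ> ?t)"
    by (rule semilinear_comp[OF g(2) t]) (use \<rho> in auto)
  have h: "lin_aut (f \<circ> (g \<circ> ?t))"
    by (rule semilinear_cong[OF semilinear_comp[OF f gt]]) (use \<rho> in auto)
  have tE: "?t ` std_space k = std_space k"
  proof -
    have "?t ` (vmap \<tau> ` std_space k) = std_space k"
      unfolding image_image
      using inv_on_vecs_left[OF semilinear_vmap[OF \<tau>]] coord_space_closed by simp
    then show ?thesis by (simp add: vmap_std_space[OF \<tau>])
  qed
  have "(f \<circ> (g \<circ> ?t)) ` std_space k = f ` (g ` (?t ` std_space k))" by (simp add: image_comp comp_assoc)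
  then have "f ` V = (f \<circ> (g \<circ> ?t)) ` std_space k" using g(3) tE by simp
  then show ?thesis using subspace_image[OF h g(1)] by simp
qed

text \<open>\<tau> may move \<open>s\<close>, so unimodularity is not transported by simply applying
  \<open>f\<close> to \<open>s\<close> v. Instead, the image of the line is free of rank 1 and has a
  unimodular generator, which is a multiple of \<open>f v\<close>.\<close>

lemma semilinear_unimodular:
  assumes \<tau>: "\<tau> \<in> carrier (ring_Aut S)" and f: "semilinear \<tau> f" and v: "unimodular v"
  shows "unimodular (f v)" "f ` line v = line (f v)"
proof -
  note vc = unimodular_closed[OF v]
  show eq: "f ` line v = line (f v)"
  proof (intro equalityI subsetI)
    fix w assume "w \<in> f ` line v"
    then show "w \<in> line (f v)"
      using semilinear_smult[OF f _ vc] ring_Aut_closed[OF \<tau>] by (auto simp: line_def)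
  next
    fix w assume "w \<in> line (f v)"
    then obtain c where c: "c \<in> carrier S" "w = c \<odot>\<^bsub>M\<^esub> f v" by (auto simp: line_def)
    obtain b where b: "b \<in> carrier S" "\<tau> b = c"
      using c(1) ring_Aut_bij[OF \<tau>] unfolding bij_betw_def by (metis imageE)
    then have "w = f (b \<odot>\<^bsub>M\<^esub> v)" using semilinear_smult[OF f b(1) vc] c by simp
    then show "w \<in> f ` line v" using line_smult_mem[OF b(1), of v] by simp
  qed
  have "subspace 1 (line (f v))" using semilinear_subspace[OF \<tau> f line_subspace[OF v]] eq by simp
  then obtain u where u: "unimodular u" "line (f v) = line u" by (rule subspace_1_line)
  have "u \<in> line (f v)" using u line_self unimodular_closed by simp
  then obtain c where c: "c \<in> carrier S" "u = c \<odot>\<^bsub>M\<^esub> f v" by (auto simp: line_def)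
  note fc = semilinear_closed[OF f vc]
  show "unimodular (f v)"
  proof (rule ccontr)
    assume "\<not> unimodular (f v)"
    then have z: "s \<odot>\<^bsub>M\<^esub> f v = \<zero>\<^bsub>M\<^esub>" using fc by (simp add: unimodular_def)
    have "s \<odot>\<^bsub>M\<^esub> u = c \<odot>\<^bsub>M\<^esub> (s \<odot>\<^bsub>M\<^esub> f v)"
      using c fc by (simp add: vec.smult_assoc1[symmetric] m_comm)
    then show False using z c(1) u(1) by (simp add: unimodular_def)
  qed
qed

text \<open>A unit first coordinate is scaled to 1, where \<open>fixes_frame_affine\<close> applies.
  If the first coordinate is a non-unit, the point is located on two joins, each passing through one
  of the fixed points e_0 and e_0 + e_j.\<close>

lemma fixes_frame_line:
  assumes \<psi>: "fixes_frame \<psi>" and v: "unimodular v"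
  defines "\<tau> \<equiv> frame_ring_aut \<psi>"
  shows "\<psi> (line v) = line (vmap \<tau> v)"
proof -
  have \<phi>: "order_aut \<psi>" and fix_e: "\<And>j. j < d \<Longrightarrow> \<psi> (line (unit_vec j)) = line (unit_vec j)"
    and fix_e0: "\<And>j. 0 < j \<Longrightarrow> j < d \<Longrightarrow> \<psi> (line (unit_vec 0 \<oplus>\<^bsub>M\<^esub> unit_vec j)) = line (unit_vec 0 \<oplus>\<^bsub>M\<^esub> unit_vec j)"
    using \<psi> by (auto simp: fixes_frame_def)
  have d0: "0 < d" "1 < d" using d_ge_3 by auto
  have \<tau>: "\<tau> \<in> carrier (ring_Aut S)" unfolding \<tau>_def by (rule frame_ring_aut_in_ring_Aut[OF \<psi>])
  note f = semilinear_vmap[OF \<tau>]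
  have cm: "coord_map \<psi> i x = \<tau> x" if "0 < i" "i < d" "x \<in> carrier S" for i x
    using coord_map_indep[OF \<psi> that(1,2) _ d0(2) that(3)] that(3) by (simp add: \<tau>_def frame_ring_aut_def)
  have affine: "\<psi> (line v) = line (vmap \<tau> v)" if v: "v \<in> carrier M" "v 0 = \<one>" for v
  proof -
    have "(\<lambda>i\<in>{..<d}. if i = 0 then \<one> else coord_map \<psi> i (v i)) = vmap \<tau> v"
      unfolding vec_map_def using v cm ring_Aut_one[OF \<tau>] by (intro restrict_ext) auto
    then show ?thesis using fixes_frame_affine(3)[OF \<psi> v] by simp
  qed
  have unit0: "\<psi> (line v) = line (vmap \<tau> v)" if v: "v \<in> carrier M" "v 0 \<in> Units S" for v
  proof -
    let ?u = "inv (v 0) \<odot>\<^bsub>M\<^esub> v"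
    have vu: "unimodular v" using v d0 by (intro unimodularI[of _ 0])
    have uc: "?u \<in> carrier M" "?u 0 = \<one>" using v d0 by auto
    have uu: "unimodular ?u" using unimodular_smult[OF vu] v(2) by simp
    have "vmap \<tau> ?u = \<tau> (inv (v 0)) \<odot>\<^bsub>M\<^esub> vmap \<tau> v" using semilinear_smult[OF f _ v(1)] v(2) by simp
    then have "line (vmap \<tau> ?u) = line (vmap \<tau> v)"
      using line_smult[OF semilinear_unimodular(1)[OF \<tau> f vu]] ring_Aut_Units[OF \<tau>, of "inv (v 0)"] v(2) by simp
    then show ?thesis using affine[OF uc] line_smult[OF vu, of "inv (v 0)"] v(2) by simp
  qed
  show ?thesis
  proof (cases "v 0 \<in> Units S")
    case True
    then show ?thesis using unit0 unimodular_closed[OF v] by simp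
  next
    case False
    note vc = unimodular_closed[OF v]
    obtain i where i: "i < d" "v i \<in> Units S" using v by (auto simp: unimodular_iff)
    have i0: "0 < i" using i False by (cases "i = 0") auto
    obtain j where j: "0 < j" "j < d" and ij: "i \<noteq> j"
      using d_ge_3 that[of 1] that[of 2] by (cases "i = 1") auto
    have v0c: "v 0 \<in> carrier S" using vc d0 by auto
    \<comment> \<open>One plus a non-unit is a unit, since \<open>s\<close> kills the second
      summand. Adding a vector with first coordinate 1 to \<open>v\<close> therefore leads back to
      the case already settled.\<close>
    have "s \<otimes> (\<one> \<oplus> v 0) \<noteq> \<zero>"
      using Unit_or_annihilates_socle[OF v0c] False v0c socle_nonzero by (simp add: r_distr)
    then have u1: "\<one> \<oplus> v 0 \<in> Units S" using Unit_iff[of "\<one> \<oplus> v 0"] v0c by simp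
    let ?f = "vmap \<tau>"
    have fe: "?f (unit_vec k) = unit_vec k" if "k < d" for k
      using vmap_closed[OF \<tau>] ring_Aut_one[OF \<tau>] ring_Aut_zero[OF \<tau>] by (intro vec_eqI) auto
    have fv: "?f v \<in> carrier M" using vmap_closed[OF \<tau> vc] .
    have fvi: "\<tau> (v i) \<in> Units S" using ring_Aut_Units[OF \<tau> i(2)] .
    obtain w where w: "unimodular w" "\<psi> (line v) = line w" by (rule order_aut_line[OF \<phi> v])
    \<comment> \<open>\<open>v\<close> lies on the join of the fixed point e and the point e + v,
      whose image is already known. The condition \<open>e i = \<zero>\<close> at the pivot
      \<open>i\<close> of \<open>v\<close> keeps these two generators independent.\<close>
    have key: "\<exists>a\<in>carrier S. \<exists>b\<in>carrier S. w = a \<odot>\<^bsub>M\<^esub> e \<oplus>\<^bsub>M\<^esub> b \<odot>\<^bsub>M\<^esub> ?f v"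
      if e: "unimodular e" "\<psi> (line e) = line e" "?f e = e" "e 0 = \<one>" "e i = \<zero>" for e
    proof -
      note ec = unimodular_closed[OF e(1)]
      let ?v = "e \<oplus>\<^bsub>M\<^esub> v"
      have vv: "?v \<in> carrier M" "?v 0 \<in> Units S" using ec vc d0 e(4) u1 by auto
      have vu: "unimodular ?v" using vv d0 by (intro unimodularI[of _ 0])
      have fvv: "?f ?v = e \<oplus>\<^bsub>M\<^esub> ?f v" using semilinear_add[OF f ec vc] e(3) by simp
      have n: "s \<odot>\<^bsub>M\<^esub> ?v \<notin> line e"
        by (rule not_in_lineI[of i]) (use i e(5) vc in auto)
      have "v = \<ominus> \<one> \<odot>\<^bsub>M\<^esub> e \<oplus>\<^bsub>M\<^esub> \<one> \<odot>\<^bsub>M\<^esub> ?v"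
      proof (rule vec_eqI[OF vc])
        fix k assume k: "k < d"
        have "e k \<in> carrier S" "v k \<in> carrier S" using k ec vc by auto
        then have "v k = \<ominus> \<one> \<otimes> e k \<oplus> \<one> \<otimes> (e k \<oplus> v k)" by algebra
        then show "v k = (\<ominus> \<one> \<odot>\<^bsub>M\<^esub> e \<oplus>\<^bsub>M\<^esub> \<one> \<odot>\<^bsub>M\<^esub> ?v) k" using k by simp
      qed (use ec vc in auto)
      then obtain a b where ab: "a \<in> carrier S" "b \<in> carrier S" "w = a \<odot>\<^bsub>M\<^esub> e \<oplus>\<^bsub>M\<^esub> b \<odot>\<^bsub>M\<^esub> ?f ?v"
        by (rule order_aut_collinear[OF \<phi> e(1) vu v e(1) semilinear_unimodular(1)[OF \<tau> f vu] w(1) e(2) unit0[OF vv] w(2) n,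
              of "\<ominus> \<one>" \<one>, rotated 2]) auto
      then have "w = (a \<oplus> b) \<odot>\<^bsub>M\<^esub> e \<oplus>\<^bsub>M\<^esub> b \<odot>\<^bsub>M\<^esub> ?f v"
        unfolding fvv using ec fv by (simp add: vec.smult_r_distr vec.smult_l_distr vec.M.a_assoc)
      then show ?thesis using ab(1,2) by (intro bexI[of _ "a \<oplus> b"] bexI[of _ b]) auto
    qed
    obtain a b where ab: "a \<in> carrier S" "b \<in> carrier S" "w = a \<odot>\<^bsub>M\<^esub> unit_vec 0 \<oplus>\<^bsub>M\<^esub> b \<odot>\<^bsub>M\<^esub> ?f v"
      using key[OF unimodular_unit_vec[OF d0(1)] fix_e[OF d0(1)] fe[OF d0(1)]] i i0 d0 by auto
    let ?e = "unit_vec 0 \<oplus>\<^bsub>M\<^esub> unit_vec j"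
    have eu: "unimodular ?e" using j d0 by (intro unimodularI[of _ 0]) auto
    have "?f ?e = ?e" using semilinear_add[OF f] fe d0 j by simp
    then obtain a' b' where ab': "a' \<in> carrier S" "b' \<in> carrier S" "w = a' \<odot>\<^bsub>M\<^esub> ?e \<oplus>\<^bsub>M\<^esub> b' \<odot>\<^bsub>M\<^esub> ?f v"
      using key[OF eu fix_e0[OF j]] i i0 d0 j ij by auto
    have tc: "\<tau> (v k) \<in> carrier S" if "k < d" for k using ring_Aut_closed[OF \<tau>] vc that by auto
    \<comment> \<open>Two expansions of the same vector: coordinate \<open>i\<close> identifies the
      coefficients at the image of \<open>v\<close>, and coordinate \<open>j\<close> then shows that
      the coefficient of e_0 + e_j vanishes.\<close>
    have "w i = b \<otimes> \<tau> (v i)" using ab i i0 tc[OF i(1)] by simp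
    moreover have "w i = b' \<otimes> \<tau> (v i)" using ab' i i0 j ij tc[OF i(1)] by simp
    ultimately have "b \<otimes> \<tau> (v i) \<otimes> inv (\<tau> (v i)) = b' \<otimes> \<tau> (v i) \<otimes> inv (\<tau> (v i))" by simp
    then have bb: "b = b'" using ab ab' fvi tc[OF i(1)] by (simp add: m_assoc)
    have "w j = b \<otimes> \<tau> (v j)" using ab j tc[OF j(2)] by simp
    moreover have "w j = a' \<oplus> b \<otimes> \<tau> (v j)" using ab' j tc[OF j(2)] bb by simp
    ultimately have "\<zero> \<oplus> b \<otimes> \<tau> (v j) = a' \<oplus> b \<otimes> \<tau> (v j)" using ab tc[OF j(2)] by simp
    then have "a' = \<zero>" using ab ab' tc[OF j(2)] add.right_cancel by (metis m_closed zero_closed)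
    then have "w = b \<odot>\<^bsub>M\<^esub> ?f v" using ab'(3) bb ab(2) fv eu unimodular_closed by simp
    then have "w \<in> line (?f v)" using line_smult_mem[OF ab(2)] by simp
    then show ?thesis
      using line_unimodular_eq[OF semilinear_unimodular(1)[OF \<tau> f v] _ w(1)] w(2) by simp
  qed
qed

text \<open>A vertex is generated by its unimodular vectors, and the two maps agree on points. This
  gives one inclusion; the ranks turn it into an equality.\<close>

lemma fixes_frame_eq_vmap:
  assumes \<psi>: "fixes_frame \<psi>" and V: "V \<in> verts"
  shows "\<psi> V = vmap (frame_ring_aut \<psi>) ` V"
proof -
  let ?\<tau> = "frame_ring_aut \<psi>"
  have \<phi>: "order_aut \<psi>" using \<psi> by (auto simp: fixes_frame_def)
  note \<tau> = frame_ring_aut_in_ring_Aut[OF \<psi>]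
  note f = semilinear_vmap[OF \<tau>]
  note fV = semilinear_subspace[OF \<tau> f vertex_subspace[OF V]]
  note \<psi>V = vertex_subspace[OF order_aut_closed[OF \<phi> V]]
  have "vmap ?\<tau> ` V \<subseteq> \<psi> V"
  proof (rule subspace_subset_unimodularI[OF fV \<psi>V])
    fix w assume w: "unimodular w" "w \<in> vmap ?\<tau> ` V"
    then obtain v where v: "v \<in> V" "w = vmap ?\<tau> v" by blast
    note vc = subspace_closed[OF vertex_subspace[OF V] v(1)]
    \<comment> \<open>Otherwise \<open>s\<close> kills all coordinates of \<open>v\<close>. Applying
      \<tau> at a unit coordinate of \<open>w\<close> would give that \<open>\<tau> s\<close> is
      zero, against injectivity of \<tau>.\<close>
    have vu: "unimodular v"
    proof (rule ccontr)
      assume "\<not> unimodular v"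
      then have z: "s \<otimes> v i = \<zero>" if "i < d" for i
        using that vc Unit_or_annihilates_socle[of "v i"] by (auto simp: unimodular_iff)
      obtain i where i: "i < d" "w i \<in> Units S" using w(1) by (auto simp: unimodular_iff)
      have vi: "v i \<in> carrier S" using vc i by auto
      have "?\<tau> s \<otimes> w i = ?\<tau> \<zero>" using z[OF i(1)] i v(2) ring_Aut_mult[OF \<tau> socle_closed vi] by simp
      then have "?\<tau> s \<otimes> w i \<otimes> inv (w i) = \<zero>" using i(2) ring_Aut_zero[OF \<tau>] by simp
      then have "?\<tau> s = ?\<tau> \<zero>" using i(2) Units_closed[OF i(2)] ring_Aut_closed[OF \<tau> socle_closed] ring_Aut_zero[OF \<tau>] by (simp add: m_assoc)
      then show False
        using ring_Aut_bij[OF \<tau>] socle_nonzero unfolding bij_betw_def inj_on_def by blast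
    qed
    have "line v \<subseteq> V" using line_subset_iff[OF vertex_subspace[OF V] vc] v(1) by simp
    then have "line w \<subseteq> \<psi> V"
      using order_aut_subset_iff[OF \<phi> line_vertex[OF vu] V] fixes_frame_line[OF \<psi> vu] v(2) by simp
    then show "w \<in> \<psi> V" using line_self[OF unimodular_closed[OF w(1)]] by blast
  qed
  then show ?thesis using subspace_nested_eq[OF fV \<psi>V] rk_order_aut[OF \<phi> V] by simp
qed


section \<open>Orthogonal complements\<close>

abbreviation "form \<equiv> std_form S d"

lemma form_closed [simp]: "v \<in> carrier M \<Longrightarrow> w \<in> carrier M \<Longrightarrow> form v w \<in> carrier S"
  unfolding std_form_def by (intro finsum_closed) auto

lemma form_commute: "v \<in> carrier M \<Longrightarrow> w \<in> carrier M \<Longrightarrow> form v w = form w v"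
  unfolding std_form_def by (intro finsum_cong') (auto simp: m_comm)

lemma form_add_left:
  assumes "v \<in> carrier M" "v' \<in> carrier M" "w \<in> carrier M"
  shows "form (v \<oplus>\<^bsub>M\<^esub> v') w = form v w \<oplus> form v' w"
proof -
  have "form (v \<oplus>\<^bsub>M\<^esub> v') w = (\<Oplus>i\<in>{..<d}. v i \<otimes> w i \<oplus> v' i \<otimes> w i)"
    unfolding std_form_def by (intro finsum_cong') (use assms in \<open>auto simp: l_distr\<close>)
  also have "\<dots> = form v w \<oplus> form v' w"
    unfolding std_form_def by (intro finsum_addf) (use assms in auto)
  finally show ?thesis .
qed

lemma form_smult_left:
  assumes "c \<in> carrier S" "v \<in> carrier M" "w \<in> carrier M"
  shows "form (c \<odot>\<^bsub>M\<^esub> v) w = c \<otimes> form v w"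
proof -
  have "c \<otimes> form v w = (\<Oplus>i\<in>{..<d}. c \<otimes> (v i \<otimes> w i))"
    unfolding std_form_def by (intro finsum_rdistr) (use assms in auto)
  also have "\<dots> = form (c \<odot>\<^bsub>M\<^esub> v) w"
    unfolding std_form_def by (intro finsum_cong') (use assms in \<open>auto simp: m_assoc\<close>)
  finally show ?thesis by simp
qed

lemma form_add_right:
  "v \<in> carrier M \<Longrightarrow> w \<in> carrier M \<Longrightarrow> w' \<in> carrier M \<Longrightarrow> form v (w \<oplus>\<^bsub>M\<^esub> w') = form v w \<oplus> form v w'"
  using form_add_left[of w w' v] form_commute[of v] by simp

lemma form_smult_right:
  "c \<in> carrier S \<Longrightarrow> v \<in> carrier M \<Longrightarrow> w \<in> carrier M \<Longrightarrow> form v (c \<odot>\<^bsub>M\<^esub> w) = c \<otimes> form v w"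
  using form_smult_left[of c w v] form_commute[of v] by simp

lemma form_unit_vec:
  assumes "i < d" "w \<in> carrier M" shows "form (unit_vec i) w = w i"
proof -
  have "form (unit_vec i) w = (\<Oplus>j\<in>{..<d}. if i = j then w j else \<zero>)"
    unfolding std_form_def by (intro finsum_cong') (use assms in auto)
  also have "\<dots> = w i" by (rule add.finprod_singleton) (use assms in auto)
  finally show ?thesis .
qed

lemma form_zero_left:
  assumes "w \<in> carrier M" shows "form \<zero>\<^bsub>M\<^esub> w = \<zero>"
proof -
  have "form (\<zero> \<odot>\<^bsub>M\<^esub> w) w = \<zero> \<otimes> form w w" by (rule form_smult_left) (use assms in auto)
  then show ?thesis using assms by simp
qed

lemma form_finsum_left:
  assumes "finite I" "f \<in> I \<rightarrow> carrier M" "w \<in> carrier M"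
  shows "form (\<Oplus>\<^bsub>M\<^esub>i\<in>I. f i) w = (\<Oplus>i\<in>I. form (f i) w)"
  using assms(1,2)
proof (induction I)
  case (insert a F)
  then have f: "f \<in> F \<rightarrow> carrier M" "f a \<in> carrier M" by auto
  then have "(\<lambda>i. form (f i) w) \<in> F \<rightarrow> carrier S" using assms(3) by (auto simp: Pi_iff)
  then show ?case using insert f assms(3) by (simp add: form_add_left)
qed (simp add: form_zero_left assms(3))

lemma form_expand_left:
  assumes "lin_aut g" "v \<in> carrier M" "w \<in> carrier M"
  shows "form (g v) w = (\<Oplus>i\<in>{..<d}. v i \<otimes> form (g (unit_vec i)) w)"
proof -
  have "linear_on (std_space d) g" using lin_aut_linear_on[OF assms(1)] by (simp add: std_space_full)
  then have "g v = (\<Oplus>\<^bsub>M\<^esub>i\<in>{..<d}. v i \<odot>\<^bsub>M\<^esub> g (unit_vec i))"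
    using linear_on_expand[of d g v] assms(2) by (simp add: std_space_full)
  then have "form (g v) w = (\<Oplus>i\<in>{..<d}. form (v i \<odot>\<^bsub>M\<^esub> g (unit_vec i)) w)"
    using form_finsum_left[of "{..<d}" "\<lambda>i. v i \<odot>\<^bsub>M\<^esub> g (unit_vec i)" w] assms semilinear_closed[OF assms(1)]
    by (simp add: Pi_iff)
  also have "\<dots> = (\<Oplus>i\<in>{..<d}. v i \<otimes> form (g (unit_vec i)) w)"
    by (intro finsum_cong') (use assms semilinear_closed[OF assms(1)] in \<open>auto simp: form_smult_left\<close>)
  finally show ?thesis .
qed

text \<open>The transpose with respect to the standard form (\<open>form_adjoint\<close>), written
  without matrices: its coordinates are the products with the columns of \<open>g\<close>.\<close>

definition adjoint :: "((nat \<Rightarrow> 'a) \<Rightarrow> nat \<Rightarrow> 'a) \<Rightarrow> (nat \<Rightarrow> 'a) \<Rightarrow> nat \<Rightarrow> 'a" where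
  "adjoint g w = (\<lambda>i\<in>{..<d}. form (g (unit_vec i)) w)"

lemma adjoint_closed: "lin_aut g \<Longrightarrow> w \<in> carrier M \<Longrightarrow> adjoint g w \<in> carrier M"
  unfolding adjoint_def by (rule vec_closedI) (simp add: semilinear_closed)

lemma form_adjoint:
  assumes "lin_aut g" "v \<in> carrier M" "w \<in> carrier M"
  shows "form (g v) w = form v (adjoint g w)"
  unfolding form_expand_left[OF assms] unfolding std_form_def[of S d v]
  by (intro finsum_cong') (use assms semilinear_closed[OF assms(1)] in \<open>auto simp: adjoint_def\<close>)

lemma form_eqI:
  assumes "v \<in> carrier M" "w \<in> carrier M" "\<And>u. u \<in> carrier M \<Longrightarrow> form u v = form u w"
  shows "v = w"
  by (rule vec_eqI[OF assms(1,2)]) (metis assms form_unit_vec unit_vec_closed)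

lemma adjoint_inverse:
  assumes g: "lin_aut g" and h: "lin_aut h" and hg: "\<And>v. v \<in> carrier M \<Longrightarrow> h (g v) = v" and w: "w \<in> carrier M"
  shows "adjoint g (adjoint h w) = w"
proof (rule form_eqI)
  fix u assume u: "u \<in> carrier M"
  have "form u (adjoint g (adjoint h w)) = form (g u) (adjoint h w)"
    using form_adjoint[OF g u adjoint_closed[OF h w]] by simp
  also have "\<dots> = form (h (g u)) w" using form_adjoint[OF h _ w] semilinear_closed[OF g u] by simp
  finally show "form u (adjoint g (adjoint h w)) = form u w" using hg[OF u] by simp
qed (use adjoint_closed[OF g] adjoint_closed[OF h] w in auto)

lemma lin_aut_adjoint:
  assumes g: "lin_aut g" shows "lin_aut (adjoint g)"
proof (rule lin_autI[where g = "adjoint (inv_on_vecs g)"])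
  note g' = lin_aut_inv[OF g]
  note gc = semilinear_closed[OF g]
  show "adjoint (inv_on_vecs g) (adjoint g v) = v" if "v \<in> carrier M" for v
    by (rule adjoint_inverse[OF g' g _ that]) (simp add: inv_on_vecs_right[OF g])
  show "adjoint g (adjoint (inv_on_vecs g) v) = v" if "v \<in> carrier M" for v
    by (rule adjoint_inverse[OF g g' _ that]) (simp add: inv_on_vecs_left[OF g])
  show "adjoint (inv_on_vecs g) v \<in> carrier M" if "v \<in> carrier M" for v by (rule adjoint_closed[OF g' that])
  show "adjoint g (v \<oplus>\<^bsub>M\<^esub> w) = adjoint g v \<oplus>\<^bsub>M\<^esub> adjoint g w" if "v \<in> carrier M" "w \<in> carrier M" for v w
    by (rule vec_eqI[OF adjoint_closed[OF g] vec.M.a_closed[OF adjoint_closed[OF g] adjoint_closed[OF g]]])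
       (use that in \<open>simp_all add: adjoint_def form_add_right gc\<close>)
  show "adjoint g (c \<odot>\<^bsub>M\<^esub> v) = c \<odot>\<^bsub>M\<^esub> adjoint g v" if "c \<in> carrier S" "v \<in> carrier M" for c v
    by (rule vec_eqI[OF adjoint_closed[OF g] vec.smult_closed[OF _ adjoint_closed[OF g]]])
       (use that in \<open>simp_all add: adjoint_def form_smult_right gc\<close>)
qed (rule adjoint_closed[OF g])

definition perp :: "(nat \<Rightarrow> 'a) set \<Rightarrow> (nat \<Rightarrow> 'a) set" where
  "perp V = {w \<in> carrier M. \<forall>v\<in>V. form v w = \<zero>}"

lemma perp_std_space: "k \<le> d \<Longrightarrow> perp (std_space k) = coord_space {k..<d}"
proof (intro equalityI subsetI)
  assume k: "k \<le> d"
  fix w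
  {
    assume w: "w \<in> perp (std_space k)"
    then have wc: "w \<in> carrier M" by (simp add: perp_def)
    have "w i = \<zero>" if "i < d" "i \<notin> {k..<d}" for i
    proof -
      have "unit_vec i \<in> std_space k" using that by (intro unit_vec_in_coord_space) auto
      then have "form (unit_vec i) w = \<zero>" using w by (simp add: perp_def)
      then show ?thesis using form_unit_vec[OF that(1) wc] by simp
    qed
    then show "w \<in> coord_space {k..<d}" using wc by (auto simp: coord_space_def)
  next
    assume w: "w \<in> coord_space {k..<d}"
    note wc = coord_space_closed[OF w]
    have "form v w = \<zero>" if v: "v \<in> std_space k" for v
    proof -
      have "v i \<otimes> w i = \<zero>" if i: "i < d" for i
      proof (cases "i < k")
        case True
        then have "w i = \<zero>" using coord_space_nth[OF w i] by simp
        then show ?thesis using coord_space_closed[OF v] i by simp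
      next
        case False
        then have "v i = \<zero>" using coord_space_nth[OF v i] by simp
        then show ?thesis using wc i by simp
      qed
      then have "form v w = (\<Oplus>i\<in>{..<d}. \<zero>)" unfolding std_form_def by (intro finsum_cong') auto
      then show ?thesis by simp
    qed
    then show "w \<in> perp (std_space k)" using wc by (simp add: perp_def)
  }
qed

text \<open>Moving \<open>g\<close> across the form shows that a vector is orthogonal to the image
  of \<open>V\<close> exactly when its adjoint image is orthogonal to \<open>V\<close>. Complements
  of free submodules are seen to be free in this way.\<close>

lemma perp_image:
  assumes g: "lin_aut g" and V: "V \<subseteq> carrier M"
  shows "perp (g ` V) = inv_on_vecs (adjoint g) ` perp V"
proof (intro equalityI subsetI)
  note a = lin_aut_adjoint[OF g]
  fix w
  {
    assume "w \<in> perp (g ` V)"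
    then have wc: "w \<in> carrier M" and w: "\<And>v. v \<in> V \<Longrightarrow> form (g v) w = \<zero>" by (auto simp: perp_def)
    have "form v (adjoint g w) = \<zero>" if "v \<in> V" for v
      using w[OF that] form_adjoint[OF g _ wc, of v] V that by auto
    then have "adjoint g w \<in> perp V" using adjoint_closed[OF g wc] by (simp add: perp_def)
    then show "w \<in> inv_on_vecs (adjoint g) ` perp V"
      using inv_on_vecs_left[OF a wc] by (intro image_eqI[of _ _ "adjoint g w"]) simp_all
  next
    assume "w \<in> inv_on_vecs (adjoint g) ` perp V"
    then obtain u where u: "u \<in> perp V" "w = inv_on_vecs (adjoint g) u" by blast
    then have uc: "u \<in> carrier M" by (simp add: perp_def)
    have wc: "w \<in> carrier M" "adjoint g w = u" using u(2) inv_on_vecs_closed[OF a uc] inv_on_vecs_right[OF a uc] by auto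
    then show "w \<in> perp (g ` V)"
      using u(1) form_adjoint[OF g _ wc(1)] V by (auto simp: perp_def)
  }
qed

lemma perp_subspace:
  assumes "subspace k V" shows "subspace (d - k) (perp V)"
proof -
  obtain g where g: "k \<le> d" "lin_aut g" "V = g ` std_space k" using assms by (auto simp: subspace_def)
  have "subspace (card {k..<d}) (coord_space {k..<d})" by (rule subspace_coord_space) auto
  then have "subspace (d - k) (coord_space {k..<d})" by simp
  then obtain h where h: "lin_aut h" "coord_space {k..<d} = h ` std_space (d - k)" by (auto simp: subspace_def)
  have "std_space k \<subseteq> carrier M" using coord_space_closed by blast
  then have "perp V = (inv_on_vecs (adjoint g) \<circ> h) ` std_space (d - k)"
    unfolding g(3) by (simp add: perp_image[OF g(2)] perp_std_space[OF g(1)] h(2) image_comp)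
  then show ?thesis
    using subspace_image[OF lin_aut_comp[OF lin_aut_inv[OF lin_aut_adjoint[OF g(2)]] h(1)], of "d - k"] by simp
qed

lemma perp_antimono: "V \<subseteq> W \<Longrightarrow> perp W \<subseteq> perp V"
  by (auto simp: perp_def)

lemma perp_vertex: "V \<in> verts \<Longrightarrow> perp V \<in> verts" and rk_perp: "V \<in> verts \<Longrightarrow> rk (perp V) = d - rk V"
proof -
  assume V: "V \<in> verts"
  note p = perp_subspace[OF vertex_subspace[OF V]]
  show "perp V \<in> verts" using vertexI[OF p] rk_pos[OF V] rk_less[OF V] by simp
  show "rk (perp V) = d - rk V" using rk_eq[OF p] .
qed

text \<open>One inclusion is the symmetry of the form; the rank d - (d - k) = k gives the
  other.\<close>

lemma perp_perp: assumes V: "V \<in> verts" shows "perp (perp V) = V"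
proof -
  have "V \<subseteq> perp (perp V)"
    using form_commute subspace_closed[OF vertex_subspace[OF V]] by (auto simp: perp_def)
  then show ?thesis
    using vertex_eqI[OF V perp_vertex[OF perp_vertex[OF V]]] rk_perp[OF perp_vertex[OF V]] rk_perp[OF V] rk_less[OF V] by simp
qed

lemma perp_subset_iff:
  assumes "V \<in> verts" "W \<in> verts" shows "perp V \<subseteq> perp W \<longleftrightarrow> W \<subseteq> V"
  using perp_antimono[of W V] perp_antimono[of "perp V" "perp W"] perp_perp assms by auto

lemma perp_bij: "bij_betw perp verts verts"
  by (rule bij_betw_byWitness[where f' = perp]) (auto simp: perp_perp perp_vertex)


section \<open>Automorphisms preserve or reverse inclusion\<close>

definition comparable :: "(nat \<Rightarrow> 'a) set \<Rightarrow> (nat \<Rightarrow> 'a) set \<Rightarrow> bool" where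
  "comparable V W \<longleftrightarrow> V \<subseteq> W \<or> W \<subseteq> V"

text \<open>Flags are the cliques of the comparability graph, so simplicial automorphisms are its
  graph automorphisms (\<open>flags_iff\<close>). Unlike \<open>order_aut\<close>, this notion
  includes maps that reverse inclusion.\<close>

definition comparability_aut :: "((nat \<Rightarrow> 'a) set \<Rightarrow> (nat \<Rightarrow> 'a) set) \<Rightarrow> bool" where
  "comparability_aut \<phi> \<longleftrightarrow> bij_betw \<phi> verts verts \<and>
     (\<forall>V\<in>verts. \<forall>W\<in>verts. comparable (\<phi> V) (\<phi> W) \<longleftrightarrow> comparable V W)"

lemma comparability_aut_bij: "comparability_aut \<phi> \<Longrightarrow> bij_betw \<phi> verts verts"
  by (simp add: comparability_aut_def)

lemma comparability_aut_closed: "comparability_aut \<phi> \<Longrightarrow> V \<in> verts \<Longrightarrow> \<phi> V \<in> verts"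
  using comparability_aut_bij bij_betwE by metis

lemma comparability_aut_iff:
  "comparability_aut \<phi> \<Longrightarrow> V \<in> verts \<Longrightarrow> W \<in> verts \<Longrightarrow> comparable (\<phi> V) (\<phi> W) \<longleftrightarrow> comparable V W"
  by (simp add: comparability_aut_def)

lemma comparability_aut_eq_iff:
  "comparability_aut \<phi> \<Longrightarrow> V \<in> verts \<Longrightarrow> W \<in> verts \<Longrightarrow> \<phi> V = \<phi> W \<longleftrightarrow> V = W"
  using comparability_aut_bij[of \<phi>] by (auto simp: bij_betw_def inj_on_def)

lemma comparability_aut_surj:
  assumes "comparability_aut \<phi>" "W \<in> verts" obtains V where "V \<in> verts" "\<phi> V = W"
  using comparability_aut_bij[OF assms(1)] assms(2) unfolding bij_betw_def by (metis imageE)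

lemma comparability_aut_inv:
  assumes \<phi>: "comparability_aut \<phi>"
  shows "comparability_aut (inv_into verts \<phi>)"
  unfolding comparability_aut_def
proof (intro conjI ballI)
  let ?i = "inv_into verts \<phi>"
  show b: "bij_betw ?i verts verts" using bij_betw_inv_into[OF comparability_aut_bij[OF \<phi>]] .
  fix V W assume V: "V \<in> verts" and W: "W \<in> verts"
  have "?i V \<in> verts" "?i W \<in> verts" using bij_betwE[OF b] V W by auto
  then show "comparable (?i V) (?i W) \<longleftrightarrow> comparable V W"
    using comparability_aut_iff[OF \<phi>, of "?i V" "?i W"]
      bij_betw_inv_into_right[OF comparability_aut_bij[OF \<phi>]] V W by simp
qed

lemma comparability_aut_comp:
  assumes \<phi>: "comparability_aut \<phi>" and \<psi>: "comparability_aut \<psi>"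
  shows "comparability_aut (\<phi> \<circ> \<psi>)"
  unfolding comparability_aut_def
proof (intro conjI ballI)
  show "bij_betw (\<phi> \<circ> \<psi>) verts verts"
    by (rule bij_betw_trans[OF comparability_aut_bij[OF \<psi>] comparability_aut_bij[OF \<phi>]])
  show "comparable ((\<phi> \<circ> \<psi>) V) ((\<phi> \<circ> \<psi>) W) \<longleftrightarrow> comparable V W" if "V \<in> verts" "W \<in> verts" for V W
    using comparability_aut_iff[OF \<phi>] comparability_aut_iff[OF \<psi>] comparability_aut_closed[OF \<psi>] that by simp
qed

lemma comparability_aut_perp: "comparability_aut perp"
  unfolding comparability_aut_def comparable_def using perp_bij perp_subset_iff by blast

lemma order_aut_imp_comparability_aut: "order_aut \<phi> \<Longrightarrow> comparability_aut \<phi>"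
  unfolding comparability_aut_def comparable_def using order_aut_bij order_aut_subset_iff by blast

lemma comparable_eqI: "V \<in> verts \<Longrightarrow> W \<in> verts \<Longrightarrow> comparable V W \<Longrightarrow> rk V = rk W \<Longrightarrow> V = W"
  using vertex_eqI[of V W] vertex_eqI[of W V] by (auto simp: comparable_def)

lemma comparable_subsetI: "V \<in> verts \<Longrightarrow> W \<in> verts \<Longrightarrow> comparable V W \<Longrightarrow> rk V \<le> rk W \<Longrightarrow> V \<subseteq> W"
  using vertex_eqI[of W V] by (auto simp: comparable_def)

text \<open>Points and hyperplanes are the vertices whose link is not a join.\<close>

definition extreme :: "(nat \<Rightarrow> 'a) set \<Rightarrow> bool" where
  "extreme V \<longleftrightarrow> (\<forall>A\<in>verts. \<forall>B\<in>verts. A \<noteq> V \<longrightarrow> B \<noteq> V \<longrightarrow> comparable A V \<longrightarrow> comparable B V \<longrightarrow> comparable A B \<longrightarrow>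
     (\<exists>U\<in>verts. comparable U V \<and> \<not> comparable U A \<and> \<not> comparable U B))"

lemma extreme_image:
  assumes \<phi>: "comparability_aut \<phi>" and V: "V \<in> verts" and e: "extreme V"
  shows "extreme (\<phi> V)"
  unfolding extreme_def
proof (intro ballI impI)
  fix A' B' assume A': "A' \<in> verts" "A' \<noteq> \<phi> V" "comparable A' (\<phi> V)"
    and B': "B' \<in> verts" "B' \<noteq> \<phi> V" "comparable B' (\<phi> V)" and AB: "comparable A' B'"
  obtain A where A: "A \<in> verts" "\<phi> A = A'" by (rule comparability_aut_surj[OF \<phi> A'(1)])
  obtain B where B: "B \<in> verts" "\<phi> B = B'" by (rule comparability_aut_surj[OF \<phi> B'(1)])
  note iff = comparability_aut_iff[OF \<phi>]
  have "A \<noteq> V" "B \<noteq> V" "comparable A V" "comparable B V" "comparable A B"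
    using A' B' AB A B iff[OF A(1) V] iff[OF B(1) V] iff[OF A(1) B(1)] by auto
  then obtain U where U: "U \<in> verts" "comparable U V" "\<not> comparable U A" "\<not> comparable U B"
    using e A(1) B(1) unfolding extreme_def by blast
  show "\<exists>U\<in>verts. comparable U (\<phi> V) \<and> \<not> comparable U A' \<and> \<not> comparable U B'"
    using U iff[OF U(1) V] iff[OF U(1) A(1)] iff[OF U(1) B(1)] A(2) B(2) comparability_aut_closed[OF \<phi> U(1)]
    by (intro bexI[of _ "\<phi> U"]) auto
qed

text \<open>Everything comparable with a point lies above it. For a chain
  \<open>A \<subseteq> B\<close> of larger vertices, a plane through \<open>L\<close> that meets
  \<open>B\<close> only in \<open>L\<close> is comparable with neither.\<close>

lemma extreme_line:
  assumes L: "L \<in> verts" "rk L = 1"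
  shows "extreme L"
proof -
  have main: "\<exists>U\<in>verts. comparable U L \<and> \<not> comparable U A \<and> \<not> comparable U B"
    if A: "A \<in> verts" "A \<noteq> L" "L \<subseteq> A" and B: "B \<in> verts" "B \<noteq> L" "L \<subseteq> B" and AB: "A \<subseteq> B" for A B
  proof -
    let ?k = "rk B"
    have k: "1 < ?k" "?k < d" using vertex_eqI[OF L(1) B(1,3)] L(2) B(2) rk_less[OF B(1)] by auto
    have L1: "subspace 1 L" using vertex_subspace[OF L(1)] L(2) by simp
    obtain g where g: "lin_aut g" "L = g ` std_space 1" "B = g ` std_space ?k"
      by (rule subspace_nested[OF L1 vertex_subspace[OF B(1)] B(3)])
    \<comment> \<open>\<open>?k\<close> is the first basis index outside \<open>B\<close>, available
      because \<open>B\<close> is proper; index 0 keeps \<open>L\<close> inside the plane.\<close>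
    let ?C = "coord_space {0, ?k}"
    have "subspace 2 ?C" using subspace_coord_space[of "{0, ?k}"] k by (simp add: numeral_2_eq_2)
    then obtain h where h: "lin_aut h" "?C = h ` std_space 2" by (auto simp: subspace_def)
    let ?U = "g ` ?C"
    have U: "?U = (g \<circ> h) ` std_space 2" unfolding h(2) by (simp add: image_comp)
    have Uv: "?U \<in> verts" unfolding U using vertex_image[OF lin_aut_comp[OF g(1) h(1)]] d_ge_3 by simp
    have LU: "L \<subseteq> ?U" unfolding g(2) by (intro image_mono coord_space_mono) auto
    have inj: "x = y" if "g x = g y" "x \<in> coord_space I" "y \<in> coord_space J" for x y I J
      using that semilinear_eq_iff[OF g(1)] coord_space_closed by auto
    have "g (unit_vec ?k) \<in> ?U" by (intro imageI unit_vec_in_coord_space) auto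
    moreover have "g (unit_vec ?k) \<notin> B"
    proof
      assume "g (unit_vec ?k) \<in> B"
      then obtain x where x: "x \<in> std_space ?k" "g (unit_vec ?k) = g x" using g(3) by blast
      then have "unit_vec ?k = x" using inj[OF x(2) unit_vec_in_coord_space[of ?k "{?k}"] x(1)] by simp
      then have "unit_vec ?k ?k = \<zero>" using coord_space_nth[OF x(1) k(2)] by simp
      then show False using k one_neq_zero by simp
    qed
    ultimately have nUB: "\<not> ?U \<subseteq> B" by blast
    have UB: "?U \<inter> B \<subseteq> L"
    proof
      fix y assume y: "y \<in> ?U \<inter> B"
      then obtain x x' where x: "x \<in> ?C" "y = g x" and x': "x' \<in> std_space ?k" "y = g x'" using g(3) by blast
      have eq: "x = x'" using inj[OF _ x(1) x'(1)] x(2) x'(2) by simp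
      have "x i = \<zero>" if "i < d" "i \<notin> {..<1}" for i
        using coord_space_nth[OF x(1) that(1)] coord_space_nth[OF x'(1) that(1)] that eq by (cases "i = ?k") auto
      then have "x \<in> std_space 1" using coord_space_closed[OF x(1)] by (auto simp: coord_space_def)
      then show "y \<in> L" using x(2) g(2) by blast
    qed
    have "\<not> A \<subseteq> ?U" using UB A AB by blast
    moreover have "\<not> B \<subseteq> ?U" using UB B by blast
    ultimately show ?thesis using Uv LU nUB AB unfolding comparable_def by (intro bexI[of _ ?U]) auto
  qed
  have above: "L \<subseteq> A" if "A \<in> verts" "comparable A L" for A
    using comparable_subsetI[OF L(1) that(1)] that(2) rk_pos[OF that(1)] L(2) by (auto simp: comparable_def)
  show ?thesis unfolding extreme_def
  proof (intro ballI impI)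
    fix A B assume A: "A \<in> verts" "A \<noteq> L" "comparable A L" and B: "B \<in> verts" "B \<noteq> L" "comparable B L"
      and AB: "comparable A B"
    show "\<exists>U\<in>verts. comparable U L \<and> \<not> comparable U A \<and> \<not> comparable U B"
    proof (cases "A \<subseteq> B")
      case True
      then show ?thesis using main[OF A(1,2) above[OF A(1,3)] B(1,2) above[OF B(1,3)]] by blast
    next
      case False
      then have "B \<subseteq> A" using AB by (auto simp: comparable_def)
      then show ?thesis using main[OF B(1,2) above[OF B(1,3)] A(1,2) above[OF A(1,3)]] by blast
    qed
  qed
qed

text \<open>Hyperplanes are complements of points, and complements preserve comparability. In an
  intermediate rank, take a point below \<open>V\<close> and a hyperplane above it: whatever is
  comparable with \<open>V\<close> contains the former or is contained in the latter.\<close>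

lemma extreme_iff:
  assumes V: "V \<in> verts"
  shows "extreme V \<longleftrightarrow> rk V = 1 \<or> rk V = d - 1"
proof
  assume "rk V = 1 \<or> rk V = d - 1"
  then show "extreme V"
  proof
    assume "rk V = d - 1"
    then have "rk (perp V) = 1" using rk_perp[OF V] d_ge_3 by simp
    then have "extreme (perp (perp V))"
      using extreme_image[OF comparability_aut_perp perp_vertex[OF V]] extreme_line[OF perp_vertex[OF V]] by simp
    then show ?thesis using perp_perp[OF V] by simp
  qed (rule extreme_line[OF V])
next
  assume e: "extreme V"
  show "rk V = 1 \<or> rk V = d - 1"
  proof (rule ccontr)
    assume "\<not> ?thesis"
    then have k: "1 < rk V" "rk V < d - 1" using rk_pos[OF V] rk_less[OF V] by auto
    obtain g where g: "lin_aut g" "V = g ` std_space (rk V)" by (rule vertex_standard[OF V])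
    let ?A = "g ` std_space 1" and ?B = "g ` std_space (d - 1)"
    have A: "?A \<in> verts" "rk ?A = 1" and B: "?B \<in> verts" "rk ?B = d - 1"
      using vertex_image[OF g(1)] rk_image[OF g(1)] d_ge_3 by auto
    have AV: "?A \<subseteq> V" by (subst g(2)) (intro image_mono coord_space_mono, use k in auto)
    have VB: "V \<subseteq> ?B" by (subst g(2)) (intro image_mono coord_space_mono, use k in auto)
    have ne: "?A \<noteq> V" "?B \<noteq> V" using A(2) B(2) k by auto
    have cmp: "comparable ?A V" "comparable ?B V" "comparable ?A ?B"
      using AV VB subset_trans[OF AV VB] by (simp_all add: comparable_def)
    obtain U where U: "comparable U V" "\<not> comparable U ?A" "\<not> comparable U ?B"
      using e[unfolded extreme_def, rule_format, OF A(1) B(1) ne cmp] by blast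
    show False
    proof (cases "U \<subseteq> V")
      case True
      then have "U \<subseteq> ?B" using VB by (rule subset_trans)
      then show False using U(3) by (simp add: comparable_def)
    next
      case False
      then have "V \<subseteq> U" using U(1) by (simp add: comparable_def)
      then have "?A \<subseteq> U" using AV by (rule subset_trans[rotated])
      then show False using U(2) by (simp add: comparable_def)
    qed
  qed
qed

lemma hyperplane_exists:
  assumes V: "V \<in> verts" obtains H where "H \<in> verts" "rk H = d - 1" "V \<subseteq> H"
proof -
  obtain g where g: "lin_aut g" "V = g ` std_space (rk V)" by (rule vertex_standard[OF V])
  have "V \<subseteq> g ` std_space (d - 1)"
    by (subst g(2)) (intro image_mono coord_space_mono, use rk_less[OF V] in auto)
  then show thesis
    using that vertex_image[OF g(1), of "d - 1"] rk_image[OF g(1), of "d - 1"] d_ge_3 by simp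
qed

lemma line_exists:
  assumes V: "V \<in> verts" obtains v where "unimodular v" "line v \<subseteq> V"
proof -
  obtain g where g: "lin_aut g" "V = g ` std_space (rk V)" by (rule vertex_standard[OF V])
  have "unit_vec 0 \<in> std_space (rk V)" using rk_pos[OF V] by (intro unit_vec_in_coord_space) simp
  then have "g (unit_vec 0) \<in> V" using g(2) by blast
  moreover have "unimodular (g (unit_vec 0))"
    using unimodular_image_iff[OF g(1)] unimodular_unit_vec[of 0] d_ge_3 by simp
  ultimately show thesis using that line_subset_iff[OF vertex_subspace[OF V] unimodular_closed] by blast
qed

text \<open>Both points lie in a plane, and this in a hyperplane \<open>H\<close>. The image of
  \<open>H\<close> is a point or a hyperplane, and distinct points are incomparable, so it is a
  hyperplane. By the same argument applied to hyperplanes, the image of the second point is not a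
  hyperplane, hence a point.\<close>

lemma rk_line_propagates:
  assumes \<phi>: "comparability_aut \<phi>" and v: "unimodular v" "rk (\<phi> (line v)) = 1" and u: "unimodular u"
    and n: "s \<odot>\<^bsub>M\<^esub> u \<notin> line v"
  shows "rk (\<phi> (line u)) = 1"
proof -
  obtain W where W: "W \<in> verts" "rk W = 2" "v \<in> W" "u \<in> W"
    by (rule plane_exists[OF v(1) unimodular_closed[OF u] n])
  obtain H where H: "H \<in> verts" "rk H = d - 1" "W \<subseteq> H" by (rule hyperplane_exists[OF W(1)])
  have sub: "line x \<subseteq> H" if "unimodular x" "x \<in> W" for x
    using that H(3) line_subset_iff[OF vertex_subspace[OF H(1)] unimodular_closed] by blast
  have ne: "line x \<noteq> H" if "unimodular x" for x using rk_line[OF that] H(2) d_ge_3 by auto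
  have cmp: "comparable (\<phi> (line x)) (\<phi> H)" "\<phi> (line x) \<noteq> \<phi> H" "\<phi> (line x) \<in> verts" if "unimodular x" "x \<in> W" for x
    using comparability_aut_iff[OF \<phi> line_vertex[OF that(1)] H(1)] sub[OF that] ne[OF that(1)]
      comparability_aut_eq_iff[OF \<phi> line_vertex[OF that(1)] H(1)] comparability_aut_closed[OF \<phi> line_vertex[OF that(1)]]
    by (auto simp: comparable_def)
  have H': "\<phi> H \<in> verts" using comparability_aut_closed[OF \<phi> H(1)] .
  have "extreme (\<phi> H)" using extreme_image[OF \<phi> H(1)] extreme_iff[OF H(1)] H(2) by simp
  then have "rk (\<phi> H) = 1 \<or> rk (\<phi> H) = d - 1" using extreme_iff[OF H'] by simp
  moreover have "rk (\<phi> H) \<noteq> 1"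
    using comparable_eqI[OF cmp(3)[OF v(1) W(3)] H' cmp(1)[OF v(1) W(3)]] cmp(2)[OF v(1) W(3)] v(2) by metis
  ultimately have rH: "rk (\<phi> H) = d - 1" by simp
  have "extreme (\<phi> (line u))"
    using extreme_image[OF \<phi> line_vertex[OF u]] extreme_iff[OF line_vertex[OF u]] rk_line[OF u] by simp
  then have "rk (\<phi> (line u)) = 1 \<or> rk (\<phi> (line u)) = d - 1" using extreme_iff[OF cmp(3)[OF u W(4)]] by simp
  moreover have "rk (\<phi> (line u)) \<noteq> d - 1"
    using comparable_eqI[OF cmp(3)[OF u W(4)] H' cmp(1)[OF u W(4)]] cmp(2)[OF u W(4)] rH by metis
  ultimately show ?thesis by simp
qed

text \<open>Near points are connected through a third point that is near neither: \<open>v\<close>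
  and \<open>u\<close> share a pivot \<open>i\<close>, and e_j serves for any other index
  \<open>j\<close>.\<close>

lemma rk_line_propagates_all:
  assumes \<phi>: "comparability_aut \<phi>" and v: "unimodular v" "rk (\<phi> (line v)) = 1" and u: "unimodular u"
  shows "rk (\<phi> (line u)) = 1"
proof (cases "s \<odot>\<^bsub>M\<^esub> u \<in> line v")
  case True
  note vc = unimodular_closed[OF v(1)] and uc = unimodular_closed[OF u]
  obtain i where i: "i < d" "v i \<in> Units S" using v(1) by (auto simp: unimodular_iff)
  obtain j where j: "j < d" "j \<noteq> i" using d_ge_3 that[of 0] that[of 1] by (cases "i = 0") auto
  have vi: "v i \<in> carrier S" "v i \<noteq> \<zero>" using vc i Unit_nonzero by auto
  have cancel: "c = \<zero>" if "c \<in> carrier S" "c \<otimes> v i = \<zero>" for c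
  proof -
    have "c = (c \<otimes> v i) \<otimes> inv (v i)" using that(1) i vi(1) by (simp only: m_assoc Units_inv_closed Units_r_inv r_one)
    then show ?thesis using that(2) i by simp
  qed
  have 1: "s \<odot>\<^bsub>M\<^esub> unit_vec j \<notin> line v"
  proof
    assume "s \<odot>\<^bsub>M\<^esub> unit_vec j \<in> line v"
    then obtain c where c: "c \<in> carrier S" "s \<odot>\<^bsub>M\<^esub> unit_vec j = c \<odot>\<^bsub>M\<^esub> v" by (auto simp: line_def)
    have eq: "(s \<odot>\<^bsub>M\<^esub> unit_vec j) k = (c \<odot>\<^bsub>M\<^esub> v) k" for k using c(2) by simp
    have "c = \<zero>" using eq[of i] i j c(1) cancel by simp
    then show False using eq[of j] j vc socle_nonzero by simp
  qed
  obtain c where c: "c \<in> carrier S" "s \<odot>\<^bsub>M\<^esub> u = c \<odot>\<^bsub>M\<^esub> v" using True by (auto simp: line_def)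
  have "c \<noteq> \<zero>" using c(2) u vc by (auto simp: unimodular_def)
  then have "c \<otimes> v i \<noteq> \<zero>" using cancel c(1) by blast
  moreover have "(s \<odot>\<^bsub>M\<^esub> u) i = (c \<odot>\<^bsub>M\<^esub> v) i" using c(2) by simp
  ultimately have "s \<otimes> u i \<noteq> \<zero>" using i by simp
  then have ui: "u i \<in> Units S" using Unit_iff[of "u i"] uc i by auto
  have 2: "s \<odot>\<^bsub>M\<^esub> u \<notin> line (unit_vec j)"
    using i(1) ui by (rule not_in_lineI[of i u]) (use i j in simp)
  show ?thesis
    using rk_line_propagates[OF \<phi> unimodular_unit_vec[OF j(1)] _ u 2]
      rk_line_propagates[OF \<phi> v unimodular_unit_vec[OF j(1)] 1] by simp
qed (rule rk_line_propagates[OF \<phi> v u])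

text \<open>Inclusion of vertices is tested on points, and for a point comparability with a vertex
  already means being contained in it.\<close>

lemma point_preserving_mono:
  assumes \<phi>: "comparability_aut \<phi>" and pts: "\<And>V. V \<in> verts \<Longrightarrow> rk (\<phi> V) = 1 \<longleftrightarrow> rk V = 1"
    and V: "V \<in> verts" and W: "W \<in> verts" and sub: "V \<subseteq> W"
  shows "\<phi> V \<subseteq> \<phi> W"
proof (rule subspace_subset_unimodularI[OF vertex_subspace vertex_subspace])
  show V': "\<phi> V \<in> verts" and W': "\<phi> W \<in> verts" using comparability_aut_closed[OF \<phi>] V W by auto
  fix w assume w: "unimodular w" "w \<in> \<phi> V"
  obtain P where P: "P \<in> verts" "\<phi> P = line w" by (rule comparability_aut_surj[OF \<phi> line_vertex[OF w(1)]])
  have P1: "rk P = 1" using pts[OF P(1)] P(2) rk_line[OF w(1)] by simp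
  have "line w \<subseteq> \<phi> V" using line_subset_iff[OF vertex_subspace[OF V'] unimodular_closed[OF w(1)]] w(2) by simp
  then have "comparable P V" using comparability_aut_iff[OF \<phi> P(1) V] P(2) by (auto simp: comparable_def)
  then have "P \<subseteq> V" using comparable_subsetI[OF P(1) V] P1 rk_pos[OF V] by simp
  then have "comparable P W" using sub by (auto simp: comparable_def)
  then have "comparable (line w) (\<phi> W)" using comparability_aut_iff[OF \<phi> P(1) W] P(2) by simp
  then have "line w \<subseteq> \<phi> W"
    using comparable_subsetI[OF line_vertex[OF w(1)] W'] rk_line[OF w(1)] rk_pos[OF W'] by simp
  then show "w \<in> \<phi> W" using line_self[OF unimodular_closed[OF w(1)]] by blast
qed

text \<open>Points go to points by propagation. Conversely, a vertex sent to a point contains some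
  point, whose image is comparable with it and of the same rank, so the two coincide. Hence the map
  and its inverse both preserve inclusion.\<close>

lemma point_preserving_order_aut:
  assumes \<phi>: "comparability_aut \<phi>" and v: "unimodular v" "rk (\<phi> (line v)) = 1"
  shows "order_aut \<phi>"
proof -
  let ?i = "inv_into verts \<phi>"
  note i = comparability_aut_inv[OF \<phi>]
  have pts: "rk (\<phi> V) = 1 \<longleftrightarrow> rk V = 1" if V: "V \<in> verts" for V
  proof
    assume "rk V = 1"
    then obtain u where "unimodular u" "V = line u" by (rule rk_1_line[OF V])
    then show "rk (\<phi> V) = 1" using rk_line_propagates_all[OF \<phi> v] by simp
  next
    assume r: "rk (\<phi> V) = 1"
    obtain u where u: "unimodular u" "line u \<subseteq> V" by (rule line_exists[OF V])
    note L = line_vertex[OF u(1)]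
    have "comparable (\<phi> (line u)) (\<phi> V)"
      using comparability_aut_iff[OF \<phi> L V] u(2) by (auto simp: comparable_def)
    then have "\<phi> (line u) = \<phi> V"
      using comparable_eqI[OF comparability_aut_closed[OF \<phi> L] comparability_aut_closed[OF \<phi> V]]
        rk_line_propagates_all[OF \<phi> v u(1)] r by simp
    then have "line u = V" using comparability_aut_eq_iff[OF \<phi> L V] by simp
    then show "rk V = 1" using rk_line[OF u(1)] by simp
  qed
  have inv: "?i V \<in> verts" "\<phi> (?i V) = V" if "V \<in> verts" for V
    using comparability_aut_closed[OF i that] bij_betw_inv_into_right[OF comparability_aut_bij[OF \<phi>] that] by auto
  have inv': "?i (\<phi> V) = V" if "V \<in> verts" for V
    using bij_betw_inv_into_left[OF comparability_aut_bij[OF \<phi>] that] .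
  have pts': "rk (?i V) = 1 \<longleftrightarrow> rk V = 1" if V: "V \<in> verts" for V
    using pts[OF inv(1)[OF V]] inv(2)[OF V] by simp
  have "\<phi> V \<subseteq> \<phi> W \<longleftrightarrow> V \<subseteq> W" if V: "V \<in> verts" and W: "W \<in> verts" for V W
  proof
    show "V \<subseteq> W \<Longrightarrow> \<phi> V \<subseteq> \<phi> W" by (rule point_preserving_mono[OF \<phi> pts V W])
    assume "\<phi> V \<subseteq> \<phi> W"
    then have "?i (\<phi> V) \<subseteq> ?i (\<phi> W)"
      using point_preserving_mono[OF i _ comparability_aut_closed[OF \<phi> V] comparability_aut_closed[OF \<phi> W]] pts' by blast
    then show "V \<subseteq> W" using inv' V W by simp
  qed
  then show ?thesis using comparability_aut_bij[OF \<phi>] by (simp add: order_aut_def)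
qed

text \<open>The image of one point is a point or a hyperplane, and in the second case
  complementation makes it a point. One point is enough because the property propagates to
  all.\<close>

lemma comparability_aut_cases:
  assumes \<phi>: "comparability_aut \<phi>"
  shows "order_aut \<phi> \<or> order_aut (perp \<circ> \<phi>)"
proof -
  have e: "unimodular (unit_vec 0)" using unimodular_unit_vec[of 0] d_ge_3 by simp
  note L = line_vertex[OF e]
  note L' = comparability_aut_closed[OF \<phi> L]
  have "extreme (\<phi> (line (unit_vec 0)))"
    using extreme_image[OF \<phi> L] extreme_iff[OF L] rk_line[OF e] by simp
  then consider "rk (\<phi> (line (unit_vec 0))) = 1" | "rk (\<phi> (line (unit_vec 0))) = d - 1"
    using extreme_iff[OF L'] by blast
  then show ?thesis
  proof cases
    case 1
    then show ?thesis using point_preserving_order_aut[OF \<phi> e] by simp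
  next
    case 2
    then have "rk ((perp \<circ> \<phi>) (line (unit_vec 0))) = 1" using rk_perp[OF L'] d_ge_3 by simp
    then show ?thesis
      using point_preserving_order_aut[OF comparability_aut_comp[OF comparability_aut_perp \<phi>] e] by simp
  qed
qed


section \<open>Matrices\<close>

lemma linear_on_eqI:
  assumes "linear_on (carrier M) f" "linear_on (carrier M) g" "\<And>i. i < d \<Longrightarrow> f (unit_vec i) = g (unit_vec i)"
    and v: "v \<in> carrier M"
  shows "f v = g v"
proof -
  have "f v = (\<Oplus>\<^bsub>M\<^esub>i\<in>{..<d}. v i \<odot>\<^bsub>M\<^esub> f (unit_vec i))"
    using linear_on_expand[of d f v] assms by (simp add: std_space_full)
  also have "\<dots> = (\<Oplus>\<^bsub>M\<^esub>i\<in>{..<d}. v i \<odot>\<^bsub>M\<^esub> g (unit_vec i))"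
    using v linear_on_closed[OF assms(2)] by (intro vec.M.finsum_cong') (auto simp: assms(3))
  also have "\<dots> = g v"
    using linear_on_expand[of d g v] assms by (simp add: std_space_full)
  finally show ?thesis .
qed

abbreviation "MM \<equiv> mat_monoid S d"

abbreviation "mv \<equiv> mat_vec S d"

lemma mat_nth_closed [simp]: "A \<in> carrier MM \<Longrightarrow> i < d \<Longrightarrow> j < d \<Longrightarrow> A (i, j) \<in> carrier S"
  by (auto simp: mat_monoid_def)

lemma mat_closedI: "(\<And>i j. i < d \<Longrightarrow> j < d \<Longrightarrow> f i j \<in> carrier S) \<Longrightarrow> (\<lambda>(i, j)\<in>{..<d} \<times> {..<d}. f i j) \<in> carrier MM"
  by (auto simp: mat_monoid_def)

lemma mat_extI: "A \<in> carrier MM \<Longrightarrow> B \<in> carrier MM \<Longrightarrow> (\<And>i j. i < d \<Longrightarrow> j < d \<Longrightarrow> A (i, j) = B (i, j)) \<Longrightarrow> A = B"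
  unfolding mat_monoid_def by (rule PiE_ext) auto

lemma mat_mult_nth: "i < d \<Longrightarrow> j < d \<Longrightarrow> (A \<otimes>\<^bsub>MM\<^esub> B) (i, j) = (\<Oplus>k\<in>{..<d}. A (i, k) \<otimes> B (k, j))"
  by (simp add: mat_monoid_def)

lemma mat_one_nth: "i < d \<Longrightarrow> j < d \<Longrightarrow> \<one>\<^bsub>MM\<^esub> (i, j) = (if i = j then \<one> else \<zero>)"
  by (simp add: mat_monoid_def)

lemma mat_one_closed: "\<one>\<^bsub>MM\<^esub> \<in> carrier MM"
  by (auto simp: mat_monoid_def)

lemma mat_mult_closed: "A \<in> carrier MM \<Longrightarrow> B \<in> carrier MM \<Longrightarrow> A \<otimes>\<^bsub>MM\<^esub> B \<in> carrier MM"
  unfolding mat_monoid_def by (auto intro!: finsum_closed simp: PiE_iff)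

lemma mv_nth: "i < d \<Longrightarrow> mv A v i = (\<Oplus>j\<in>{..<d}. A (i, j) \<otimes> v j)"
  by (simp add: mat_vec_def)

lemma row_closed: "A \<in> carrier MM \<Longrightarrow> i < d \<Longrightarrow> (\<lambda>j\<in>{..<d}. A (i, j)) \<in> carrier M"
  by (intro vec_closedI) simp

lemma mv_closed: "A \<in> carrier MM \<Longrightarrow> v \<in> carrier M \<Longrightarrow> mv A v \<in> carrier M"
  unfolding mat_vec_def by (intro vec_closedI finsum_closed) auto

lemma mv_linear_on:
  assumes A: "A \<in> carrier MM" shows "linear_on (carrier M) (mv A)"
  unfolding linear_on_def
proof (intro conjI ballI)
  show "mv A \<in> carrier M \<rightarrow> carrier M" using mv_closed[OF A] by simp
  have eq: "mv A v i = form (\<lambda>j\<in>{..<d}. A (i, j)) v" if "v \<in> carrier M" "i < d" for v i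
    using that A unfolding mat_vec_def std_form_def by (auto intro!: finsum_cong')
  show "mv A (v \<oplus>\<^bsub>M\<^esub> w) = mv A v \<oplus>\<^bsub>M\<^esub> mv A w" if "v \<in> carrier M" "w \<in> carrier M" for v w
    by (rule vec_eqI) (use that in \<open>simp_all add: mv_closed[OF A] eq form_add_right row_closed[OF A]\<close>)
  show "mv A (c \<odot>\<^bsub>M\<^esub> v) = c \<odot>\<^bsub>M\<^esub> mv A v" if "c \<in> carrier S" "v \<in> carrier M" for c v
    by (rule vec_eqI) (use that in \<open>simp_all add: mv_closed[OF A] eq form_smult_right row_closed[OF A]\<close>)
qed

lemma mv_unit_vec_nth:
  assumes "A \<in> carrier MM" "i < d" "j < d" shows "mv A (unit_vec j) i = A (i, j)"
proof -
  have "mv A (unit_vec j) i = (\<Oplus>k\<in>{..<d}. if j = k then A (i, k) else \<zero>)"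
    unfolding mv_nth[OF assms(2)] by (intro finsum_cong') (use assms in auto)
  also have "\<dots> = A (i, j)" by (rule add.finprod_singleton) (use assms in auto)
  finally show ?thesis .
qed

lemma mat_eqI:
  assumes A: "A \<in> carrier MM" and B: "B \<in> carrier MM" and eq: "\<And>j. j < d \<Longrightarrow> mv A (unit_vec j) = mv B (unit_vec j)"
  shows "A = B"
  by (rule mat_extI[OF A B]) (metis eq mv_unit_vec_nth A B)

lemma mv_mult:
  assumes A: "A \<in> carrier MM" and B: "B \<in> carrier MM" and v: "v \<in> carrier M"
  shows "mv (A \<otimes>\<^bsub>MM\<^esub> B) v = mv A (mv B v)"
proof (rule linear_on_eqI[OF mv_linear_on[OF mat_mult_closed[OF A B]] _ _ v])
  show "linear_on (carrier M) (\<lambda>v. mv A (mv B v))"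
    using mv_linear_on[OF A] mv_linear_on[OF B] unfolding linear_on_def Pi_iff by simp
  fix k assume k: "k < d"
  have Bk: "mv B (unit_vec k) \<in> carrier M" using mv_closed[OF B] by simp
  show "mv (A \<otimes>\<^bsub>MM\<^esub> B) (unit_vec k) = mv A (mv B (unit_vec k))"
  proof (rule vec_eqI[OF mv_closed[OF mat_mult_closed[OF A B] unit_vec_closed] mv_closed[OF A Bk]])
    fix i assume i: "i < d"
    have "mv (A \<otimes>\<^bsub>MM\<^esub> B) (unit_vec k) i = (\<Oplus>j\<in>{..<d}. A (i, j) \<otimes> B (j, k))"
      using mv_unit_vec_nth[OF mat_mult_closed[OF A B] i k] mat_mult_nth[OF i k] by simp
    also have "\<dots> = mv A (mv B (unit_vec k)) i"
      unfolding mv_nth[OF i] by (intro finsum_cong') (use i k A B in \<open>auto simp: mv_unit_vec_nth\<close>)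
    finally show "mv (A \<otimes>\<^bsub>MM\<^esub> B) (unit_vec k) i = mv A (mv B (unit_vec k)) i" .
  qed
qed

lemma mv_one: "v \<in> carrier M \<Longrightarrow> mv \<one>\<^bsub>MM\<^esub> v = v"
  by (rule linear_on_eqI[OF mv_linear_on[OF mat_one_closed] lin_aut_linear_on[OF lin_aut_id]])
     (auto intro!: vec_eqI mv_closed mat_one_closed simp: mv_unit_vec_nth[OF mat_one_closed] mat_one_nth)

text \<open>A matrix is determined by its columns, so matrix identities are checked as identities
  between the maps \<open>mv\<close> on unit vectors; associativity becomes that of
  composition.\<close>

lemma monoid_MM: "monoid MM"
proof (rule monoidI)
  fix A B C assume A: "A \<in> carrier MM" and B: "B \<in> carrier MM" and C: "C \<in> carrier MM"
  show "A \<otimes>\<^bsub>MM\<^esub> B \<otimes>\<^bsub>MM\<^esub> C = A \<otimes>\<^bsub>MM\<^esub> (B \<otimes>\<^bsub>MM\<^esub> C)"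
    by (rule mat_eqI) (simp_all add: mv_mult mat_mult_closed mv_closed A B C)
next
  fix A assume A: "A \<in> carrier MM"
  show "\<one>\<^bsub>MM\<^esub> \<otimes>\<^bsub>MM\<^esub> A = A"
    by (rule mat_eqI) (simp_all add: mv_mult mat_mult_closed mat_one_closed mv_closed mv_one A)
  show "A \<otimes>\<^bsub>MM\<^esub> \<one>\<^bsub>MM\<^esub> = A"
    by (rule mat_eqI) (simp_all add: mv_mult mat_mult_closed mat_one_closed mv_closed mv_one A)
qed (auto simp: mat_one_closed mat_mult_closed)

section \<open>Invertible matrices and linear automorphisms\<close>

abbreviation "GLd \<equiv> GL S d"

lemma group_GL: "group GLd"
  unfolding GL_def by (rule monoid.units_group[OF monoid_MM])

lemma GL_mult: "A \<otimes>\<^bsub>GLd\<^esub> B = A \<otimes>\<^bsub>MM\<^esub> B" and GL_one: "\<one>\<^bsub>GLd\<^esub> = \<one>\<^bsub>MM\<^esub>"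
  by (simp_all add: GL_def units_of_mult units_of_one)

lemma GL_closed: "A \<in> carrier GLd \<Longrightarrow> A \<in> carrier MM"
  by (auto simp: GL_def units_of_carrier Units_def)

lemma GL_I:
  assumes "A \<in> carrier MM" "B \<in> carrier MM" "A \<otimes>\<^bsub>MM\<^esub> B = \<one>\<^bsub>MM\<^esub>" "B \<otimes>\<^bsub>MM\<^esub> A = \<one>\<^bsub>MM\<^esub>"
  shows "A \<in> carrier GLd"
  using assms by (auto simp: GL_def units_of_carrier Units_def)

lemma GL_inv:
  assumes A: "A \<in> carrier GLd"
  shows "inv\<^bsub>GLd\<^esub> A \<in> carrier GLd" "A \<otimes>\<^bsub>MM\<^esub> inv\<^bsub>GLd\<^esub> A = \<one>\<^bsub>MM\<^esub>" "inv\<^bsub>GLd\<^esub> A \<otimes>\<^bsub>MM\<^esub> A = \<one>\<^bsub>MM\<^esub>"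
  using group.inv_closed[OF group_GL A] group.r_inv[OF group_GL A] group.l_inv[OF group_GL A]
  by (simp_all add: GL_mult GL_one)

lemma lin_aut_mv:
  assumes A: "A \<in> carrier GLd" shows "lin_aut (mv A)"
proof -
  note i = GL_inv[OF A]
  note Ac = GL_closed[OF A] and ic = GL_closed[OF i(1)]
  note lin = mv_linear_on[OF Ac]
  have 1: "mv (inv\<^bsub>GLd\<^esub> A) (mv A v) = v" "mv A (mv (inv\<^bsub>GLd\<^esub> A) v) = v" if "v \<in> carrier M" for v
    using mv_mult[OF ic Ac that] mv_mult[OF Ac ic that] i(2,3) mv_one[OF that] by simp_all
  show ?thesis
    by (rule lin_autI[where g = "mv (inv\<^bsub>GLd\<^esub> A)"])
       (simp_all add: mv_closed[OF Ac] mv_closed[OF ic] 1 linear_on_add[OF lin] linear_on_smult[OF lin])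
qed

definition mat_of :: "((nat \<Rightarrow> 'a) \<Rightarrow> nat \<Rightarrow> 'a) \<Rightarrow> nat \<times> nat \<Rightarrow> 'a" where
  "mat_of g = (\<lambda>(i, j)\<in>{..<d} \<times> {..<d}. g (unit_vec j) i)"

lemma mat_of_nth: "i < d \<Longrightarrow> j < d \<Longrightarrow> mat_of g (i, j) = g (unit_vec j) i"
  by (simp add: mat_of_def)

lemma mat_of:
  assumes g: "lin_aut g"
  shows mat_of_closed: "mat_of g \<in> carrier MM" and mv_mat_of: "\<And>v. v \<in> carrier M \<Longrightarrow> mv (mat_of g) v = g v"
proof -
  have gu: "g (unit_vec j) \<in> carrier M" for j using semilinear_closed[OF g] by simp
  show c: "mat_of g \<in> carrier MM"
    unfolding mat_of_def by (rule mat_closedI) (simp add: gu)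
  show "mv (mat_of g) v = g v" if "v \<in> carrier M" for v
  proof (rule linear_on_eqI[OF mv_linear_on[OF c] lin_aut_linear_on[OF g order_refl] _ that])
    fix j assume j: "j < d"
    show "mv (mat_of g) (unit_vec j) = g (unit_vec j)"
      by (rule vec_eqI[OF mv_closed[OF c unit_vec_closed] gu]) (simp add: mv_unit_vec_nth[OF c _ j] mat_of_nth j)
  qed
qed

lemma mat_of_GL:
  assumes g: "lin_aut g" shows "mat_of g \<in> carrier GLd"
proof -
  note g' = lin_aut_inv[OF g]
  note c = mat_of_closed[OF g] mat_of_closed[OF g']
  show ?thesis
  proof (rule GL_I[OF c])
    show "mat_of g \<otimes>\<^bsub>MM\<^esub> mat_of (inv_on_vecs g) = \<one>\<^bsub>MM\<^esub>"
      by (rule mat_eqI) (simp_all add: mv_mult c mat_mult_closed mat_one_closed mv_one mv_mat_of[OF g]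
          mv_mat_of[OF g'] inv_on_vecs_closed[OF g] inv_on_vecs_right[OF g])
    show "mat_of (inv_on_vecs g) \<otimes>\<^bsub>MM\<^esub> mat_of g = \<one>\<^bsub>MM\<^esub>"
      by (rule mat_eqI) (simp_all add: mv_mult c mat_mult_closed mat_one_closed mv_one mv_mat_of[OF g]
          mv_mat_of[OF g'] semilinear_closed[OF g] inv_on_vecs_left[OF g])
  qed
qed

lemma ring_Aut_finsum:
  assumes \<tau>: "\<tau> \<in> carrier (ring_Aut S)" and "finite I" "f \<in> I \<rightarrow> carrier S"
  shows "\<tau> (\<Oplus>i\<in>I. f i) = (\<Oplus>i\<in>I. \<tau> (f i))"
  using assms(2,3)
proof (induction I)
  case (insert a F)
  then have f: "f \<in> F \<rightarrow> carrier S" "f a \<in> carrier S" by auto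
  then have "(\<lambda>i. \<tau> (f i)) \<in> F \<rightarrow> carrier S" using ring_Aut_closed[OF \<tau>] by (auto simp: Pi_iff)
  then show ?case using insert f by (simp add: ring_Aut_add[OF \<tau>] ring_Aut_closed[OF \<tau>])
qed (simp add: ring_Aut_zero[OF \<tau>])

abbreviation "mmap \<equiv> mat_map d"

lemma mmap_nth: "i < d \<Longrightarrow> j < d \<Longrightarrow> mmap \<tau> A (i, j) = \<tau> (A (i, j))"
  by (simp add: mat_map_def)

lemma mmap_closed: "\<tau> \<in> carrier (ring_Aut S) \<Longrightarrow> A \<in> carrier MM \<Longrightarrow> mmap \<tau> A \<in> carrier MM"
  unfolding mat_map_def by (rule mat_closedI) (simp add: ring_Aut_closed)

lemma mmap_mult:
  assumes \<tau>: "\<tau> \<in> carrier (ring_Aut S)" and A: "A \<in> carrier MM" and B: "B \<in> carrier MM"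
  shows "mmap \<tau> (A \<otimes>\<^bsub>MM\<^esub> B) = mmap \<tau> A \<otimes>\<^bsub>MM\<^esub> mmap \<tau> B"
proof (rule mat_extI[OF mmap_closed[OF \<tau> mat_mult_closed[OF A B]] mat_mult_closed[OF mmap_closed[OF \<tau> A] mmap_closed[OF \<tau> B]]])
  fix i j assume ij: "i < d" "j < d"
  have "\<tau> (\<Oplus>k\<in>{..<d}. A (i, k) \<otimes> B (k, j)) = (\<Oplus>k\<in>{..<d}. \<tau> (A (i, k) \<otimes> B (k, j)))"
    by (rule ring_Aut_finsum[OF \<tau>]) (use A B ij in auto)
  also have "\<dots> = (\<Oplus>k\<in>{..<d}. mmap \<tau> A (i, k) \<otimes> mmap \<tau> B (k, j))"
    by (intro finsum_cong') (use A B ij in \<open>auto simp: mmap_nth ring_Aut_mult[OF \<tau>] ring_Aut_closed[OF \<tau>]\<close>)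
  finally show "mmap \<tau> (A \<otimes>\<^bsub>MM\<^esub> B) (i, j) = (mmap \<tau> A \<otimes>\<^bsub>MM\<^esub> mmap \<tau> B) (i, j)"
    by (simp add: ij mmap_nth mat_mult_nth)
qed

lemma mmap_one: "\<tau> \<in> carrier (ring_Aut S) \<Longrightarrow> mmap \<tau> \<one>\<^bsub>MM\<^esub> = \<one>\<^bsub>MM\<^esub>"
  by (rule mat_extI) (auto simp: mmap_closed mat_one_closed mmap_nth mat_one_nth ring_Aut_one ring_Aut_zero)

lemma mmap_GL:
  assumes \<tau>: "\<tau> \<in> carrier (ring_Aut S)" and A: "A \<in> carrier GLd"
  shows "mmap \<tau> A \<in> carrier GLd"
proof -
  note i = GL_inv[OF A]
  note Ac = GL_closed[OF A] and ic = GL_closed[OF i(1)]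
  show ?thesis
    by (rule GL_I[OF mmap_closed[OF \<tau> Ac] mmap_closed[OF \<tau> ic]])
       (simp_all add: mmap_mult[OF \<tau>, symmetric] Ac ic i mmap_one[OF \<tau>])
qed

lemma vmap_mv:
  assumes \<tau>: "\<tau> \<in> carrier (ring_Aut S)" and A: "A \<in> carrier MM" and v: "v \<in> carrier M"
  shows "vmap \<tau> (mv A v) = mv (mmap \<tau> A) (vmap \<tau> v)"
proof (rule vec_eqI[OF vmap_closed[OF \<tau> mv_closed[OF A v]] mv_closed[OF mmap_closed[OF \<tau> A] vmap_closed[OF \<tau> v]]])
  fix i assume i: "i < d"
  have "\<tau> (\<Oplus>j\<in>{..<d}. A (i, j) \<otimes> v j) = (\<Oplus>j\<in>{..<d}. \<tau> (A (i, j) \<otimes> v j))"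
    by (rule ring_Aut_finsum[OF \<tau>]) (use A v i in auto)
  also have "\<dots> = (\<Oplus>j\<in>{..<d}. mmap \<tau> A (i, j) \<otimes> vmap \<tau> v j)"
    by (intro finsum_cong') (use A v i in \<open>auto simp: mmap_nth ring_Aut_mult[OF \<tau>] ring_Aut_closed[OF \<tau>]\<close>)
  finally show "vmap \<tau> (mv A v) i = mv (mmap \<tau> A) (vmap \<tau> v) i" using i by (simp add: mv_nth)
qed

section \<open>Transposes and contragredient matrices\<close>

abbreviation "mtrans \<equiv> mat_transpose d"

lemma mtrans_nth: "i < d \<Longrightarrow> j < d \<Longrightarrow> mtrans A (i, j) = A (j, i)"
  by (simp add: mat_transpose_def)

lemma mtrans_closed: "A \<in> carrier MM \<Longrightarrow> mtrans A \<in> carrier MM"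
  unfolding mat_transpose_def by (rule mat_closedI) simp

lemma mtrans_mult:
  assumes A: "A \<in> carrier MM" and B: "B \<in> carrier MM"
  shows "mtrans (A \<otimes>\<^bsub>MM\<^esub> B) = mtrans B \<otimes>\<^bsub>MM\<^esub> mtrans A"
proof (rule mat_extI[OF mtrans_closed[OF mat_mult_closed[OF A B]] mat_mult_closed[OF mtrans_closed[OF B] mtrans_closed[OF A]]])
  fix i j assume ij: "i < d" "j < d"
  have "(\<Oplus>k\<in>{..<d}. A (j, k) \<otimes> B (k, i)) = (\<Oplus>k\<in>{..<d}. mtrans B (i, k) \<otimes> mtrans A (k, j))"
    by (intro finsum_cong') (use A B ij in \<open>auto simp: mtrans_nth m_comm\<close>)
  then show "mtrans (A \<otimes>\<^bsub>MM\<^esub> B) (i, j) = (mtrans B \<otimes>\<^bsub>MM\<^esub> mtrans A) (i, j)"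
    using ij by (simp add: mtrans_nth mat_mult_nth)
qed

lemma mtrans_one: "mtrans \<one>\<^bsub>MM\<^esub> = \<one>\<^bsub>MM\<^esub>"
  by (rule mat_extI) (auto simp: mtrans_closed mat_one_closed mtrans_nth mat_one_nth)

lemma adjoint_mv:
  assumes A: "A \<in> carrier GLd" and w: "w \<in> carrier M"
  shows "adjoint (mv A) w = mv (mtrans A) w"
proof (rule vec_eqI[OF adjoint_closed[OF lin_aut_mv[OF A] w] mv_closed[OF mtrans_closed[OF GL_closed[OF A]] w]])
  note Ac = GL_closed[OF A]
  fix i assume i: "i < d"
  have "form (mv A (unit_vec i)) w = (\<Oplus>j\<in>{..<d}. mtrans A (i, j) \<otimes> w j)"
    unfolding std_form_def by (intro finsum_cong') (use i Ac w in \<open>auto simp: mtrans_nth mv_unit_vec_nth[OF Ac]\<close>)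
  then show "adjoint (mv A) w i = mv (mtrans A) w i" using i by (simp add: adjoint_def mv_nth)
qed

abbreviation "contragredient A \<equiv> mtrans (inv\<^bsub>GLd\<^esub> A)"

lemma contragredient_GL:
  assumes A: "A \<in> carrier GLd"
  shows "contragredient A \<in> carrier GLd"
    and "mtrans A \<otimes>\<^bsub>MM\<^esub> contragredient A = \<one>\<^bsub>MM\<^esub>" and "contragredient A \<otimes>\<^bsub>MM\<^esub> mtrans A = \<one>\<^bsub>MM\<^esub>"
proof -
  note i = GL_inv[OF A]
  note Ac = GL_closed[OF A] and ic = GL_closed[OF i(1)]
  show 1: "mtrans A \<otimes>\<^bsub>MM\<^esub> contragredient A = \<one>\<^bsub>MM\<^esub>" and 2: "contragredient A \<otimes>\<^bsub>MM\<^esub> mtrans A = \<one>\<^bsub>MM\<^esub>"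
    using mtrans_mult[OF ic Ac] mtrans_mult[OF Ac ic] i mtrans_one by simp_all
  show "contragredient A \<in> carrier GLd"
    by (rule GL_I[OF mtrans_closed[OF ic] mtrans_closed[OF Ac] 2 1])
qed

lemma contragredient_mult:
  assumes A: "A \<in> carrier GLd" and B: "B \<in> carrier GLd"
  shows "contragredient (A \<otimes>\<^bsub>GLd\<^esub> B) = contragredient A \<otimes>\<^bsub>GLd\<^esub> contragredient B"
  using group.inv_mult_group[OF group_GL A B] mtrans_mult[OF GL_closed[OF GL_inv(1)[OF B]] GL_closed[OF GL_inv(1)[OF A]]]
  by (simp add: GL_mult)

section \<open>Scalar matrices and the projective linear group\<close>

definition scalar_mat :: "'a \<Rightarrow> nat \<times> nat \<Rightarrow> 'a" where
  "scalar_mat u = (\<lambda>(i, j)\<in>{..<d} \<times> {..<d}. if i = j then u else \<zero>)"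

lemma scalar_mat_nth: "i < d \<Longrightarrow> j < d \<Longrightarrow> scalar_mat u (i, j) = (if i = j then u else \<zero>)"
  by (simp add: scalar_mat_def)

lemma scalar_mats_eq: "scalar_mats S d = scalar_mat ` Units S"
  by (simp add: scalar_mats_def scalar_mat_def)

lemma scalar_mat_closed: "u \<in> carrier S \<Longrightarrow> scalar_mat u \<in> carrier MM"
  unfolding scalar_mat_def by (rule mat_closedI) simp

lemma mv_scalar_mat:
  assumes u: "u \<in> carrier S" and v: "v \<in> carrier M"
  shows "mv (scalar_mat u) v = u \<odot>\<^bsub>M\<^esub> v"
proof (rule linear_on_eqI[OF mv_linear_on[OF scalar_mat_closed[OF u]] _ _ v])
  show "linear_on (carrier M) (\<lambda>v. u \<odot>\<^bsub>M\<^esub> v)"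
    unfolding linear_on_def using u by (auto simp: vec.smult_r_distr vec.smult_assoc1[symmetric] m_comm)
  fix j assume j: "j < d"
  show "mv (scalar_mat u) (unit_vec j) = u \<odot>\<^bsub>M\<^esub> unit_vec j"
    by (rule vec_eqI[OF mv_closed[OF scalar_mat_closed[OF u] unit_vec_closed] vec.smult_closed[OF u unit_vec_closed]])
       (use u j in \<open>simp add: mv_unit_vec_nth[OF scalar_mat_closed[OF u]] scalar_mat_nth\<close>)
qed

lemma scalar_mat_mult:
  assumes "u \<in> carrier S" "v \<in> carrier S"
  shows "scalar_mat u \<otimes>\<^bsub>MM\<^esub> scalar_mat v = scalar_mat (u \<otimes> v)"
  by (rule mat_eqI) (use assms in \<open>simp_all add: mat_mult_closed scalar_mat_closed mv_mult mv_scalar_mat vec.smult_assoc1\<close>)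

lemma scalar_mat_one: "scalar_mat \<one> = \<one>\<^bsub>MM\<^esub>"
  by (simp add: scalar_mat_def mat_monoid_def)

lemma scalar_mat_commute:
  assumes "u \<in> carrier S" "A \<in> carrier MM"
  shows "scalar_mat u \<otimes>\<^bsub>MM\<^esub> A = A \<otimes>\<^bsub>MM\<^esub> scalar_mat u"
  by (rule mat_eqI) (use assms linear_on_smult[OF mv_linear_on[OF assms(2)]] in
    \<open>simp_all add: mat_mult_closed scalar_mat_closed mv_mult mv_scalar_mat mv_closed\<close>)

lemma scalar_mat_GL: "u \<in> Units S \<Longrightarrow> scalar_mat u \<in> carrier GLd"
  by (rule GL_I[of _ "scalar_mat (inv u)"]) (simp_all add: scalar_mat_closed scalar_mat_mult scalar_mat_one Units_closed)

lemma scalar_mat_inv: "u \<in> Units S \<Longrightarrow> inv\<^bsub>GLd\<^esub> scalar_mat u = scalar_mat (inv u)"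
  by (rule group.inv_equality[OF group_GL])
     (simp_all add: scalar_mat_GL GL_mult GL_one scalar_mat_mult scalar_mat_one Units_closed)

text \<open>Scalar matrices are central, so conjugation fixes each of them.\<close>

lemma scalar_mats_normal: "scalar_mats S d \<lhd> GLd"
  unfolding group.normal_inv_iff[OF group_GL]
proof (intro conjI ballI)
  show "subgroup (scalar_mats S d) GLd"
  proof (rule group.subgroupI[OF group_GL])
    show "scalar_mats S d \<subseteq> carrier GLd" using scalar_mat_GL by (auto simp: scalar_mats_eq)
    show "scalar_mats S d \<noteq> {}" by (auto simp: scalar_mats_eq)
    show "inv\<^bsub>GLd\<^esub> A \<in> scalar_mats S d" if "A \<in> scalar_mats S d" for A
      using that by (auto simp: scalar_mats_eq scalar_mat_inv)
    show "A \<otimes>\<^bsub>GLd\<^esub> B \<in> scalar_mats S d" if "A \<in> scalar_mats S d" "B \<in> scalar_mats S d" for A B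
      using that by (auto simp: scalar_mats_eq GL_mult scalar_mat_mult Units_closed)
  qed
  fix A h assume A: "A \<in> carrier GLd" and h: "h \<in> scalar_mats S d"
  then obtain u where u: "u \<in> Units S" "h = scalar_mat u" by (auto simp: scalar_mats_eq)
  have "A \<otimes>\<^bsub>GLd\<^esub> h = h \<otimes>\<^bsub>GLd\<^esub> A" using scalar_mat_commute[OF _ GL_closed[OF A]] u by (simp add: GL_mult Units_closed)
  then have "A \<otimes>\<^bsub>GLd\<^esub> h \<otimes>\<^bsub>GLd\<^esub> inv\<^bsub>GLd\<^esub> A = h"
    using A scalar_mat_GL[OF u(1)] u(2) group.inv_solve_right'[OF group_GL]
    by (simp add: group.inv_closed[OF group_GL] group.is_monoid[OF group_GL] monoid.m_assoc group.r_inv[OF group_GL])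
  then show "A \<otimes>\<^bsub>GLd\<^esub> h \<otimes>\<^bsub>GLd\<^esub> inv\<^bsub>GLd\<^esub> A \<in> scalar_mats S d" using h by simp
qed

abbreviation "coset A \<equiv> scalar_mats S d #>\<^bsub>GLd\<^esub> A"

lemma coset_eq: "coset A = (\<lambda>u. scalar_mat u \<otimes>\<^bsub>GLd\<^esub> A) ` Units S"
  by (auto simp: r_coset_def scalar_mats_eq)

lemma PGL_carrier: "carrier (PGL S d) = coset ` carrier GLd"
  by (auto simp: PGL_def FactGroup_def RCOSETS_def)

lemma PGL_mult: "A \<in> carrier GLd \<Longrightarrow> B \<in> carrier GLd \<Longrightarrow> coset A \<otimes>\<^bsub>PGL S d\<^esub> coset B = coset (A \<otimes>\<^bsub>GLd\<^esub> B)"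
  unfolding PGL_def FactGroup_def using normal.rcos_sum[OF scalar_mats_normal] by simp

lemma mem_coset_self: "A \<in> carrier GLd \<Longrightarrow> A \<in> coset A"
  using group.rcos_self[OF group_GL] scalar_mats_normal normal_imp_subgroup by metis

text \<open>A multiplicative map that permutes the scalar matrices sends cosets of them onto cosets.
  It is applied to the entrywise action, where \<open>e\<close> is \<tau>, and to the
  contragredient, where \<open>e\<close> is inversion.\<close>

lemma coset_image:
  assumes F: "\<And>A B. A \<in> carrier GLd \<Longrightarrow> B \<in> carrier GLd \<Longrightarrow> F (A \<otimes>\<^bsub>GLd\<^esub> B) = F A \<otimes>\<^bsub>GLd\<^esub> F B"
    and sc: "\<And>u. u \<in> Units S \<Longrightarrow> F (scalar_mat u) = scalar_mat (e u)" and e: "e ` Units S = Units S"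
    and A: "A \<in> carrier GLd"
  shows "F ` coset A = coset (F A)"
proof -
  have "F ` coset A = (\<lambda>u. F (scalar_mat u \<otimes>\<^bsub>GLd\<^esub> A)) ` Units S" unfolding coset_eq by (simp add: image_image)
  also have "\<dots> = (\<lambda>u. scalar_mat (e u) \<otimes>\<^bsub>GLd\<^esub> F A) ` Units S"
    by (rule image_cong) (simp_all add: F scalar_mat_GL A sc)
  also have "\<dots> = (\<lambda>u. scalar_mat u \<otimes>\<^bsub>GLd\<^esub> F A) ` (e ` Units S)" by (simp add: image_image)
  finally show ?thesis unfolding e coset_eq .
qed

lemma ring_Aut_inv:
  assumes \<tau>: "\<tau> \<in> carrier (ring_Aut S)"
  defines "\<rho> \<equiv> restrict (inv_into (carrier S) \<tau>) (carrier S)"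
  shows "\<rho> \<in> carrier (ring_Aut S)" "\<And>x. x \<in> carrier S \<Longrightarrow> \<tau> (\<rho> x) = x" "\<And>x. x \<in> carrier S \<Longrightarrow> \<rho> (\<tau> x) = x"
proof -
  note b = ring_Aut_bij[OF \<tau>]
  have b': "bij_betw \<rho> (carrier S) (carrier S)" unfolding \<rho>_def using bij_betw_inv_into[OF b] by simp
  show r: "\<tau> (\<rho> x) = x" if "x \<in> carrier S" for x
    unfolding \<rho>_def using bij_betw_inv_into_right[OF b that] that by simp
  show l: "\<rho> (\<tau> x) = x" if "x \<in> carrier S" for x
    unfolding \<rho>_def using bij_betw_inv_into_left[OF b that] ring_Aut_closed[OF \<tau> that] by simp
  have c: "\<rho> x \<in> carrier S" if "x \<in> carrier S" for x using bij_betwE[OF b'] that by simp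
  have "\<rho> \<in> ring_hom S S"
  proof (rule ring_hom_memI)
    fix x y assume x: "x \<in> carrier S" and y: "y \<in> carrier S"
    show "\<rho> (x \<otimes> y) = \<rho> x \<otimes> \<rho> y"
      using l[of "\<rho> x \<otimes> \<rho> y"] ring_Aut_mult[OF \<tau> c[OF x] c[OF y]] r x y c by simp
    show "\<rho> (x \<oplus> y) = \<rho> x \<oplus> \<rho> y"
      using l[of "\<rho> x \<oplus> \<rho> y"] ring_Aut_add[OF \<tau> c[OF x] c[OF y]] r x y c by simp
  qed (use l[of \<one>] ring_Aut_one[OF \<tau>] c in auto)
  then show "\<rho> \<in> carrier (ring_Aut S)" unfolding ring_Aut_iff using b' by (simp add: \<rho>_def)
qed

lemma ring_Aut_Units_image:
  assumes \<tau>: "\<tau> \<in> carrier (ring_Aut S)" shows "\<tau> ` Units S = Units S"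
proof (intro equalityI subsetI)
  fix u assume u: "u \<in> Units S"
  note i = ring_Aut_inv[OF \<tau>]
  show "u \<in> \<tau> ` Units S"
    using i(2)[OF Units_closed[OF u]] ring_Aut_Units[OF i(1) u] by (metis imageI)
qed (use ring_Aut_Units[OF \<tau>] in auto)

lemma mmap_coset:
  assumes \<tau>: "\<tau> \<in> carrier (ring_Aut S)" and A: "A \<in> carrier GLd"
  shows "mmap \<tau> ` coset A = coset (mmap \<tau> A)"
proof (rule coset_image[OF _ _ ring_Aut_Units_image[OF \<tau>] A])
  show "mmap \<tau> (A \<otimes>\<^bsub>GLd\<^esub> B) = mmap \<tau> A \<otimes>\<^bsub>GLd\<^esub> mmap \<tau> B" if "A \<in> carrier GLd" "B \<in> carrier GLd" for A B
    using mmap_mult[OF \<tau> GL_closed GL_closed] that by (simp add: GL_mult)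
  show "mmap \<tau> (scalar_mat u) = scalar_mat (\<tau> u)" if "u \<in> Units S" for u
    by (rule mat_extI) (use that in \<open>auto simp: mmap_closed[OF \<tau>] scalar_mat_closed Units_closed ring_Aut_closed[OF \<tau>]
        mmap_nth scalar_mat_nth ring_Aut_zero[OF \<tau>]\<close>)
qed

lemma contragredient_coset:
  assumes A: "A \<in> carrier GLd"
  shows "(\<lambda>B. contragredient B) ` coset A = coset (contragredient A)"
proof (rule coset_image[OF contragredient_mult _ _ A])
  show "contragredient (scalar_mat u) = scalar_mat (inv u)" if "u \<in> Units S" for u
    unfolding scalar_mat_inv[OF that]
    by (rule mat_extI) (use that in \<open>auto simp: mtrans_closed scalar_mat_closed Units_closed mtrans_nth scalar_mat_nth\<close>)
  show "m_inv S ` Units S = Units S"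
  proof (intro equalityI subsetI)
    fix u assume u: "u \<in> Units S"
    then show "u \<in> m_inv S ` Units S" by (intro image_eqI[of _ _ "inv u"]) auto
  qed auto
qed auto


section \<open>The automorphism groups\<close>

text \<open>Pairs of comparable vertices are cells, and cells are sets of pairwise comparable
  vertices, so cells and comparability determine each other. Every cell is attained because the
  inverse map preserves comparability too.\<close>

lemma flags_iff:
  assumes b: "bij_betw \<phi> verts verts"
  shows "(\<lambda>C. \<phi> ` C) ` fr_flags S d = fr_flags S d \<longleftrightarrow> comparability_aut \<phi>"
proof -
  have flag: "C \<in> fr_flags S d \<longleftrightarrow> C \<subseteq> verts \<and> (\<forall>V\<in>C. \<forall>W\<in>C. comparable V W)" for C
    by (auto simp: fr_flags_def comparable_def)
  have pair: "{V, W} \<in> fr_flags S d \<longleftrightarrow> comparable V W" if "V \<in> verts" "W \<in> verts" for V W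
    using that unfolding flag by (auto simp: comparable_def)
  have inj: "inj_on \<phi> verts" and im: "\<phi> ` verts = verts" using b by (auto simp: bij_betw_def)
  have c: "\<phi> V \<in> verts" if "V \<in> verts" for V using im that by blast
  show ?thesis
  proof
    assume eq: "(\<lambda>C. \<phi> ` C) ` fr_flags S d = fr_flags S d"
    have "comparable (\<phi> V) (\<phi> W) \<longleftrightarrow> comparable V W" if V: "V \<in> verts" and W: "W \<in> verts" for V W
    proof
      assume "comparable V W"
      then have "\<phi> ` {V, W} \<in> fr_flags S d" using eq pair[OF V W] by blast
      then show "comparable (\<phi> V) (\<phi> W)" using pair[OF c[OF V] c[OF W]] by simp
    next
      assume "comparable (\<phi> V) (\<phi> W)"
      then have "{\<phi> V, \<phi> W} \<in> (\<lambda>C. \<phi> ` C) ` fr_flags S d" using eq pair[OF c[OF V] c[OF W]] by simp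
      then obtain C where C: "C \<in> fr_flags S d" "\<phi> ` C = \<phi> ` {V, W}" by auto
      have "C \<subseteq> verts" using C(1) flag by blast
      then have "C = {V, W}" using inj_on_image_eq_iff[OF inj, of C "{V, W}"] C(2) V W by simp
      then show "comparable V W" using C(1) pair[OF V W] by simp
    qed
    then show "comparability_aut \<phi>" using b by (simp add: comparability_aut_def)
  next
    assume \<phi>: "comparability_aut \<phi>"
    have img: "\<psi> ` C \<in> fr_flags S d" if "comparability_aut \<psi>" "C \<in> fr_flags S d" for \<psi> C
      using that(2) comparability_aut_iff[OF that(1)] comparability_aut_closed[OF that(1)] unfolding flag by blast
    show "(\<lambda>C. \<phi> ` C) ` fr_flags S d = fr_flags S d"
    proof (intro equalityI subsetI)
      fix C assume C: "C \<in> fr_flags S d"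
      let ?D = "inv_into verts \<phi> ` C"
      have "\<phi> ` ?D = C"
        using C unfolding flag by (intro image_inv_into_cancel[OF im]) blast
      then show "C \<in> (\<lambda>C. \<phi> ` C) ` fr_flags S d"
        using img[OF comparability_aut_inv[OF \<phi>] C] by (intro image_eqI[of _ _ ?D]) simp_all
    qed (use img[OF \<phi>] in auto)
  qed
qed

lemma fr_Aut_carrier: "\<phi> \<in> carrier (fr_Aut S d) \<longleftrightarrow> \<phi> \<in> extensional verts \<and> comparability_aut \<phi>"
proof -
  have "bij_betw \<phi> verts verts" if "comparability_aut \<phi>" using comparability_aut_bij[OF that] .
  then show ?thesis
    using flags_iff[of \<phi>] by (auto simp: fr_Aut_def simplicial_Aut_def simplicial_auts_def Bij_def)
qed

text \<open>Between comparable vertices the one of smaller rank lies below, so preserving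
  comparability and color means preserving inclusion. Conversely, the color is an order invariant by
  \<open>rk_order_aut\<close>.\<close>

lemma fr_Aut0_carrier: "\<phi> \<in> carrier (fr_Aut0 S d) \<longleftrightarrow> \<phi> \<in> extensional verts \<and> order_aut \<phi>"
proof
  assume "\<phi> \<in> carrier (fr_Aut0 S d)"
  then have ext: "\<phi> \<in> extensional verts" and \<phi>: "comparability_aut \<phi>" and r: "\<And>V. V \<in> verts \<Longrightarrow> rk (\<phi> V) = rk V"
    by (auto simp: fr_Aut0_def fr_auts0_def fr_Aut_carrier)
  note c = comparability_aut_closed[OF \<phi>]
  have "\<phi> V \<subseteq> \<phi> W \<longleftrightarrow> V \<subseteq> W" if V: "V \<in> verts" and W: "W \<in> verts" for V W
  proof
    assume sub: "V \<subseteq> W"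
    have "comparable (\<phi> V) (\<phi> W)" using comparability_aut_iff[OF \<phi> V W] sub by (simp add: comparable_def)
    then show "\<phi> V \<subseteq> \<phi> W" using comparable_subsetI[OF c[OF V] c[OF W]] r V W rk_mono[OF V W sub] by simp
  next
    assume sub: "\<phi> V \<subseteq> \<phi> W"
    have "comparable V W" using comparability_aut_iff[OF \<phi> V W] sub by (simp add: comparable_def)
    then show "V \<subseteq> W" using comparable_subsetI[OF V W] r V W rk_mono[OF c[OF V] c[OF W] sub] by simp
  qed
  then show "\<phi> \<in> extensional verts \<and> order_aut \<phi>"
    using ext comparability_aut_bij[OF \<phi>] by (simp add: order_aut_def)
next
  assume "\<phi> \<in> extensional verts \<and> order_aut \<phi>"
  then show "\<phi> \<in> carrier (fr_Aut0 S d)"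
    using rk_order_aut order_aut_imp_comparability_aut by (auto simp: fr_Aut0_def fr_auts0_def fr_Aut_carrier)
qed

section \<open>The automorphism group and its involution\<close>

abbreviation "GA \<equiv> fr_Aut S d"

abbreviation "N0 \<equiv> carrier (fr_Aut0 S d)"

lemma GA_mult: "\<phi> \<in> carrier GA \<Longrightarrow> \<psi> \<in> carrier GA \<Longrightarrow> \<phi> \<otimes>\<^bsub>GA\<^esub> \<psi> = compose verts \<phi> \<psi>"
  by (auto simp: fr_Aut_def simplicial_Aut_def simplicial_auts_def BijGroup_def)

lemma GA_one: "\<one>\<^bsub>GA\<^esub> = (\<lambda>V\<in>verts. V)"
  by (simp add: fr_Aut_def simplicial_Aut_def BijGroup_def)

lemma comparability_aut_cong:
  assumes "comparability_aut \<phi>" "\<And>V. V \<in> verts \<Longrightarrow> \<phi> V = \<psi> V" shows "comparability_aut \<psi>"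
  using assms(1) bij_betw_cong[of verts \<phi> \<psi> verts] assms(2) unfolding comparability_aut_def by auto

lemma order_aut_id: "order_aut (\<lambda>V. V)"
  by (auto simp: order_aut_def bij_betw_def)

text \<open>Order automorphisms are handled as plain functions, and made extensional only on
  entering the group.\<close>

lemma restrict_in_N0: "order_aut \<phi> \<Longrightarrow> restrict \<phi> verts \<in> N0"
  unfolding fr_Aut0_carrier by (auto intro: order_aut_cong)

lemma restrict_in_GA: "comparability_aut \<phi> \<Longrightarrow> restrict \<phi> verts \<in> carrier GA"
  unfolding fr_Aut_carrier by (auto intro: comparability_aut_cong)

lemma N0_subset: "N0 \<subseteq> carrier GA"
  using order_aut_imp_comparability_aut by (auto simp: fr_Aut0_carrier fr_Aut_carrier)

lemma GA_comp_closed: "\<phi> \<in> carrier GA \<Longrightarrow> \<psi> \<in> carrier GA \<Longrightarrow> compose verts \<phi> \<psi> \<in> carrier GA"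
  using restrict_in_GA[OF comparability_aut_comp] by (auto simp: fr_Aut_carrier compose_def comp_def)

lemma N0_comp_closed: "\<phi> \<in> N0 \<Longrightarrow> \<psi> \<in> N0 \<Longrightarrow> compose verts \<phi> \<psi> \<in> N0"
  using restrict_in_N0[OF order_aut_comp] by (auto simp: fr_Aut0_carrier compose_def comp_def)

lemma GA_closed: "\<phi> \<in> carrier GA \<Longrightarrow> V \<in> verts \<Longrightarrow> \<phi> V \<in> verts"
  using comparability_aut_closed by (auto simp: fr_Aut_carrier)

lemma GA_eqI:
  "\<phi> \<in> carrier GA \<Longrightarrow> \<psi> \<in> carrier GA \<Longrightarrow> (\<And>V. V \<in> verts \<Longrightarrow> \<phi> V = \<psi> V) \<Longrightarrow> \<phi> = \<psi>"
  by (auto simp: fr_Aut_carrier intro: extensionalityI)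

lemma GA_left_inverse:
  assumes \<phi>: "\<phi> \<in> carrier GA"
  shows "restrict (inv_into verts \<phi>) verts \<otimes>\<^bsub>GA\<^esub> \<phi> = \<one>\<^bsub>GA\<^esub>" "restrict (inv_into verts \<phi>) verts \<in> carrier GA"
proof -
  have c: "comparability_aut \<phi>" using \<phi> by (simp add: fr_Aut_carrier)
  show i: "restrict (inv_into verts \<phi>) verts \<in> carrier GA" by (rule restrict_in_GA[OF comparability_aut_inv[OF c]])
  show "restrict (inv_into verts \<phi>) verts \<otimes>\<^bsub>GA\<^esub> \<phi> = \<one>\<^bsub>GA\<^esub>"
    unfolding GA_mult[OF i \<phi>] GA_one compose_def
    using GA_closed[OF \<phi>] bij_betw_inv_into_left[OF comparability_aut_bij[OF c]] by (auto intro: restrict_ext)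
qed

lemma GA_one_closed: "\<one>\<^bsub>GA\<^esub> \<in> carrier GA"
  using restrict_in_N0[OF order_aut_id] N0_subset unfolding GA_one by blast

lemma group_GA: "group GA"
proof (rule groupI)
  fix \<phi> \<psi> \<chi> assume c: "\<phi> \<in> carrier GA" "\<psi> \<in> carrier GA" "\<chi> \<in> carrier GA"
  show "\<phi> \<otimes>\<^bsub>GA\<^esub> \<psi> \<otimes>\<^bsub>GA\<^esub> \<chi> = \<phi> \<otimes>\<^bsub>GA\<^esub> (\<psi> \<otimes>\<^bsub>GA\<^esub> \<chi>)"
    using c by (simp add: GA_mult GA_comp_closed) (auto simp: compose_def GA_closed intro: restrict_ext)
next
  fix \<phi> assume c: "\<phi> \<in> carrier GA"
  show "\<one>\<^bsub>GA\<^esub> \<otimes>\<^bsub>GA\<^esub> \<phi> = \<phi>"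
    unfolding GA_mult[OF GA_one_closed c]
    by (rule GA_eqI[OF GA_comp_closed[OF GA_one_closed c] c]) (simp add: compose_def GA_one GA_closed[OF c])
  show "\<exists>\<psi>\<in>carrier GA. \<psi> \<otimes>\<^bsub>GA\<^esub> \<phi> = \<one>\<^bsub>GA\<^esub>" using GA_left_inverse[OF c] by blast
qed (auto simp: GA_mult GA_comp_closed GA_one_closed)

lemma GA_inv: "\<phi> \<in> carrier GA \<Longrightarrow> inv\<^bsub>GA\<^esub> \<phi> = restrict (inv_into verts \<phi>) verts"
  using group.inv_equality[OF group_GA GA_left_inverse(1)] GA_left_inverse(2) by blast

lemma N0_subgroup: "subgroup N0 GA"
proof (rule group.subgroupI[OF group_GA N0_subset])
  show "N0 \<noteq> {}" using restrict_in_N0[OF order_aut_id] by blast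
  show "inv\<^bsub>GA\<^esub> \<phi> \<in> N0" if "\<phi> \<in> N0" for \<phi>
    using that N0_subset restrict_in_N0[OF order_aut_inv] GA_inv by (auto simp: fr_Aut0_carrier subset_iff)
  show "\<phi> \<otimes>\<^bsub>GA\<^esub> \<psi> \<in> N0" if "\<phi> \<in> N0" "\<psi> \<in> N0" for \<phi> \<psi>
    using N0_comp_closed[OF that] that N0_subset GA_mult by (simp add: subset_iff)
qed

abbreviation "PP \<equiv> phi_perp S d"

lemma PP_apply: "V \<in> verts \<Longrightarrow> PP V = perp V"
  by (simp add: phi_perp_def perp_def)

lemma PP_eq: "PP = restrict perp verts"
  unfolding phi_perp_def by (rule restrict_ext) (simp add: perp_def)

lemma PP_closed: "PP \<in> carrier GA"
  unfolding PP_eq by (rule restrict_in_GA[OF comparability_aut_perp])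

lemma PP_PP: "PP \<otimes>\<^bsub>GA\<^esub> PP = \<one>\<^bsub>GA\<^esub>"
  unfolding GA_mult[OF PP_closed PP_closed] GA_one
  by (auto simp: compose_def PP_apply perp_vertex perp_perp intro: restrict_ext)

lemma PP_notin_N0: "PP \<notin> N0"
proof
  assume "PP \<in> N0"
  then have \<phi>: "order_aut PP" by (simp add: fr_Aut0_carrier)
  have e: "unimodular (unit_vec 0)" using unimodular_unit_vec[of 0] d_ge_3 by simp
  note L = line_vertex[OF e]
  have "rk (PP (line (unit_vec 0))) = 1" using rk_order_aut[OF \<phi> L] rk_line[OF e] by simp
  then show False using rk_perp[OF L] rk_line[OF e] d_ge_3 by (simp add: PP_apply[OF L])
qed

text \<open>Complementation reverses inclusion, and the reversals on the two sides of an order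
  automorphism cancel.\<close>

lemma PP_conj:
  assumes \<phi>: "\<phi> \<in> N0" shows "PP \<otimes>\<^bsub>GA\<^esub> \<phi> \<otimes>\<^bsub>GA\<^esub> PP \<in> N0"
proof -
  have \<phi>G: "\<phi> \<in> carrier GA" and o: "order_aut \<phi>" using \<phi> N0_subset by (auto simp: fr_Aut0_carrier)
  have "order_aut (perp \<circ> (\<phi> \<circ> perp))"
    unfolding order_aut_def
  proof (intro conjI ballI)
    show "bij_betw (perp \<circ> (\<phi> \<circ> perp)) verts verts"
      using bij_betw_trans[OF bij_betw_trans[OF perp_bij order_aut_bij[OF o]] perp_bij] .
    show "(perp \<circ> (\<phi> \<circ> perp)) V \<subseteq> (perp \<circ> (\<phi> \<circ> perp)) W \<longleftrightarrow> V \<subseteq> W" if "V \<in> verts" "W \<in> verts" for V W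
      using that by (simp add: perp_subset_iff order_aut_subset_iff[OF o] order_aut_closed[OF o] perp_vertex)
  qed
  then have "restrict (perp \<circ> (\<phi> \<circ> perp)) verts \<in> N0" by (rule restrict_in_N0)
  moreover have "PP \<otimes>\<^bsub>GA\<^esub> \<phi> \<otimes>\<^bsub>GA\<^esub> PP = restrict (perp \<circ> (\<phi> \<circ> perp)) verts"
    using PP_closed \<phi>G by (simp add: GA_mult GA_comp_closed)
      (auto simp: compose_def PP_apply perp_vertex order_aut_closed[OF o] intro: restrict_ext)
  ultimately show ?thesis by simp
qed

lemma GA_cases:
  assumes \<phi>: "\<phi> \<in> carrier GA"
  shows "\<phi> \<in> N0 \<or> \<phi> \<otimes>\<^bsub>GA\<^esub> PP \<in> N0"
proof -
  have ext: "\<phi> \<in> extensional verts" and c: "comparability_aut \<phi>" using \<phi> by (auto simp: fr_Aut_carrier)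
  show ?thesis
  proof (cases "order_aut \<phi>")
    case False
    then have "order_aut (perp \<circ> \<phi>)" using comparability_aut_cases[OF c] by blast
    then have "restrict (perp \<circ> \<phi>) verts \<in> N0" by (rule restrict_in_N0)
    moreover have "PP \<otimes>\<^bsub>GA\<^esub> \<phi> = restrict (perp \<circ> \<phi>) verts"
      unfolding GA_mult[OF PP_closed \<phi>] by (auto simp: compose_def PP_apply GA_closed[OF \<phi>] intro: restrict_ext)
    \<comment> \<open>The case distinction provides \<open>PP\<close> as a left factor; conjugation
      by \<open>PP\<close> moves it to the right.\<close>
    ultimately have "PP \<otimes>\<^bsub>GA\<^esub> (PP \<otimes>\<^bsub>GA\<^esub> \<phi>) \<otimes>\<^bsub>GA\<^esub> PP \<in> N0" using PP_conj by simp
    moreover have "PP \<otimes>\<^bsub>GA\<^esub> (PP \<otimes>\<^bsub>GA\<^esub> \<phi>) = \<phi>"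
      using monoid.m_assoc[OF group.is_monoid[OF group_GA] PP_closed PP_closed \<phi>] PP_PP
        monoid.l_one[OF group.is_monoid[OF group_GA] \<phi>] by simp
    ultimately show ?thesis by simp
  qed (use ext in \<open>simp add: fr_Aut0_carrier\<close>)
qed

lemma generate_PP: "generate GA {PP} = {\<one>\<^bsub>GA\<^esub>, PP}"
proof (intro equalityI subsetI)
  note mon = group.is_monoid[OF group_GA]
  have inv: "inv\<^bsub>GA\<^esub> PP = PP" by (rule group.inv_equality[OF group_GA PP_PP PP_closed PP_closed])
  fix x assume "x \<in> generate GA {PP}"
  then show "x \<in> {\<one>\<^bsub>GA\<^esub>, PP}"
    by (induction rule: generate.induct)
       (auto simp: inv PP_PP monoid.l_one[OF mon PP_closed] monoid.r_one[OF mon PP_closed] monoid.l_one[OF mon GA_one_closed])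
qed (auto intro: generate.one generate.incl)

lemma internal_semidirect:
  "is_internal_semidirect GA N0 (generate GA {PP})"
  unfolding is_internal_semidirect_def
proof (intro conjI)
  interpret G: group GA by (rule group_GA)
  show "N0 \<lhd> GA"
    unfolding G.normal_inv_iff
  proof (intro conjI N0_subgroup ballI)
    fix x h assume x: "x \<in> carrier GA" and h: "h \<in> N0"
    have hc: "h \<in> carrier GA" using h N0_subset by blast
    from GA_cases[OF x] show "x \<otimes>\<^bsub>GA\<^esub> h \<otimes>\<^bsub>GA\<^esub> inv\<^bsub>GA\<^esub> x \<in> N0"
    proof
      assume "x \<in> N0"
      then show ?thesis using h subgroup.m_closed[OF N0_subgroup] subgroup.m_inv_closed[OF N0_subgroup] by blast
    next
      \<comment> \<open>Since \<open>x\<close> is the product of \<open>?y\<close> and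
        \<open>PP\<close>, conjugating \<open>h\<close> by \<open>x\<close> amounts to conjugating
        \<open>?k\<close> by \<open>?y\<close>, and both of these lie in \<open>N0\<close>.\<close>
      let ?y = "x \<otimes>\<^bsub>GA\<^esub> PP" and ?k = "PP \<otimes>\<^bsub>GA\<^esub> h \<otimes>\<^bsub>GA\<^esub> PP"
      assume y: "?y \<in> N0"
      have inv: "inv\<^bsub>GA\<^esub> PP = PP" by (rule G.inv_equality[OF PP_PP PP_closed PP_closed])
      have PPl: "PP \<otimes>\<^bsub>GA\<^esub> (PP \<otimes>\<^bsub>GA\<^esub> z) = z" if "z \<in> carrier GA" for z
        using G.m_assoc[OF PP_closed PP_closed that] PP_PP that by simp
      have "?y \<otimes>\<^bsub>GA\<^esub> ?k \<otimes>\<^bsub>GA\<^esub> inv\<^bsub>GA\<^esub> ?y \<in> N0"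
        using y PP_conj[OF h] subgroup.m_closed[OF N0_subgroup] subgroup.m_inv_closed[OF N0_subgroup] by blast
      moreover have "?y \<otimes>\<^bsub>GA\<^esub> ?k \<otimes>\<^bsub>GA\<^esub> inv\<^bsub>GA\<^esub> ?y = x \<otimes>\<^bsub>GA\<^esub> h \<otimes>\<^bsub>GA\<^esub> inv\<^bsub>GA\<^esub> x"
        using x hc PP_closed by (simp add: G.inv_mult_group inv G.m_assoc PPl)
      ultimately show ?thesis by simp
    qed
  qed
  show "subgroup (generate GA {PP}) GA" using G.generate_is_subgroup PP_closed by simp
  show "N0 \<inter> generate GA {PP} = {\<one>\<^bsub>GA\<^esub>}"
    unfolding generate_PP using PP_notin_N0 subgroup.one_closed[OF N0_subgroup] by auto
  show "N0 <#>\<^bsub>GA\<^esub> generate GA {PP} = carrier GA"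
  proof (intro equalityI subsetI)
    fix x assume x: "x \<in> carrier GA"
    from GA_cases[OF x] show "x \<in> N0 <#>\<^bsub>GA\<^esub> generate GA {PP}"
    proof
      assume "x \<in> N0"
      then have "x \<otimes>\<^bsub>GA\<^esub> \<one>\<^bsub>GA\<^esub> \<in> N0 <#>\<^bsub>GA\<^esub> generate GA {PP}" unfolding generate_PP set_mult_def by blast
      then show ?thesis using x by simp
    next
      assume "x \<otimes>\<^bsub>GA\<^esub> PP \<in> N0"
      then have "x \<otimes>\<^bsub>GA\<^esub> PP \<otimes>\<^bsub>GA\<^esub> PP \<in> N0 <#>\<^bsub>GA\<^esub> generate GA {PP}" unfolding generate_PP set_mult_def by blast
      then show ?thesis using x PP_closed by (simp add: G.m_assoc PP_PP)
    qed
  next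
    fix x assume "x \<in> N0 <#>\<^bsub>GA\<^esub> generate GA {PP}"
    then show "x \<in> carrier GA" unfolding generate_PP set_mult_def using N0_subset PP_closed by auto
  qed
qed


section \<open>Color-preserving automorphisms as semilinear maps\<close>

abbreviation "phi \<equiv> phi_semilinear S d"

definition act :: "(nat \<times> nat \<Rightarrow> 'a) \<Rightarrow> ('a \<Rightarrow> 'a) \<Rightarrow> (nat \<Rightarrow> 'a) \<Rightarrow> nat \<Rightarrow> 'a" where
  "act A \<tau> v = mv A (vmap \<tau> v)"

lemma phi_apply: "V \<in> verts \<Longrightarrow> phi A \<tau> V = act A \<tau> ` V"
  by (simp add: phi_semilinear_def act_def)

lemma semilinear_act:
  assumes A: "A \<in> carrier GLd" and \<tau>: "\<tau> \<in> carrier (ring_Aut S)"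
  shows "semilinear \<tau> (act A \<tau>)"
proof -
  have "semilinear \<tau> (mv A \<circ> vmap \<tau>)"
    using semilinear_comp[OF lin_aut_mv[OF A] semilinear_vmap[OF \<tau>]] ring_Aut_closed[OF \<tau>] by simp
  then show ?thesis unfolding act_def[abs_def] comp_def .
qed

lemma semilinear_order_aut:
  assumes \<tau>: "\<tau> \<in> carrier (ring_Aut S)" and f: "semilinear \<tau> f"
  shows "order_aut (\<lambda>V. f ` V)"
proof -
  have sub: "V \<subseteq> carrier M" if "V \<in> verts" for V using subspace_closed[OF vertex_subspace[OF that]] by blast
  have im: "h ` V \<in> verts" if "\<rho> \<in> carrier (ring_Aut S)" "semilinear \<rho> h" "V \<in> verts" for \<rho> h V
    using vertexI[OF semilinear_subspace[OF that(1,2) vertex_subspace[OF that(3)]]] rk_pos rk_less that(3) by simp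
  note \<rho> = ring_Aut_inv[OF \<tau>]
  have g: "semilinear (restrict (inv_into (carrier S) \<tau>) (carrier S)) (inv_on_vecs f)"
    by (rule semilinear_inv[OF f]) (use \<rho>(2) ring_Aut_closed[OF \<rho>(1)] in blast)
  have fg: "f ` inv_on_vecs f ` V = V" if "V \<in> verts" for V
    using inv_on_vecs_right[OF f] sub[OF that] by (force simp: image_image)
  have gf: "inv_on_vecs f ` f ` V = V" if "V \<in> verts" for V
    using inv_on_vecs_left[OF f] sub[OF that] by (force simp: image_image)
  have "bij_betw (\<lambda>V. f ` V) verts verts"
    by (rule bij_betw_byWitness[where f' = "\<lambda>V. inv_on_vecs f ` V"]) (use fg gf im[OF \<tau> f] im[OF \<rho>(1) g] in auto)
  moreover have "f ` V \<subseteq> f ` W \<longleftrightarrow> V \<subseteq> W" if "V \<in> verts" "W \<in> verts" for V W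
  proof
    assume "f ` V \<subseteq> f ` W"
    then have "inv_on_vecs f ` f ` V \<subseteq> inv_on_vecs f ` f ` W" by (rule image_mono)
    then show "V \<subseteq> W" using gf that by simp
  qed (rule image_mono)
  ultimately show ?thesis by (simp add: order_aut_def)
qed

lemma phi_in_N0: "A \<in> carrier GLd \<Longrightarrow> \<tau> \<in> carrier (ring_Aut S) \<Longrightarrow> phi A \<tau> \<in> N0"
  using restrict_in_N0[OF semilinear_order_aut[OF _ semilinear_act]] by (simp add: phi_semilinear_def act_def)

lemma N0_phi:
  assumes \<phi>: "\<phi> \<in> N0"
  shows "\<exists>A\<in>carrier GLd. \<exists>\<tau>\<in>carrier (ring_Aut S). \<phi> = phi A \<tau>"
proof -
  have o: "order_aut \<phi>" and ext: "\<phi> \<in> extensional verts" using \<phi> by (auto simp: fr_Aut0_carrier)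
  obtain a where a: "\<And>i. i < d \<Longrightarrow> unimodular (a i) \<and> \<phi> (line (unit_vec i)) = line (a i)"
    and a0: "\<And>i. 0 < i \<Longrightarrow> i < d \<Longrightarrow> \<phi> (line (unit_vec 0 \<oplus>\<^bsub>M\<^esub> unit_vec i)) = line (a 0 \<oplus>\<^bsub>M\<^esub> a i)"
    using exists_frame[OF o] by blast
  obtain g where g: "lin_aut g" "\<And>i. i < d \<Longrightarrow> g (unit_vec i) = a i"
    using exists_lin_aut_frame[OF o a order_refl] by blast
  let ?h = "inv_on_vecs g"
  note h = lin_aut_inv[OF g(1)]
  \<comment> \<open>\<open>semilinear_order_aut\<close> asks for an element of
    \<open>ring_Aut\<close>, which must be extensional; so the linear map \<open>?h\<close> is
    regarded as semilinear for the restricted identity.\<close>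
  have idA: "(\<lambda>x\<in>carrier S. x) \<in> carrier (ring_Aut S)"
    unfolding ring_Aut_iff by (auto simp: ring_hom_def bij_betw_def inj_on_def)
  have h': "semilinear (\<lambda>x\<in>carrier S. x) ?h" by (rule semilinear_cong[OF h]) simp
  \<comment> \<open>Undoing the linear map that realizes the images of the frame points leaves an
    automorphism that fixes the frame, hence a coordinatewise ring automorphism.\<close>
  let ?\<psi> = "\<lambda>V. ?h ` \<phi> V"
  have o': "order_aut ?\<psi>"
    using order_aut_comp[OF semilinear_order_aut[OF idA h'] o] by (simp add: comp_def)
  have d0: "0 < d" using d_ge_3 by simp
  have hl: "?h ` line (g v) = line v" if "v \<in> carrier M" for v
    using line_image[OF h semilinear_closed[OF g(1) that]] inv_on_vecs_left[OF g(1) that] by simp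
  have "fixes_frame ?\<psi>"
    unfolding fixes_frame_def
  proof (intro conjI allI impI o')
    fix i assume i: "i < d"
    show "?h ` \<phi> (line (unit_vec i)) = line (unit_vec i)"
      using a[OF i] g(2)[OF i] hl[OF unit_vec_closed, of i] by simp
    assume i0: "0 < i"
    show "?h ` \<phi> (line (unit_vec 0 \<oplus>\<^bsub>M\<^esub> unit_vec i)) = line (unit_vec 0 \<oplus>\<^bsub>M\<^esub> unit_vec i)"
      using a0[OF i0 i] g(2)[OF i] g(2)[OF d0] hl[of "unit_vec 0 \<oplus>\<^bsub>M\<^esub> unit_vec i"] semilinear_add[OF g(1)] by simp
  qed
  note \<psi> = this
  let ?\<tau> = "frame_ring_aut ?\<psi>"
  note \<tau> = frame_ring_aut_in_ring_Aut[OF \<psi>]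
  have "\<phi> V = phi (mat_of g) ?\<tau> V" if V: "V \<in> verts" for V
  proof -
    have Vc: "V \<subseteq> carrier M" using subspace_closed[OF vertex_subspace[OF V]] by blast
    have "\<phi> V \<subseteq> carrier M" using subspace_closed[OF vertex_subspace[OF order_aut_closed[OF o V]]] by blast
    then have "\<phi> V = g ` ?h ` \<phi> V" using inv_on_vecs_right[OF g(1)] by (force simp: image_image)
    also have "\<dots> = g ` vmap ?\<tau> ` V" using fixes_frame_eq_vmap[OF \<psi> V] by simp
    also have "\<dots> = act (mat_of g) ?\<tau> ` V"
      unfolding image_image act_def
      by (rule image_cong) (use mv_mat_of[OF g(1)] vmap_closed[OF \<tau>] Vc in auto)
    finally show ?thesis using phi_apply[OF V] by simp
  qed
  then have "\<phi> = phi (mat_of g) ?\<tau>"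
    using ext by (intro extensionalityI[of \<phi> verts]) (auto simp: phi_semilinear_def)
  then show ?thesis using mat_of_GL[OF g(1)] \<tau> by blast
qed

text \<open>Moving \<tau> past \<open>B\<close> applies it to the entries of \<open>B\<close>
  (\<open>vmap_mv\<close>), which is the twist in the semidirect product.\<close>

lemma phi_mult:
  assumes A: "A \<in> carrier GLd" and \<tau>: "\<tau> \<in> carrier (ring_Aut S)"
    and B: "B \<in> carrier GLd" and \<rho>: "\<rho> \<in> carrier (ring_Aut S)"
  shows "phi A \<tau> \<otimes>\<^bsub>GA\<^esub> phi B \<rho> = phi (A \<otimes>\<^bsub>GLd\<^esub> mmap \<tau> B) (\<tau> \<otimes>\<^bsub>ring_Aut S\<^esub> \<rho>)"
    and "\<tau> \<otimes>\<^bsub>ring_Aut S\<^esub> \<rho> \<in> carrier (ring_Aut S)"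
proof -
  have Bij: "\<tau> \<in> Bij (carrier S)" "\<rho> \<in> Bij (carrier S)" using \<tau> \<rho> by (auto simp: ring_Aut_def)
  have m: "\<tau> \<otimes>\<^bsub>ring_Aut S\<^esub> \<rho> = compose (carrier S) \<tau> \<rho>" using Bij by (simp add: ring_Aut_def BijGroup_def)
  show c: "\<tau> \<otimes>\<^bsub>ring_Aut S\<^esub> \<rho> \<in> carrier (ring_Aut S)"
  proof -
    have "compose (carrier S) \<tau> \<rho> \<in> ring_hom S S"
      by (rule ring_hom_memI)
         (use \<tau> \<rho> in \<open>auto simp: compose_def ring_Aut_closed ring_Aut_mult ring_Aut_add ring_Aut_one\<close>)
    then show ?thesis unfolding m using compose_Bij[OF Bij] by (simp add: ring_Aut_def)
  qed
  note AB = group.is_monoid[OF group_GL, THEN monoid.m_closed, OF A mmap_GL[OF \<tau> B]]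
  have pG: "phi A \<tau> \<in> carrier GA" "phi B \<rho> \<in> carrier GA" using phi_in_N0[OF A \<tau>] phi_in_N0[OF B \<rho>] N0_subset by auto
  show "phi A \<tau> \<otimes>\<^bsub>GA\<^esub> phi B \<rho> = phi (A \<otimes>\<^bsub>GLd\<^esub> mmap \<tau> B) (\<tau> \<otimes>\<^bsub>ring_Aut S\<^esub> \<rho>)"
    unfolding GA_mult[OF pG]
  proof (rule GA_eqI[OF GA_comp_closed[OF pG]])
    show "phi (A \<otimes>\<^bsub>GLd\<^esub> mmap \<tau> B) (\<tau> \<otimes>\<^bsub>ring_Aut S\<^esub> \<rho>) \<in> carrier GA" using phi_in_N0[OF AB c] N0_subset by blast
    fix V assume V: "V \<in> verts"
    have Vc: "V \<subseteq> carrier M" using subspace_closed[OF vertex_subspace[OF V]] by blast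
    have "act A \<tau> (act B \<rho> v) = act (A \<otimes>\<^bsub>GLd\<^esub> mmap \<tau> B) (\<tau> \<otimes>\<^bsub>ring_Aut S\<^esub> \<rho>) v" if v: "v \<in> carrier M" for v
    proof -
      have "vmap (\<tau> \<otimes>\<^bsub>ring_Aut S\<^esub> \<rho>) v = vmap \<tau> (vmap \<rho> v)"
        by (rule vec_eqI[OF vmap_closed[OF c v] vmap_closed[OF \<tau> vmap_closed[OF \<rho> v]]])
           (use v in \<open>simp add: m compose_def\<close>)
      then show ?thesis
        unfolding act_def GL_mult
        using vmap_mv[OF \<tau> GL_closed[OF B] vmap_closed[OF \<rho> v]]
          mv_mult[OF GL_closed[OF A] mmap_closed[OF \<tau> GL_closed[OF B]] vmap_closed[OF \<tau> vmap_closed[OF \<rho> v]]] by simp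
    qed
    then have "act A \<tau> ` act B \<rho> ` V = act (A \<otimes>\<^bsub>GLd\<^esub> mmap \<tau> B) (\<tau> \<otimes>\<^bsub>ring_Aut S\<^esub> \<rho>) ` V"
      unfolding image_image using Vc by (intro image_cong) auto
    then show "compose verts (phi A \<tau>) (phi B \<rho>) V = phi (A \<otimes>\<^bsub>GLd\<^esub> mmap \<tau> B) (\<tau> \<otimes>\<^bsub>ring_Aut S\<^esub> \<rho>) V"
      using phi_apply[OF V] phi_apply[OF GA_closed[OF pG(2) V]] V by (simp add: compose_def)
  qed
qed

text \<open>Multiplication by a unit maps every submodule onto itself, so a scalar factor of the
  matrix is invisible on vertices.\<close>

lemma phi_coset:
  assumes A: "A \<in> carrier GLd" and \<tau>: "\<tau> \<in> carrier (ring_Aut S)" and B: "B \<in> coset A"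
  shows "phi B \<tau> = phi A \<tau>"
proof -
  obtain u where u: "u \<in> Units S" "B = scalar_mat u \<otimes>\<^bsub>MM\<^esub> A" using B by (auto simp: coset_eq GL_mult)
  note uc = Units_closed[OF u(1)]
  have ac: "act B \<tau> v = u \<odot>\<^bsub>M\<^esub> act A \<tau> v" if "v \<in> carrier M" for v
    unfolding act_def u(2)
    using mv_mult[OF scalar_mat_closed[OF uc] GL_closed[OF A] vmap_closed[OF \<tau> that]]
      mv_scalar_mat[OF uc mv_closed[OF GL_closed[OF A] vmap_closed[OF \<tau> that]]] by simp
  have "act B \<tau> ` V = act A \<tau> ` V" if V: "V \<in> verts" for V
  proof -
    have Vc: "V \<subseteq> carrier M" using subspace_closed[OF vertex_subspace[OF V]] by blast
    note W = semilinear_subspace[OF \<tau> semilinear_act[OF A \<tau>] vertex_subspace[OF V]]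
    have "act B \<tau> ` V = (\<lambda>w. u \<odot>\<^bsub>M\<^esub> w) ` act A \<tau> ` V"
      unfolding image_image by (rule image_cong) (use ac Vc in auto)
    also have "\<dots> = act A \<tau> ` V"
    proof (intro equalityI subsetI)
      fix w assume w: "w \<in> act A \<tau> ` V"
      have "w = u \<odot>\<^bsub>M\<^esub> (inv u \<odot>\<^bsub>M\<^esub> w)"
        using subspace_closed[OF W w] u(1) uc by (simp add: vec.smult_assoc1[symmetric])
      moreover have "inv u \<odot>\<^bsub>M\<^esub> w \<in> act A \<tau> ` V" using subspace_smult[OF W _ w] u(1) by simp
      ultimately show "w \<in> (\<lambda>w. u \<odot>\<^bsub>M\<^esub> w) ` act A \<tau> ` V" by (rule image_eqI)
    next
      fix w assume "w \<in> (\<lambda>w. u \<odot>\<^bsub>M\<^esub> w) ` act A \<tau> ` V"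
      then show "w \<in> act A \<tau> ` V" using subspace_smult[OF W uc] by blast
    qed
    finally show ?thesis .
  qed
  then show ?thesis unfolding phi_semilinear_def act_def[symmetric] by (intro restrict_ext)
qed

text \<open>Fixing the points e_i gives h(e_i) = c_i e_i, and fixing e_0 + x e_i then gives
  \<rho>(x) c_i = c_0 x. At x = 1 this makes all c_i equal, and cancelling the unit c_0 leaves
  \<rho>(x) = x. This computes the kernel of the action on points.\<close>

lemma semilinear_fixing_lines:
  assumes h: "semilinear \<rho> h" and \<rho>: "\<rho> \<in> carrier S \<rightarrow> carrier S"
    and fixl: "\<And>v. unimodular v \<Longrightarrow> h ` line v = line v"
  obtains c where "c \<in> Units S" "\<And>v. v \<in> carrier M \<Longrightarrow> h v = c \<odot>\<^bsub>M\<^esub> v" "\<And>x. x \<in> carrier S \<Longrightarrow> \<rho> x = x"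
proof -
  have d: "0 < d" "1 < d" using d_ge_3 by auto
  have mem: "h v \<in> line v" if "unimodular v" for v
    using fixl[OF that] line_self[OF unimodular_closed[OF that]] by blast
  have "\<exists>c. c \<in> carrier S \<and> h (unit_vec i) = c \<odot>\<^bsub>M\<^esub> unit_vec i" if "i < d" for i
    using mem[OF unimodular_unit_vec[OF that]] by (auto simp: line_def)
  then obtain c where c: "\<And>i. i < d \<Longrightarrow> c i \<in> carrier S \<and> h (unit_vec i) = c i \<odot>\<^bsub>M\<^esub> unit_vec i" by metis
  have key: "\<rho> x \<otimes> c i = c 0 \<otimes> x" if i: "0 < i" "i < d" and x: "x \<in> carrier S" for i x
  proof -
    obtain b where b: "b \<in> carrier S" "h (axis i x) = b \<odot>\<^bsub>M\<^esub> axis i x"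
      using mem[OF axis_unimodular[OF i x]] by (auto simp: line_def)
    have \<rho>x: "\<rho> x \<in> carrier S" using \<rho> x by auto
    have "h (axis i x) = c 0 \<odot>\<^bsub>M\<^esub> unit_vec 0 \<oplus>\<^bsub>M\<^esub> \<rho> x \<odot>\<^bsub>M\<^esub> (c i \<odot>\<^bsub>M\<^esub> unit_vec i)"
      using semilinear_add[OF h] semilinear_smult[OF h x] c[OF d(1)] c[OF i(2)] x by simp
    then have eq: "(b \<odot>\<^bsub>M\<^esub> axis i x) k = (c 0 \<odot>\<^bsub>M\<^esub> unit_vec 0 \<oplus>\<^bsub>M\<^esub> \<rho> x \<odot>\<^bsub>M\<^esub> (c i \<odot>\<^bsub>M\<^esub> unit_vec i)) k" for k
      using b(2) by simp
    have "b = c 0" using eq[of 0] i d c[OF d(1)] c[OF i(2)] b(1) x \<rho>x by simp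
    moreover have "b \<otimes> x = \<rho> x \<otimes> c i" using eq[of i] i d c[OF d(1)] c[OF i(2)] b(1) x \<rho>x by simp
    ultimately show ?thesis by simp
  qed
  \<comment> \<open>The vector e_0 is itself a value of \<open>h\<close> on the line it spans; this
    makes c_0 invertible.\<close>
  have "\<exists>b\<in>carrier S. \<rho> b \<otimes> c 0 = \<one>"
  proof -
    have "unit_vec 0 \<in> h ` line (unit_vec 0)" using fixl[OF unimodular_unit_vec[OF d(1)]] line_self by simp
    then obtain b where b: "b \<in> carrier S" "unit_vec 0 = h (b \<odot>\<^bsub>M\<^esub> unit_vec 0)" by (auto simp: line_def)
    have \<rho>b: "\<rho> b \<in> carrier S" using \<rho> b(1) by auto
    have eq: "(unit_vec 0 :: nat \<Rightarrow> 'a) k = (\<rho> b \<odot>\<^bsub>M\<^esub> (c 0 \<odot>\<^bsub>M\<^esub> unit_vec 0)) k" for k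
      using b(2) semilinear_smult[OF h b(1) unit_vec_closed, of 0] c[OF d(1)] by simp
    have "\<one> = \<rho> b \<otimes> c 0" using eq[of 0] d c[OF d(1)] \<rho>b by simp
    then show ?thesis using b(1) by auto
  qed
  then obtain b where b: "b \<in> carrier S" "\<rho> b \<otimes> c 0 = \<one>" by blast
  have \<rho>b: "\<rho> b \<in> carrier S" using \<rho> b(1) by auto
  have c0: "c 0 \<in> Units S" using b(2) \<rho>b c[OF d(1)] m_comm[of "\<rho> b" "c 0"] unfolding Units_def by auto
  have cc: "x = y" if "x \<in> carrier S" "y \<in> carrier S" "x \<otimes> c 0 = c 0 \<otimes> y" for x y
    using that c0 c[OF d(1)] by (metis Units_l_cancel m_comm)
  \<comment> \<open>So far \<rho> is only a function; its value at 1 is obtained from h(1 e_0) =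
    \<rho>(1) h(e_0).\<close>
  have "\<rho> \<one> = \<one>"
  proof -
    have r1: "\<rho> \<one> \<in> carrier S" using \<rho> by auto
    have eq: "(h (unit_vec 0)) k = (\<rho> \<one> \<odot>\<^bsub>M\<^esub> h (unit_vec 0)) k" for k
      using semilinear_smult[OF h one_closed unit_vec_closed, of 0] by simp
    have "c 0 = \<rho> \<one> \<otimes> c 0" using eq[of 0] d c[OF d(1)] r1 by simp
    then show ?thesis using cc[OF r1 one_closed] c[OF d(1)] by simp
  qed
  then have ci: "c i = c 0" if "i < d" for i
    using key[OF _ that one_closed] c[OF d(1)] c[OF that] by (cases "i = 0") auto
  have \<rho>x: "\<rho> x = x" if x: "x \<in> carrier S" for x
    using cc[of "\<rho> x" x] key[OF zero_less_one d(2) x] ci[OF d(2)] \<rho> x by auto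
  then have "lin_aut h" using semilinear_cong[OF h] by simp
  then have lin: "linear_on (carrier M) h" using lin_aut_linear_on by blast
  have c0c: "c 0 \<in> carrier S" using c[OF d(1)] by simp
  have lin': "linear_on (carrier M) (\<lambda>v. c 0 \<odot>\<^bsub>M\<^esub> v)"
    unfolding linear_on_def using c0c by (auto simp: vec.smult_r_distr vec.smult_assoc1[symmetric] m_comm)
  have "h v = c 0 \<odot>\<^bsub>M\<^esub> v" if "v \<in> carrier M" for v
  proof (rule linear_on_eqI[OF lin lin' _ that])
    fix i assume i: "i < d"
    show "h (unit_vec i) = c 0 \<odot>\<^bsub>M\<^esub> unit_vec i" using c[OF i] unfolding ci[OF i] by blast
  qed
  then show thesis using that c0 \<rho>x by blast
qed

text \<open>If two semilinear maps act alike on vertices, one followed by the inverse of the other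
  fixes every point, so it is multiplication by a unit with trivial scalar twist.\<close>

lemma phi_inj:
  assumes A: "A \<in> carrier GLd" and \<tau>: "\<tau> \<in> carrier (ring_Aut S)"
    and B: "B \<in> carrier GLd" and \<rho>: "\<rho> \<in> carrier (ring_Aut S)" and eq: "phi A \<tau> = phi B \<rho>"
  shows "coset A = coset B" "\<tau> = \<rho>"
proof -
  note f = semilinear_act[OF A \<tau>] and g = semilinear_act[OF B \<rho>]
  note i = ring_Aut_inv[OF \<rho>]
  let ?i = "restrict (inv_into (carrier S) \<rho>) (carrier S)"
  have g': "semilinear ?i (inv_on_vecs (act B \<rho>))"
    by (rule semilinear_inv[OF g]) (use i(2) ring_Aut_closed[OF i(1)] in blast)
  let ?h = "inv_on_vecs (act B \<rho>) \<circ> act A \<tau>"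
  have h: "semilinear (\<lambda>c. ?i (\<tau> c)) ?h"
    by (rule semilinear_comp[OF g' f]) (use ring_Aut_closed[OF \<tau>] in auto)
  have gg: "act B \<rho> (?h v) = act A \<tau> v" if "v \<in> carrier M" for v
    using inv_on_vecs_right[OF g semilinear_closed[OF f that]] by simp
  obtain c where c: "c \<in> Units S" "\<And>v. v \<in> carrier M \<Longrightarrow> ?h v = c \<odot>\<^bsub>M\<^esub> v" "\<And>x. x \<in> carrier S \<Longrightarrow> ?i (\<tau> x) = x"
  proof (rule semilinear_fixing_lines[OF h])
    show "(\<lambda>c. ?i (\<tau> c)) \<in> carrier S \<rightarrow> carrier S" using ring_Aut_closed[OF \<tau>] ring_Aut_closed[OF i(1)] by simp
    fix v assume v: "unimodular v"
    note L = line_vertex[OF v]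
    have "act A \<tau> ` line v = act B \<rho> ` line v" using eq phi_apply[OF L] by metis
    then have "?h ` line v = inv_on_vecs (act B \<rho>) ` act B \<rho> ` line v" by (metis image_comp)
    also have "\<dots> = line v"
      using inv_on_vecs_left[OF g] line_closed[OF unimodular_closed[OF v]] by (force simp: image_image)
    finally show "?h ` line v = line v" .
  qed blast
  show "\<tau> = \<rho>"
  proof (rule extensionalityI[of _ "carrier S"])
    show "\<tau> \<in> extensional (carrier S)" "\<rho> \<in> extensional (carrier S)" using \<tau> \<rho> by (auto simp: ring_Aut_iff)
    show "\<tau> x = \<rho> x" if "x \<in> carrier S" for x
      using i(2)[OF ring_Aut_closed[OF \<tau> that]] c(3)[OF that] by simp
  qed
  note cc = Units_closed[OF c(1)]
  \<comment> \<open>The factor \<open>c\<close> stands inside \<open>act B \<rho>\<close>; taken out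
    of this semilinear map it becomes \<open>\<rho> c\<close>.\<close>
  let ?c = "\<rho> c"
  have rc: "?c \<in> Units S" using ring_Aut_Units[OF \<rho> c(1)] .
  have vu: "vmap \<sigma>' (unit_vec j) = unit_vec j" if "\<sigma>' \<in> carrier (ring_Aut S)" for \<sigma>' j
    by (rule vec_eqI) (use that in \<open>auto simp: vmap_closed ring_Aut_one ring_Aut_zero\<close>)
  have "A = scalar_mat ?c \<otimes>\<^bsub>MM\<^esub> B"
  proof (rule mat_eqI[OF GL_closed[OF A] mat_mult_closed[OF scalar_mat_closed[OF Units_closed[OF rc]] GL_closed[OF B]]])
    fix j assume "j < d"
    have "mv A (unit_vec j) = act A \<tau> (unit_vec j)" by (simp add: act_def vu[OF \<tau>])
    also have "\<dots> = act B \<rho> (c \<odot>\<^bsub>M\<^esub> unit_vec j)" using gg[OF unit_vec_closed, of j] c(2)[OF unit_vec_closed, of j] by simp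
    also have "\<dots> = ?c \<odot>\<^bsub>M\<^esub> act B \<rho> (unit_vec j)" using semilinear_smult[OF g cc] by simp
    also have "\<dots> = ?c \<odot>\<^bsub>M\<^esub> mv B (unit_vec j)" by (simp add: act_def vu[OF \<rho>])
    also have "\<dots> = mv (scalar_mat ?c \<otimes>\<^bsub>MM\<^esub> B) (unit_vec j)"
      using mv_mult[OF scalar_mat_closed[OF Units_closed[OF rc]] GL_closed[OF B] unit_vec_closed]
        mv_scalar_mat[OF Units_closed[OF rc] mv_closed[OF GL_closed[OF B] unit_vec_closed]] by simp
    finally show "mv A (unit_vec j) = mv (scalar_mat ?c \<otimes>\<^bsub>MM\<^esub> B) (unit_vec j)" .
  qed
  then have "A \<in> coset B" using rc by (auto simp: coset_eq GL_mult)
  then show "coset A = coset B"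
    using group.repr_independence[OF group_GL _ B normal_imp_subgroup[OF scalar_mats_normal]] by metis
qed

text \<open>With K the contragredient of \<open>A\<close>, the form of \<open>A\<close> \<tau>(v)
  and K \<tau>(u) is \<tau> of the form of v and u. So K with the same \<tau> sends the complement
  of \<open>V\<close> into the complement of the image of \<open>V\<close>, and equal ranks give
  equality.\<close>

lemma PP_phi_PP:
  assumes A: "A \<in> carrier GLd" and \<tau>: "\<tau> \<in> carrier (ring_Aut S)"
  shows "PP \<otimes>\<^bsub>GA\<^esub> phi A \<tau> \<otimes>\<^bsub>GA\<^esub> PP = phi (contragredient A) \<tau>"
proof -
  note K = contragredient_GL[OF A]
  note c = phi_in_N0[OF A \<tau>, THEN subsetD[OF N0_subset]] and kc = phi_in_N0[OF K(1) \<tau>, THEN subsetD[OF N0_subset]]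
  have f: "semilinear \<tau> (vmap \<tau>)" by (rule semilinear_vmap[OF \<tau>])
  have form_vmap: "form (vmap \<tau> v) (vmap \<tau> w) = \<tau> (form v w)" if "v \<in> carrier M" "w \<in> carrier M" for v w
  proof -
    have "\<tau> (form v w) = (\<Oplus>i\<in>{..<d}. \<tau> (v i \<otimes> w i))"
      unfolding std_form_def by (rule ring_Aut_finsum[OF \<tau>]) (use that in auto)
    also have "\<dots> = form (vmap \<tau> v) (vmap \<tau> w)"
      unfolding std_form_def by (intro finsum_cong') (use that in \<open>auto simp: ring_Aut_mult[OF \<tau>] ring_Aut_closed[OF \<tau>]\<close>)
    finally show ?thesis by simp
  qed
  have main: "act (contragredient A) \<tau> ` perp V \<subseteq> perp (act A \<tau> ` V)" if V: "V \<in> verts" for V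
  proof
    fix w assume "w \<in> act (contragredient A) \<tau> ` perp V"
    then obtain u where u: "u \<in> perp V" "w = act (contragredient A) \<tau> u" by blast
    have uc: "u \<in> carrier M" using u(1) by (simp add: perp_def)
    note tu = vmap_closed[OF \<tau> uc]
    have wc: "w \<in> carrier M" unfolding u(2) act_def by (rule mv_closed[OF GL_closed[OF K(1)] tu])
    have "form (act A \<tau> v) w = \<zero>" if v: "v \<in> V" for v
    proof -
      have vc: "v \<in> carrier M" using subspace_closed[OF vertex_subspace[OF V] v] .
      have "form (act A \<tau> v) w = form (vmap \<tau> v) (mv (mtrans A) w)"
        unfolding act_def using form_adjoint[OF lin_aut_mv[OF A] vmap_closed[OF \<tau> vc] wc] adjoint_mv[OF A wc] by simp
      also have "mv (mtrans A) w = vmap \<tau> u"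
        unfolding u(2) act_def
        using mv_mult[OF mtrans_closed[OF GL_closed[OF A]] GL_closed[OF K(1)] tu] K(2) mv_one[OF tu] by simp
      also have "form (vmap \<tau> v) (vmap \<tau> u) = \<zero>"
        using form_vmap[OF vc uc] u(1) v ring_Aut_zero[OF \<tau>] by (simp add: perp_def)
      finally show ?thesis .
    qed
    then show "w \<in> perp (act A \<tau> ` V)" using wc by (auto simp: perp_def)
  qed
  have eq: "perp (act A \<tau> ` V) = act (contragredient A) \<tau> ` perp V" if V: "V \<in> verts" for V
  proof -
    note 1 = GA_closed[OF c V] and 2 = GA_closed[OF kc perp_vertex[OF V]]
    have r: "rk (phi B \<tau> W) = rk W" if "B \<in> carrier GLd" "W \<in> verts" for B W
      using phi_in_N0[OF that(1) \<tau>] rk_order_aut that(2) by (simp add: fr_Aut0_carrier)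
    have "act (contragredient A) \<tau> ` perp V = perp (act A \<tau> ` V)"
    proof (rule vertex_eqI[OF _ _ main[OF V]])
      show "act (contragredient A) \<tau> ` perp V \<in> verts" using 2 phi_apply[OF perp_vertex[OF V]] by simp
      show "perp (act A \<tau> ` V) \<in> verts" using perp_vertex[OF 1] phi_apply[OF V] by simp
      show "rk (perp (act A \<tau> ` V)) \<le> rk (act (contragredient A) \<tau> ` perp V)"
        using rk_perp[OF 1] r[OF A V] r[OF K(1) perp_vertex[OF V]] rk_perp[OF V] phi_apply[OF V] phi_apply[OF perp_vertex[OF V]] by simp
    qed
    then show ?thesis by simp
  qed
  show ?thesis
  proof (rule GA_eqI)
    show "PP \<otimes>\<^bsub>GA\<^esub> phi A \<tau> \<otimes>\<^bsub>GA\<^esub> PP \<in> carrier GA"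
      using PP_conj[OF phi_in_N0[OF A \<tau>]] N0_subset by blast
    fix V assume V: "V \<in> verts"
    have "PP \<otimes>\<^bsub>GA\<^esub> phi A \<tau> \<otimes>\<^bsub>GA\<^esub> PP = compose verts (compose verts PP (phi A \<tau>)) PP"
      using PP_closed c by (simp add: GA_mult GA_comp_closed)
    then have "(PP \<otimes>\<^bsub>GA\<^esub> phi A \<tau> \<otimes>\<^bsub>GA\<^esub> PP) V = PP (phi A \<tau> (PP V))"
      using V perp_vertex[OF V] by (simp add: compose_def PP_apply)
    also have "\<dots> = perp (act A \<tau> ` perp V)"
      using PP_apply[OF V] PP_apply[OF GA_closed[OF c perp_vertex[OF V]]] phi_apply[OF perp_vertex[OF V]] by simp
    also have "\<dots> = act (contragredient A) \<tau> ` V" using eq[OF perp_vertex[OF V]] perp_perp[OF V] by simp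
    finally show "(PP \<otimes>\<^bsub>GA\<^esub> phi A \<tau> \<otimes>\<^bsub>GA\<^esub> PP) V = phi (contragredient A) \<tau> V" using phi_apply[OF V] by simp
  qed (rule kc)
qed

text \<open>The choice of a representative is harmless by \<open>phi_coset\<close>, so on the coset
  of \<open>A\<close> the value is that of \<open>A\<close> itself.\<close>

definition coset_phi :: "(nat \<times> nat \<Rightarrow> 'a) set \<times> ('a \<Rightarrow> 'a) \<Rightarrow> (nat \<Rightarrow> 'a) set \<Rightarrow> (nat \<Rightarrow> 'a) set" where
  "coset_phi = (\<lambda>(C, \<tau>). phi (SOME A. A \<in> C) \<tau>)"

lemma coset_phi:
  assumes A: "A \<in> carrier GLd" and \<tau>: "\<tau> \<in> carrier (ring_Aut S)"
  shows "coset_phi (coset A, \<tau>) = phi A \<tau>"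
proof -
  have "(SOME B. B \<in> coset A) \<in> coset A" by (rule someI[of "\<lambda>B. B \<in> coset A", OF mem_coset_self[OF A]])
  then show ?thesis unfolding coset_phi_def using phi_coset[OF A \<tau>] by simp
qed

lemma PGammaL_carrierE:
  assumes "x \<in> carrier (PGammaL S d)"
  obtains A \<tau> where "A \<in> carrier GLd" "\<tau> \<in> carrier (ring_Aut S)" "x = (coset A, \<tau>)"
  using assms by (auto simp: PGammaL_def semidirect_def PGL_carrier)

lemma PGammaL_carrierI:
  "A \<in> carrier GLd \<Longrightarrow> \<tau> \<in> carrier (ring_Aut S) \<Longrightarrow> (coset A, \<tau>) \<in> carrier (PGammaL S d)"
  by (auto simp: PGammaL_def semidirect_def PGL_carrier)

lemma PGammaL_mult:
  assumes "A \<in> carrier GLd" "\<tau> \<in> carrier (ring_Aut S)" "B \<in> carrier GLd"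
  shows "(coset A, \<tau>) \<otimes>\<^bsub>PGammaL S d\<^esub> (coset B, \<rho>) = (coset (A \<otimes>\<^bsub>GLd\<^esub> mmap \<tau> B), \<tau> \<otimes>\<^bsub>ring_Aut S\<^esub> \<rho>)"
  using assms by (simp add: PGammaL_def semidirect_def mmap_coset PGL_mult mmap_GL)

lemma coset_phi_mult:
  assumes "x \<in> carrier (PGammaL S d)" "y \<in> carrier (PGammaL S d)"
  shows "coset_phi (x \<otimes>\<^bsub>PGammaL S d\<^esub> y) = coset_phi x \<otimes>\<^bsub>GA\<^esub> coset_phi y"
proof -
  obtain A \<tau> where x: "A \<in> carrier GLd" "\<tau> \<in> carrier (ring_Aut S)" "x = (coset A, \<tau>)" by (rule PGammaL_carrierE[OF assms(1)])
  obtain B \<rho> where y: "B \<in> carrier GLd" "\<rho> \<in> carrier (ring_Aut S)" "y = (coset B, \<rho>)" by (rule PGammaL_carrierE[OF assms(2)])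
  note AB = group.is_monoid[OF group_GL, THEN monoid.m_closed, OF x(1) mmap_GL[OF x(2) y(1)]]
  show ?thesis
    unfolding x(3) y(3) PGammaL_mult[OF x(1,2) y(1)]
    using coset_phi[OF AB phi_mult(2)[OF x(1,2) y(1,2)]] coset_phi[OF x(1,2)] coset_phi[OF y(1,2)] phi_mult(1)[OF x(1,2) y(1,2)]
    by simp
qed

lemma coset_phi_closed: "x \<in> carrier (PGammaL S d) \<Longrightarrow> coset_phi x \<in> N0"
  by (erule PGammaL_carrierE) (simp add: coset_phi phi_in_N0)

lemma coset_phi_bij: "bij_betw coset_phi (carrier (PGammaL S d)) N0"
proof (rule bij_betw_imageI)
  show "inj_on coset_phi (carrier (PGammaL S d))"
  proof (rule inj_onI)
    fix x y assume xy: "x \<in> carrier (PGammaL S d)" "y \<in> carrier (PGammaL S d)" "coset_phi x = coset_phi y"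
    obtain A \<tau> where x: "A \<in> carrier GLd" "\<tau> \<in> carrier (ring_Aut S)" "x = (coset A, \<tau>)" by (rule PGammaL_carrierE[OF xy(1)])
    obtain B \<rho> where y: "B \<in> carrier GLd" "\<rho> \<in> carrier (ring_Aut S)" "y = (coset B, \<rho>)" by (rule PGammaL_carrierE[OF xy(2)])
    show "x = y"
      using phi_inj[OF x(1,2) y(1,2)] xy(3) coset_phi[OF x(1,2)] coset_phi[OF y(1,2)] x(3) y(3) by simp
  qed
  show "coset_phi ` carrier (PGammaL S d) = N0"
  proof (intro equalityI subsetI)
    fix \<phi> assume "\<phi> \<in> N0"
    then obtain A \<tau> where "A \<in> carrier GLd" "\<tau> \<in> carrier (ring_Aut S)" "\<phi> = phi A \<tau>" using N0_phi by blast
    then show "\<phi> \<in> coset_phi ` carrier (PGammaL S d)"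
      using coset_phi PGammaL_carrierI by (intro image_eqI[of _ _ "(coset A, \<tau>)"]) simp_all
  qed (use coset_phi_closed in blast)
qed

lemma N0_mult: "\<phi> \<otimes>\<^bsub>fr_Aut0 S d\<^esub> \<psi> = \<phi> \<otimes>\<^bsub>GA\<^esub> \<psi>"
  by (simp add: fr_Aut0_def)

lemma coset_phi_iso: "coset_phi \<in> iso (PGammaL S d) (fr_Aut0 S d)"
  by (rule isoI) (auto intro!: homI coset_phi_bij simp: coset_phi_closed coset_phi_mult N0_mult)

section \<open>The full automorphism group as a semidirect product\<close>

abbreviation "full_prod \<equiv> semidirect (PGammaL S d) (integer_mod_group 2) (inv_transpose_action S d)"

text \<open>\<open>PP\<close> stands on the right so that a pair (g, h) of the semidirect product
  goes to the product of the images of g and h. On the carrier of \<open>integer_mod_group 2\<close>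
  the exponent is 0 or 1.\<close>

definition full_phi :: "((nat \<times> nat \<Rightarrow> 'a) set \<times> ('a \<Rightarrow> 'a)) \<times> int \<Rightarrow> (nat \<Rightarrow> 'a) set \<Rightarrow> (nat \<Rightarrow> 'a) set" where
  "full_phi = (\<lambda>(x, \<epsilon>). if \<epsilon> = 0 then coset_phi x else coset_phi x \<otimes>\<^bsub>GA\<^esub> PP)"

lemma inv_transpose_action_1:
  assumes x: "x \<in> carrier (PGammaL S d)"
  shows "inv_transpose_action S d 1 x \<in> carrier (PGammaL S d)"
    "coset_phi (inv_transpose_action S d 1 x) = PP \<otimes>\<^bsub>GA\<^esub> coset_phi x \<otimes>\<^bsub>GA\<^esub> PP"
proof -
  obtain A \<tau> where A: "A \<in> carrier GLd" "\<tau> \<in> carrier (ring_Aut S)" "x = (coset A, \<tau>)" by (rule PGammaL_carrierE[OF x])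
  have eq: "inv_transpose_action S d 1 x = (coset (contragredient A), \<tau>)"
    using contragredient_coset[OF A(1)] by (simp add: inv_transpose_action_def A(3))
  show "inv_transpose_action S d 1 x \<in> carrier (PGammaL S d)"
    unfolding eq by (rule PGammaL_carrierI[OF contragredient_GL(1)[OF A(1)] A(2)])
  show "coset_phi (inv_transpose_action S d 1 x) = PP \<otimes>\<^bsub>GA\<^esub> coset_phi x \<otimes>\<^bsub>GA\<^esub> PP"
    unfolding eq using coset_phi[OF contragredient_GL(1)[OF A(1)] A(2)] coset_phi[OF A(1,2)] PP_phi_PP[OF A(1,2)] A(3) by simp
qed

lemma inv_transpose_action_0: "inv_transpose_action S d 0 x = x"
  by (simp add: inv_transpose_action_def split: prod.split)

lemma PGammaL_mult_closed:
  assumes "x \<in> carrier (PGammaL S d)" "y \<in> carrier (PGammaL S d)"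
  shows "x \<otimes>\<^bsub>PGammaL S d\<^esub> y \<in> carrier (PGammaL S d)"
proof -
  obtain A \<tau> where x: "A \<in> carrier GLd" "\<tau> \<in> carrier (ring_Aut S)" "x = (coset A, \<tau>)" by (rule PGammaL_carrierE[OF assms(1)])
  obtain B \<rho> where y: "B \<in> carrier GLd" "\<rho> \<in> carrier (ring_Aut S)" "y = (coset B, \<rho>)" by (rule PGammaL_carrierE[OF assms(2)])
  show ?thesis
    unfolding x(3) y(3) PGammaL_mult[OF x(1,2) y(1)]
    by (rule PGammaL_carrierI[OF group.is_monoid[OF group_GL, THEN monoid.m_closed, OF x(1) mmap_GL[OF x(2) y(1)]]
          phi_mult(2)[OF x(1,2) y(1,2)]])
qed

text \<open>Conjugation by \<open>PP\<close> realizes the inverse transpose action and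
  \<open>PP\<close> has order 2, which gives multiplicativity. Bijectivity holds because
  \<open>N0\<close> and its translate by \<open>PP\<close> are disjoint and cover the group.\<close>

lemma full_phi_iso: "full_phi \<in> iso full_prod GA"
proof (rule isoI)
  interpret G: group GA by (rule group_GA)
  have car: "carrier full_prod = carrier (PGammaL S d) \<times> {0, 1}"
    by (auto simp: semidirect_def carrier_integer_mod_group)
  have c: "coset_phi x \<in> carrier GA" if "x \<in> carrier (PGammaL S d)" for x
    using coset_phi_closed[OF that] N0_subset by blast
  have PPr: "z \<otimes>\<^bsub>GA\<^esub> PP \<otimes>\<^bsub>GA\<^esub> PP = z" if "z \<in> carrier GA" for z
    using that PP_closed by (simp add: G.m_assoc PP_PP)
  show "full_phi \<in> hom full_prod GA"
  proof (rule homI)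
    fix p assume "p \<in> carrier full_prod"
    then show "full_phi p \<in> carrier GA" unfolding car full_phi_def using c PP_closed by auto
  next
    fix p q assume "p \<in> carrier full_prod" "q \<in> carrier full_prod"
    then obtain x \<epsilon> y \<delta> where p: "p = (x, \<epsilon>)" "x \<in> carrier (PGammaL S d)" "\<epsilon> = 0 \<or> \<epsilon> = 1"
      and q: "q = (y, \<delta>)" "y \<in> carrier (PGammaL S d)" "\<delta> = 0 \<or> \<delta> = 1"
      unfolding car by blast
    note i = inv_transpose_action_1[OF q(2)]
    have pq: "p \<otimes>\<^bsub>full_prod\<^esub> q = (x \<otimes>\<^bsub>PGammaL S d\<^esub> inv_transpose_action S d \<epsilon> y, (\<epsilon> + \<delta>) mod 2)"
      by (simp add: p(1) q(1) semidirect_def)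
    show "full_phi (p \<otimes>\<^bsub>full_prod\<^esub> q) = full_phi p \<otimes>\<^bsub>GA\<^esub> full_phi q"
      unfolding pq using p(3) q(3) c[OF p(2)] c[OF q(2)] PP_closed
        coset_phi_mult[OF p(2) q(2)] coset_phi_mult[OF p(2) i(1)] i(2) PPr
      by (auto simp: full_phi_def p(1) q(1) inv_transpose_action_0 G.m_assoc PP_PP)
  qed
  show "bij_betw full_phi (carrier full_prod) (carrier GA)"
  proof (rule bij_betw_imageI)
    have N: "coset_phi x \<in> N0" if "x \<in> carrier (PGammaL S d)" for x by (rule coset_phi_closed[OF that])
    \<comment> \<open>If such a product were in \<open>N0\<close>, cancelling its first factor would
      put \<open>PP\<close> into \<open>N0\<close>.\<close>
    have nN: "coset_phi x \<otimes>\<^bsub>GA\<^esub> PP \<notin> N0" if x: "x \<in> carrier (PGammaL S d)" for x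
    proof
      assume "coset_phi x \<otimes>\<^bsub>GA\<^esub> PP \<in> N0"
      then have "inv\<^bsub>GA\<^esub> (coset_phi x) \<otimes>\<^bsub>GA\<^esub> (coset_phi x \<otimes>\<^bsub>GA\<^esub> PP) \<in> N0"
        using N[OF x] subgroup.m_closed[OF N0_subgroup] subgroup.m_inv_closed[OF N0_subgroup] by blast
      then show False using PP_notin_N0 c[OF x] PP_closed by (simp add: G.m_assoc[symmetric])
    qed
    have inj: "x = y" if "x \<in> carrier (PGammaL S d)" "y \<in> carrier (PGammaL S d)" "coset_phi x = coset_phi y" for x y
      using coset_phi_bij that unfolding bij_betw_def inj_on_def by blast
    show "inj_on full_phi (carrier full_prod)"
    proof (rule inj_onI)
      fix p q assume "p \<in> carrier full_prod" "q \<in> carrier full_prod" and eq: "full_phi p = full_phi q"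
      then obtain x \<epsilon> y \<delta> where p: "p = (x, \<epsilon>)" "x \<in> carrier (PGammaL S d)" "\<epsilon> = 0 \<or> \<epsilon> = 1"
        and q: "q = (y, \<delta>)" "y \<in> carrier (PGammaL S d)" "\<delta> = 0 \<or> \<delta> = 1"
        unfolding car by blast
      have "full_phi p \<in> N0 \<longleftrightarrow> \<epsilon> = 0" "full_phi q \<in> N0 \<longleftrightarrow> \<delta> = 0"
        using N[OF p(2)] nN[OF p(2)] N[OF q(2)] nN[OF q(2)] by (auto simp: full_phi_def p(1) q(1))
      then have "\<epsilon> = \<delta>" using eq p(3) q(3) by auto
      moreover have "coset_phi x = coset_phi y"
        using eq \<open>\<epsilon> = \<delta>\<close> G.right_cancel[OF PP_closed c[OF p(2)] c[OF q(2)]]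
        by (simp add: full_phi_def p(1) q(1) split: if_splits)
      ultimately show "p = q" using inj[OF p(2) q(2)] p(1) q(1) by simp
    qed
    show "full_phi ` carrier full_prod = carrier GA"
    proof (intro equalityI subsetI)
      fix \<phi> assume \<phi>: "\<phi> \<in> carrier GA"
      have surj: "\<exists>x\<in>carrier (PGammaL S d). coset_phi x = \<psi>" if "\<psi> \<in> N0" for \<psi>
        using coset_phi_bij that unfolding bij_betw_def by (metis imageE)
      from GA_cases[OF \<phi>] show "\<phi> \<in> full_phi ` carrier full_prod"
      proof
        assume "\<phi> \<in> N0"
        then obtain x where "x \<in> carrier (PGammaL S d)" "coset_phi x = \<phi>" using surj by blast
        then show ?thesis unfolding car by (intro image_eqI[of _ _ "(x, 0)"]) (simp_all add: full_phi_def)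
      next
        assume "\<phi> \<otimes>\<^bsub>GA\<^esub> PP \<in> N0"
        then obtain x where x: "x \<in> carrier (PGammaL S d)" "coset_phi x = \<phi> \<otimes>\<^bsub>GA\<^esub> PP" using surj by blast
        then have "coset_phi x \<otimes>\<^bsub>GA\<^esub> PP = \<phi>" using PPr[OF \<phi>] by simp
        then show ?thesis unfolding car using x by (intro image_eqI[of _ _ "(x, 1)"]) (simp_all add: full_phi_def)
      qed
    qed (use c PP_closed in \<open>auto simp: car full_phi_def\<close>)
  qed
qed

lemma full_prod_mult_closed:
  assumes "p \<in> carrier full_prod" "q \<in> carrier full_prod"
  shows "p \<otimes>\<^bsub>full_prod\<^esub> q \<in> carrier full_prod"
proof -
  have car: "carrier full_prod = carrier (PGammaL S d) \<times> {0, 1}"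
    by (auto simp: semidirect_def carrier_integer_mod_group)
  obtain x \<epsilon> y \<delta> where p: "p = (x, \<epsilon>)" "x \<in> carrier (PGammaL S d)" "\<epsilon> = 0 \<or> \<epsilon> = 1"
    and q: "q = (y, \<delta>)" "y \<in> carrier (PGammaL S d)" "\<delta> = 0 \<or> \<delta> = 1"
    using assms unfolding car by blast
  have "inv_transpose_action S d \<epsilon> y \<in> carrier (PGammaL S d)"
    using p(3) inv_transpose_action_1(1)[OF q(2)] q(2) by (auto simp: inv_transpose_action_0)
  then have "x \<otimes>\<^bsub>PGammaL S d\<^esub> inv_transpose_action S d \<epsilon> y \<in> carrier (PGammaL S d)"
    by (rule PGammaL_mult_closed[OF p(2)])
  moreover have "(\<epsilon> + \<delta>) mod 2 = 0 \<or> (\<epsilon> + \<delta>) mod 2 = 1" by presburger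
  ultimately show ?thesis unfolding car by (simp add: p(1) q(1) semidirect_def)
qed

text \<open>\<open>full_phi\<close> runs from the product to the group, and the isomorphism is
  wanted the other way. Its inverse is multiplicative once products stay in the carrier, which is
  \<open>full_prod_mult_closed\<close>.\<close>

lemma fr_Aut_iso: "GA \<cong> full_prod"
proof (rule is_isoI, rule isoI)
  let ?g = "inv_into (carrier full_prod) full_phi"
  have h: "full_phi \<in> hom full_prod GA" and b: "bij_betw full_phi (carrier full_prod) (carrier GA)"
    using full_phi_iso by (auto simp: iso_def)
  show b': "bij_betw ?g (carrier GA) (carrier full_prod)" by (rule bij_betw_inv_into[OF b])
  show "?g \<in> hom GA full_prod"
  proof (rule homI)
    show gc: "?g x \<in> carrier full_prod" if "x \<in> carrier GA" for x using bij_betwE[OF b'] that by blast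
    fix x y assume x: "x \<in> carrier GA" and y: "y \<in> carrier GA"
    have "full_phi (?g x \<otimes>\<^bsub>full_prod\<^esub> ?g y) = x \<otimes>\<^bsub>GA\<^esub> y"
      using hom_mult[OF h gc[OF x] gc[OF y]] bij_betw_inv_into_right[OF b x] bij_betw_inv_into_right[OF b y] by simp
    then show "?g (x \<otimes>\<^bsub>GA\<^esub> y) = ?g x \<otimes>\<^bsub>full_prod\<^esub> ?g y"
      using bij_betw_inv_into_left[OF b full_prod_mult_closed[OF gc[OF x] gc[OF y]]] by simp
  qed
qed


end


section \<open>Powers of a maximal ideal\<close>

context cring begin

definition ideal_power :: "'a set \<Rightarrow> nat \<Rightarrow> 'a set" where
  "ideal_power P n = P [^]\<^bsub>ideals_set R\<^esub> n"

lemma ideal_power_0: "ideal_power P 0 = carrier R"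
  by (simp add: ideal_power_def nat_pow_def ideals_set_def)

lemma ideal_power_Suc: "ideal_power P (Suc n) = ideal_prod R (ideal_power P n) P"
  by (simp add: ideal_power_def nat_pow_def ideals_set_def)

lemma ideal_power_ideal: "ideal P R \<Longrightarrow> ideal (ideal_power P n) R"
  by (induction n) (auto simp: ideal_power_0 ideal_power_Suc oneideal ideal_prod_is_ideal)

lemma ideal_power_subset:
  assumes "ideal P R" "n \<noteq> 0" shows "ideal_power P n \<subseteq> P"
proof -
  obtain m where "n = Suc m" using assms(2) not0_implies_Suc by blast
  then show ?thesis using ideal_prod_inter[OF ideal_power_ideal[OF assms(1)] assms(1)] by (simp add: ideal_power_Suc)
qed

text \<open>The quotient by \<open>P\<close> is a field; an inverse of the class of \<open>a\<close>
  is lifted to \<open>R\<close>.\<close>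

lemma inverse_mod_maximal:
  assumes P: "maximalideal P R" and a: "a \<in> carrier R" "a \<notin> P"
  shows "\<exists>c\<in>carrier R. \<exists>q\<in>P. a \<otimes> c \<oplus> q = \<one>"
proof -
  interpret maximalideal P R by (rule P)
  interpret F: field "R Quot P" by (rule quotient_is_field) (rule is_cring)
  have "P +> a \<noteq> \<zero>\<^bsub>R Quot P\<^esub>"
    using a_rcos_self[OF a(1)] a(2) by (auto simp: FactRing_def)
  moreover have "P +> a \<in> carrier (R Quot P)"
    using a(1) by (auto simp: FactRing_def A_RCOSETS_def')
  ultimately have "P +> a \<in> Units (R Quot P)" by (simp add: F.field_Units)
  then obtain Y where Y: "Y \<in> carrier (R Quot P)" "(P +> a) \<otimes>\<^bsub>R Quot P\<^esub> Y = \<one>\<^bsub>R Quot P\<^esub>"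
    using F.Units_r_inv_ex by blast
  then obtain c where c: "c \<in> carrier R" "Y = P +> c" by (auto simp: FactRing_def A_RCOSETS_def')
  have "P +> (a \<otimes> c) = P +> \<one>"
    using Y(2) c a(1) rcoset_mult_add[OF a(1) c(1)] by (simp add: FactRing_def)
  then have "\<one> \<in> P +> (a \<otimes> c)" using a_rcos_self[OF one_closed] by simp
  then obtain q where q: "q \<in> P" "\<one> = q \<oplus> a \<otimes> c" by (auto simp: a_r_coset_def')
  then have "a \<otimes> c \<oplus> q = \<one>" using a_comm[of q "a \<otimes> c"] a(1) c(1) a_Hcarr[OF q(1)] by simp
  then show ?thesis using c(1) q(1) by blast
qed

text \<open>From a b + p = 1 with p in the n-th power and a c + q = 1 with q in \<open>P\<close>
  follows a (b + p c) + p q = 1, and p q lies in the next power.\<close>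

lemma inverse_mod_power:
  assumes P: "maximalideal P R" and a: "a \<in> carrier R" "a \<notin> P"
  shows "\<exists>b\<in>carrier R. \<exists>p\<in>ideal_power P n. a \<otimes> b \<oplus> p = \<one>"
proof (induction n)
  case 0
  show ?case using a(1) by (intro bexI[of _ \<zero>] bexI[of _ \<one>]) (simp_all add: ideal_power_0)
next
  case (Suc n)
  have iP: "ideal P R" by (rule maximalideal.axioms(1)[OF P])
  note idl = ideal_power_ideal[OF iP]
  obtain b p where b: "b \<in> carrier R" "p \<in> ideal_power P n" "a \<otimes> b \<oplus> p = \<one>" using Suc by blast
  obtain c q where c: "c \<in> carrier R" "q \<in> P" "a \<otimes> c \<oplus> q = \<one>" using inverse_mod_maximal[OF P a] by blast
  have car: "p \<in> carrier R" "q \<in> carrier R" using ideal.Icarr[OF idl b(2)] ideal.Icarr[OF iP c(2)] by auto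
  have "a \<otimes> (b \<oplus> p \<otimes> c) \<oplus> p \<otimes> q = a \<otimes> b \<oplus> p \<otimes> (a \<otimes> c \<oplus> q)"
    using a(1) b(1) c(1) car by algebra
  then have "a \<otimes> (b \<oplus> p \<otimes> c) \<oplus> p \<otimes> q = \<one>" using b(3) c(3) car by simp
  moreover have "p \<otimes> q \<in> ideal_power P (Suc n)" unfolding ideal_power_Suc by (rule ideal_prod.prod[OF b(2) c(2)])
  ultimately show ?case using b(1) c(1) car by (intro bexI[of _ "b \<oplus> p \<otimes> c"] bexI[of _ "p \<otimes> q"]) auto
qed

text \<open>The socle element is taken in the last power of \<open>P\<close> that is not contained in \<open>P\<^sup>r\<close>.\<close>

lemma quot_power_socle_module:
  assumes P: "maximalideal P R" and r: "r \<noteq> 0" and d: "3 \<le> d"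
  shows "\<exists>s. socle_module (quot_power R P r) d s"
proof -
  have iP: "ideal P R" by (rule maximalideal.axioms(1)[OF P])
  let ?I = "ideal_power P r"
  interpret I: ideal ?I R by (rule ideal_power_ideal[OF iP])
  have S: "quot_power R P r = R Quot ?I" by (simp add: quot_power_def ideal_power_def)
  have "\<one> \<notin> ?I"
    using ideal_power_subset[OF iP r] ideal.one_imp_carrier[OF iP] maximalideal.I_notcarr[OF P] by blast
  then have n0: "\<not> ideal_power P 0 \<subseteq> ?I" by (auto simp: ideal_power_0)
  \<comment> \<open>The exponent is positive because the power 0 is the whole ring. By minimality
    some \<open>s\<close> in \<open>ideal_power P k\<close> lies outside \<open>?I\<close>, while
    its products with elements of \<open>P\<close> fall into \<open>ideal_power P n\<close> and
    hence into \<open>?I\<close>.\<close>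
  define n where "n = (LEAST n. ideal_power P n \<subseteq> ?I)"
  have n: "ideal_power P n \<subseteq> ?I" unfolding n_def by (rule LeastI[of _ r]) simp
  then obtain k where k: "n = Suc k" using n0 by (cases n) auto
  have "\<not> ideal_power P k \<subseteq> ?I" using not_less_Least[of k "\<lambda>n. ideal_power P n \<subseteq> ?I"] k by (simp add: n_def)
  then obtain s where s: "s \<in> ideal_power P k" "s \<notin> ?I" by blast
  have sc: "s \<in> carrier R" using ideal.Icarr[OF ideal_power_ideal[OF iP] s(1)] .
  have in_car: "?I +> a \<in> carrier (R Quot ?I)" if "a \<in> carrier R" for a
    using that by (auto simp: FactRing_def A_RCOSETS_def')
  have mult: "(?I +> a) \<otimes>\<^bsub>R Quot ?I\<^esub> (?I +> b) = ?I +> (a \<otimes> b)" if "a \<in> carrier R" "b \<in> carrier R" for a b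
    using I.rcoset_mult_add[OF that] by (simp add: FactRing_def)
  have zero: "\<zero>\<^bsub>R Quot ?I\<^esub> = ?I" and one: "\<one>\<^bsub>R Quot ?I\<^esub> = ?I +> \<one>" by (simp_all add: FactRing_def)
  have "socle_module (R Quot ?I) d (?I +> s)"
  proof (intro socle_module.intro socle_module_axioms.intro I.quotient_is_cring[OF is_cring] d in_car[OF sc])
    show "?I +> s \<noteq> \<zero>\<^bsub>R Quot ?I\<^esub>" using I.a_rcos_self[OF sc] s(2) zero by auto
    fix x assume "x \<in> carrier (R Quot ?I)"
    then obtain a where a: "a \<in> carrier R" "x = ?I +> a" by (auto simp: FactRing_def A_RCOSETS_def')
    \<comment> \<open>A representative in \<open>P\<close> multiplies \<open>s\<close> into the next
      power, hence to zero in the quotient; one outside \<open>P\<close> is invertible modulo every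
      power of \<open>P\<close>.\<close>
    show "x \<in> Units (R Quot ?I) \<or> (?I +> s) \<otimes>\<^bsub>R Quot ?I\<^esub> x = \<zero>\<^bsub>R Quot ?I\<^esub>"
    proof (cases "a \<in> P")
      case True
      then have "s \<otimes> a \<in> ?I" using ideal_prod.prod[OF s(1) True, of R] n k by (auto simp: ideal_power_Suc)
      then show ?thesis using mult[OF sc a(1)] I.a_rcos_const zero a(2) by simp
    next
      case False
      obtain b p where b: "b \<in> carrier R" "p \<in> ?I" "a \<otimes> b \<oplus> p = \<one>" using inverse_mod_power[OF P a(1) False] by blast
      have "\<one> = p \<oplus> a \<otimes> b" using b a(1) I.Icarr[OF b(2)] a_comm[of p "a \<otimes> b"] by simp
      then have "\<one> \<in> ?I +> (a \<otimes> b)" using b(2) by (auto simp: a_r_coset_def')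
      then have "?I +> (a \<otimes> b) = ?I +> \<one>" using I.a_repr_independence' a(1) b(1) by simp
      then have "x \<otimes>\<^bsub>R Quot ?I\<^esub> (?I +> b) = \<one>\<^bsub>R Quot ?I\<^esub>" "(?I +> b) \<otimes>\<^bsub>R Quot ?I\<^esub> x = \<one>\<^bsub>R Quot ?I\<^esub>"
        using mult[OF a(1) b(1)] mult[OF b(1) a(1)] m_comm[OF a(1) b(1)] a(2) one by simp_all
      then show ?thesis using in_car a b(1) unfolding Units_def by blast
    qed
  qed
  then show ?thesis unfolding S by blast
qed

end

theorem theorem1p3:
  fixes R :: "('a, 'm) ring_scheme" and P :: "'a set" and r d :: nat
  assumes "dedekind_domain R"
    and "primeideal P R" and "P \<noteq> {\<zero>\<^bsub>R\<^esub>}" and "finite (carrier (R Quot P))"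
    and "r \<ge> 1" and "d \<ge> 3"
  shows "let S = quot_power R P r in
         (\<forall>\<phi>\<in>carrier (fr_Aut0 S d).
            \<exists>A\<in>carrier (GL S d). \<exists>\<tau>\<in>carrier (ring_Aut S). \<phi> = phi_semilinear S d A \<tau>)
       \<and> (\<exists>\<Phi>\<in>iso (PGammaL S d) (fr_Aut0 S d).
            \<forall>A\<in>carrier (GL S d). \<forall>\<tau>\<in>carrier (ring_Aut S).
              \<Phi> (scalar_mats S d #>\<^bsub>GL S d\<^esub> A, \<tau>) = phi_semilinear S d A \<tau>)
       \<and> is_internal_semidirect (fr_Aut S d) (carrier (fr_Aut0 S d))
            (generate (fr_Aut S d) {phi_perp S d})
       \<and> fr_Aut S d \<cong> semidirect (PGammaL S d) (integer_mod_group 2) (inv_transpose_action S d)"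
proof -
  interpret dedekind_domain R by fact
  \<comment> \<open>The Dedekind property enters here: the nonzero prime \<open>P\<close> is
    maximal, so the quotient by its power has a socle element and the locale applies.\<close>
  have "maximalideal P R" by (rule nonzero_prime_maximal[OF assms(2,3)])
  then obtain s where "socle_module (quot_power R P r) d s"
    using quot_power_socle_module[of P r d] assms(5,6) by auto
  then interpret S: socle_module "quot_power R P r" d s .
  show ?thesis
    unfolding Let_def
  proof (intro conjI ballI)
    show "\<exists>\<Phi>\<in>iso (PGammaL (quot_power R P r) d) (fr_Aut0 (quot_power R P r) d).
        \<forall>A\<in>carrier (GL (quot_power R P r) d). \<forall>\<tau>\<in>carrier (ring_Aut (quot_power R P r)).
          \<Phi> (scalar_mats (quot_power R P r) d #>\<^bsub>GL (quot_power R P r) d\<^esub> A, \<tau>) =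
            phi_semilinear (quot_power R P r) d A \<tau>"
      using S.coset_phi_iso S.coset_phi by blast
  qed (fact S.N0_phi S.internal_semidirect S.fr_Aut_iso)+
qed

end
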